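(* Let $(\mathcal V,\mathcal E)$ be a finite connected directed graph with at least one boundary vertex ($\mathcal V_\partial\neq\emptyset$), with edge lengths $0<l^e<\infty$ for $e\in\mathcal E$, and let $a,b,c\in L^2(\mathcal E)$ satisfy $C_0\le a,b,c\le C_1$ a.e. on $\mathcal E$ for some constants $C_0,C_1>0$. Then there exist constants $C,\gamma>0$ such that both of the following hold. (i) (Continuous problem.) For all $\bar f,\bar g\in L^2(\mathcal E)$, every $(u,p)\in C^1([0,\infty);L^2\times L^2)\cap C([0,\infty);H(\mathrm{div})\times H^1_0)$ with $c\partial_t u+\partial_x'p+au=\bar f$, $b\partial_t p+\partial_x'u=\bar g$ on $\mathcal E$ for $t>0$ satisfies, for all $t\ge s\ge0$, $$\|u(t)-\bar u\|_{L^2}^2+\|p(t)-\bar p\|_{L^2}^2\le Ce^{-\gamma(t-s)}\big(\|u(s)-\bar u\|_{L^2}^2+\|p(s)-\bar p\|_{L^2}^2\big),$$ $$\|\partial_t u(t)\|_{L^2}^2+\|\partial_t p(t)\|_{L^2}^2\le Ce^{-\gamma(t-s)}\big(\|\partial_t u(s)\|_{L^2}^2+\|\partial_t p(s)\|_{L^2}^2\big),$$ where $(\bar u,\bar p)\in H(\mathrm{div})\times H_0^1$ is the unique solution of $\partial_x'\bar p+a\bar u=\bar f$, $\partial_x'\bar u=\bar g$. (ii) (Discrete problem, with the same constants.) Let $V_h\subset H(\mathrm{div})$ and $Q_h\subset L^2(\mathcal E)$ be any finite dimensional subspaces with $\partial_x'V_h=Q_h$ and $H^0(\mathrm{div})\subset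 V_h$, let $\bar f,\bar g\in L^2(\mathcal E)$, $u_0\in H(\mathrm{div})$, $p_0\in L^2(\mathcal E)$, $T>0$. Let $(\bar u_h,\bar p_h)\in V_h\times Q_h$ be the solution of the discrete stationary problem $$(a\bar u_h,v_h)_{\mathcal E}-(\bar p_h,\partial_x'v_h)_{\mathcal E}=(\bar f,v_h)_{\mathcal E},\qquad(\partial_x'\bar u_h,q_h)_{\mathcal E}=(\bar g,q_h)_{\mathcal E}\qquad\forall v_h\in V_h,\ q_h\in Q_h,$$ and let $(u_h,p_h)\in H^1(0,T;V_h\times Q_h)$ be the solution of the semi-discrete problem $(u_h(0),p_h(0))=\Pi_h(u_0,p_0)$ and $$(c\partial_tu_h(t),v_h)_{\mathcal E}-(p_h(t),\partial_x'v_h)_{\mathcal E}+(au_h(t),v_h)_{\mathcal E}=(\bar f,v_h)_{\mathcal E},\qquad (b\partial_tp_h(t),q_h)_{\mathcal E}+(\partial_x'u_h(t),q_h)_{\mathcal E}=(\bar g,q_h)_{\mathcal E}$$ for all $v_h\in V_h$, $q_h\in Q_h$, $t\in[0,T]$. Then for all $0\le s\le t\le T$ $$\|u_h(t)-\bar u_h\|_{L^2}^2+\|p_h(t)-\bar p_h\|_{L^2}^2\le Ce^{-\gamma(t-s)}\big(\|u_h(s)-\bar u_h\|_{L^2}^2+\|p_h(s)-\bar p_h\|_{L^2}^2\big).$$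
   Context: Network notation: $\mathcal E\subset\mathcal V\times\mathcal V$, the two end vertices of each edge being distinct; connectedness ignores edge orientation. $\mathcal E(v)$ is the set of edges having $v$ as an end vertex; $\mathcal V_0=\{v:|\mathcal E(v)|\ge2\}$ are the interior vertices and $\mathcal V_\partial=\mathcal V\setminus\mathcal V_0$ the boundary vertices. For $e\in\mathcal E$: $n^e(v)=-1$ if $e=(v,\cdot)$, $n^e(v)=1$ if $e=(\cdot,v)$, and $n^e(v)=0$ otherwise. Each edge $e=(v_l,v_r)$ is identified with the interval $[0,l^e]$, $v_l$ with $0$ and $v_r$ with $l^e$; for a function $w$ on the network, $w^e=w|_e$ and $w^e(v)$ is the value (trace) of $w^e$ at the endpoint corresponding to $v$. Function spaces: $L^2=L^2(\mathcal E)=\{w: w^e\in L^2(e)\ \forall e\}$ with $(w,z)_{\mathcal E}=\sum_e(w^e,z^e)_{L^2(e)}$ and norm $\|\cdot\|_{L^2}$; $H^1(\mathcal E)=\{w: w^e\in H^1(e)\ \forall e\}$; $\partial_x' w$ is the edgewise derivative, $(\partial_x' w)|_e=\partial_x w^e$. $H^1_0=\{p\in H^1(\mathcal E): p^e(v)=p^{e'}(v)\ \forall e,e'\in\mathcal E(v),v\in\mathcal V_0;\ p^e(v)=0\ \forall v\in\mathcal V_\partial, e\in\mathcal E(v)\}$. $H(\mathrm{div})=\{u\in H^1(\mathcal E):\sum_{e\in\mathcal E(v)}n^e(v)u^e(v)=0\ \forall v\in\mathcal V_0\}$, and $H^0(\mathrm{div})=\{u\in H(\mathrm{div}):\partial_x'u=0\}$.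 $H^1_0$ and $H(\mathrm{div})$ carry the norm $(\|w\|_{L^2}^2+\|\partial_x' w\|_{L^2}^2)^{1/2}$. Elliptic projection $\Pi_h:H(\mathrm{div})\times L^2\to V_h\times Q_h$: $\Pi_h(u,p)=(\hat u_h,\hat p_h)$ is the unique element of $V_h\times Q_h$ with $(a\hat u_h,v_h)_{\mathcal E}-(\hat p_h,\partial_x'v_h)_{\mathcal E}=(au,v_h)_{\mathcal E}-(p,\partial_x'v_h)_{\mathcal E}$ for all $v_h\in V_h$ and $(\partial_x'\hat u_h,q_h)_{\mathcal E}=(\partial_x'u,q_h)_{\mathcal E}$ for all $q_h\in Q_h$. *)

theory Defs
  imports "HOL-Analysis.Analysis"
begin

section \<open>The Hilbert space of square integrable functions on the real line\<close>

definition sq_integrable :: "(real \<Rightarrow> real) \<Rightarrow> bool" where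
  "sq_integrable f \<longleftrightarrow> f \<in> borel_measurable lborel \<and> integrable lborel (\<lambda>x. (f x)\<^sup>2)"

definition l2_rel :: "(real \<Rightarrow> real) \<Rightarrow> (real \<Rightarrow> real) \<Rightarrow> bool" where
  "l2_rel f g \<longleftrightarrow> sq_integrable f \<and> sq_integrable g \<and> (AE x in lborel. f x = g x)"

lemma sq_integrable_zero: "sq_integrable (\<lambda>x. 0)"
  by (simp add: sq_integrable_def)

lemma sq_integrable_mult:
  assumes "sq_integrable f" "sq_integrable g"
  shows "integrable lborel (\<lambda>x. f x * g x)"
proof (rule Bochner_Integration.integrable_bound)
  show "integrable lborel (\<lambda>x. (f x)\<^sup>2 + (g x)\<^sup>2)"
    using assms by (simp add: sq_integrable_def)
  show "(\<lambda>x. f x * g x) \<in> borel_measurable lborel"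
    using assms by (auto simp: sq_integrable_def intro: borel_measurable_times)
  have "\<bar>a * b\<bar> \<le> a\<^sup>2 + b\<^sup>2" for a b :: real
  proof -
    have "2 * (\<bar>a\<bar> * \<bar>b\<bar>) \<le> a\<^sup>2 + b\<^sup>2"
      using sum_squares_bound[of "\<bar>a\<bar>" "\<bar>b\<bar>"] by (simp add: mult.assoc)
    moreover have "0 \<le> \<bar>a\<bar> * \<bar>b\<bar>" by simp
    ultimately show ?thesis unfolding abs_mult by linarith
  qed
  then show "AE x in lborel. norm (f x * g x) \<le> norm ((f x)\<^sup>2 + (g x)\<^sup>2)"
    by simp
qed

lemma sq_integrable_add:
  assumes "sq_integrable f" "sq_integrable g"
  shows "sq_integrable (\<lambda>x. f x + g x)"
proof -
  have "(\<lambda>x. (f x + g x)\<^sup>2) = (\<lambda>x. (f x)\<^sup>2 + (g x)\<^sup>2 + 2 * (f x * g x))"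
    by (simp add: power2_sum algebra_simps)
  then show ?thesis
    using assms sq_integrable_mult[OF assms]
    by (auto simp: sq_integrable_def intro: borel_measurable_add)
qed

lemma sq_integrable_scale: "sq_integrable f \<Longrightarrow> sq_integrable (\<lambda>x. r * f x)"
  by (auto simp: sq_integrable_def power_mult_distrib intro: borel_measurable_times)

lemma sq_integrable_uminus: "sq_integrable f \<Longrightarrow> sq_integrable (\<lambda>x. - f x)"
  by (simp add: sq_integrable_def)

lemma sq_integrable_diff:
  "sq_integrable f \<Longrightarrow> sq_integrable g \<Longrightarrow> sq_integrable (\<lambda>x. f x - g x)"
  using sq_integrable_add[of f "\<lambda>x. - g x"] by (simp add: sq_integrable_uminus)

quotient_type l2 = "real \<Rightarrow> real" / partial: l2_rel
proof (rule part_equivpI)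
  show "\<exists>f. l2_rel f f"
    using sq_integrable_zero by (auto simp: l2_rel_def)
  show "symp l2_rel"
    by (auto simp: symp_def l2_rel_def)
  show "transp l2_rel"
  proof (rule transpI)
    fix f g h assume "l2_rel f g" "l2_rel g h"
    then show "l2_rel f h"
      unfolding l2_rel_def by (auto elim: eventually_elim2)
  qed
qed

instantiation l2 :: real_inner
begin

lift_definition zero_l2 :: l2 is "\<lambda>x. 0"
  by (simp add: l2_rel_def sq_integrable_zero)

lift_definition plus_l2 :: "l2 \<Rightarrow> l2 \<Rightarrow> l2" is "\<lambda>f g x. f x + g x"
  unfolding l2_rel_def by (auto intro: sq_integrable_add)

lift_definition uminus_l2 :: "l2 \<Rightarrow> l2" is "\<lambda>f x. - f x"
  unfolding l2_rel_def by (auto intro: sq_integrable_uminus)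

lift_definition minus_l2 :: "l2 \<Rightarrow> l2 \<Rightarrow> l2" is "\<lambda>f g x. f x - g x"
  unfolding l2_rel_def by (auto intro: sq_integrable_diff)

lift_definition scaleR_l2 :: "real \<Rightarrow> l2 \<Rightarrow> l2" is "\<lambda>r f x. r * f x"
  unfolding l2_rel_def by (auto intro: sq_integrable_scale)

lift_definition inner_l2 :: "l2 \<Rightarrow> l2 \<Rightarrow> real" is "\<lambda>f g. LINT x|lborel. f x * g x"
  unfolding l2_rel_def
  by (rule integral_cong_AE) (auto simp: sq_integrable_def)

definition norm_l2 :: "l2 \<Rightarrow> real" where "norm_l2 f = sqrt (inner f f)"

definition sgn_l2 :: "l2 \<Rightarrow> l2" where "sgn_l2 f = inverse (norm f) *\<^sub>R f"

definition dist_l2 :: "l2 \<Rightarrow> l2 \<Rightarrow> real" where "dist_l2 f g = norm (f - g)"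

definition uniformity_l2 :: "(l2 \<times> l2) filter" where
  "uniformity_l2 = (INF e\<in>{0<..}. principal {(x, y). dist x y < e})"

definition open_l2 :: "l2 set \<Rightarrow> bool" where
  "open_l2 U = (\<forall>x\<in>U. eventually (\<lambda>(x', y). x' = x \<longrightarrow> y \<in> U) uniformity)"

instance
proof
  fix f g h :: l2 and r s :: real and U :: "l2 set"
  show "f + g + h = f + (g + h)"
    by transfer (auto simp: l2_rel_def add.assoc intro!: sq_integrable_add)
  show "f + g = g + f"
    by transfer (auto simp: l2_rel_def add.commute intro!: sq_integrable_add)
  show "0 + f = f"
    by transfer (auto simp: l2_rel_def)
  show "- f + f = 0"
    by transfer (auto simp: l2_rel_def sq_integrable_zero)
  show "f - g = f + - g"
    by transfer (auto simp: l2_rel_def intro: sq_integrable_diff)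
  show "r *\<^sub>R (f + g) = r *\<^sub>R f + r *\<^sub>R g"
    by transfer (auto simp: l2_rel_def distrib_left
        intro!: sq_integrable_add sq_integrable_scale)
  show "(r + s) *\<^sub>R f = r *\<^sub>R f + s *\<^sub>R f"
    by transfer (auto simp: l2_rel_def distrib_right
        intro!: sq_integrable_add sq_integrable_scale)
  show "r *\<^sub>R s *\<^sub>R f = (r * s) *\<^sub>R f"
    by transfer (auto simp: l2_rel_def mult.assoc intro!: sq_integrable_scale)
  show "1 *\<^sub>R f = f"
    by transfer (auto simp: l2_rel_def)
  show "inner f g = inner g f"
    by transfer (simp add: mult.commute)
  show "inner (f + g) h = inner f h + inner g h"
    by transfer (simp add: l2_rel_def distrib_right sq_integrable_mult)
  show "inner (r *\<^sub>R f) g = r * inner f g"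
    by transfer (simp add: l2_rel_def mult.assoc)
  show "0 \<le> inner f f"
    by transfer simp
  show "inner f f = 0 \<longleftrightarrow> f = 0"
  proof transfer
    fix f assume "l2_rel f f"
    then have f: "sq_integrable f" by (simp add: l2_rel_def)
    have "(LINT x|lborel. f x * f x) = 0 \<longleftrightarrow> (AE x in lborel. f x * f x = 0)"
      by (rule integral_nonneg_eq_0_iff_AE) (auto intro: sq_integrable_mult f)
    then show "(LINT x|lborel. f x * f x) = 0 \<longleftrightarrow> l2_rel f (\<lambda>x. 0)"
      using f by (simp add: l2_rel_def sq_integrable_zero)
  qed
qed (simp_all add: norm_l2_def sgn_l2_def dist_l2_def uniformity_l2_def open_l2_def)

end

(* Pointwise product; only used when one factor is essentially bounded on the support of the
   other one, so that the product is again square integrable. *)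
definition l2_mult :: "l2 \<Rightarrow> l2 \<Rightarrow> l2" where
  "l2_mult f g = abs_l2 (\<lambda>x. rep_l2 f x * rep_l2 g x)"


section \<open>Lebesgue and Sobolev functions on an interval\<close>

(* L^2(0,d) is identified, isometrically, with the functions that vanish outside [0,d]. *)
definition L2_on :: "real \<Rightarrow> l2 set" where
  "L2_on d = {f. AE x in lborel. x \<notin> {0..d} \<longrightarrow> rep_l2 f x = 0}"

(* phi is a C^1 function with compact support in the open interval (0,d), with derivative phi'. *)
definition test_fun :: "real \<Rightarrow> (real \<Rightarrow> real) \<Rightarrow> (real \<Rightarrow> real) \<Rightarrow> bool" where
  "test_fun d \<phi> \<phi>' \<longleftrightarrow>
     (\<forall>x. (\<phi> has_real_derivative \<phi>' x) (at x)) \<and> continuous_on UNIV \<phi>' \<and>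
     (\<exists>r s. 0 < r \<and> s < d \<and> (\<forall>x. x \<notin> {r..s} \<longrightarrow> \<phi> x = 0))"

definition weak_deriv :: "real \<Rightarrow> l2 \<Rightarrow> l2 \<Rightarrow> bool" where
  "weak_deriv d w z \<longleftrightarrow> w \<in> L2_on d \<and> z \<in> L2_on d \<and>
     (\<forall>\<phi> \<phi>'. test_fun d \<phi> \<phi>' \<longrightarrow>
        (LINT x:{0..d}|lborel. rep_l2 w x * \<phi>' x) = - (LINT x:{0..d}|lborel. rep_l2 z x * \<phi> x))"

(* An H^1 function on an interval of positive length has exactly one representative that is
   continuous up to the end points; its values at the end points are the traces. *)
definition point_value :: "real \<Rightarrow> l2 \<Rightarrow> real \<Rightarrow> real" where
  "point_value d w y =
     (SOME g. continuous_on {0..d} g \<and> (AE x in lborel. x \<in> {0..d} \<longrightarrow> rep_l2 w x = g x)) y"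


section \<open>Networks\<close>

definition network :: "'v set \<Rightarrow> ('v \<times> 'v) set \<Rightarrow> ('v \<times> 'v \<Rightarrow> real) \<Rightarrow> bool" where
  "network V E l \<longleftrightarrow> finite V \<and> E \<subseteq> V \<times> V \<and> (\<forall>e\<in>E. fst e \<noteq> snd e) \<and>
     (\<forall>v\<in>V. \<forall>w\<in>V. (v, w) \<in> (E \<union> E\<inverse>)\<^sup>*) \<and> (\<forall>e\<in>E. 0 < l e)"

definition edges_at :: "('v \<times> 'v) set \<Rightarrow> 'v \<Rightarrow> ('v \<times> 'v) set" where
  "edges_at E v = {e \<in> E. v = fst e \<or> v = snd e}"

definition interior_vertices :: "'v set \<Rightarrow> ('v \<times> 'v) set \<Rightarrow> 'v set" where
  "interior_vertices V E = {v \<in> V. card (edges_at E v) \<ge> 2}"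

definition boundary_vertices :: "'v set \<Rightarrow> ('v \<times> 'v) set \<Rightarrow> 'v set" where
  "boundary_vertices V E = V - interior_vertices V E"

definition incidence :: "'v \<times> 'v \<Rightarrow> 'v \<Rightarrow> real" where
  "incidence e v = (if v = fst e then -1 else if v = snd e then 1 else 0)"

(* Functions on the network: one component per pair of vertices, those of non-edges being 0.
   The inner product and the norm of this type are then those of L^2 on the network. *)
type_synonym 'v net_fun = "(l2, 'v \<times> 'v) vec"

definition L2 :: "('v::finite \<times> 'v) set \<Rightarrow> ('v \<times> 'v \<Rightarrow> real) \<Rightarrow> 'v net_fun set" where
  "L2 E l = {w. (\<forall>e\<in>E. w $ e \<in> L2_on (l e)) \<and> (\<forall>e. e \<notin> E \<longrightarrow> w $ e = 0)}"

definition net_mult :: "'v::finite net_fun \<Rightarrow> 'v net_fun \<Rightarrow> 'v net_fun"  (infixl "\<odot>" 70) where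
  "a \<odot> w = (\<chi> e. l2_mult (a $ e) (w $ e))"

definition ae_between ::
  "('v::finite \<times> 'v) set \<Rightarrow> ('v \<times> 'v \<Rightarrow> real) \<Rightarrow> real \<Rightarrow> real \<Rightarrow> 'v net_fun \<Rightarrow> bool" where
  "ae_between E l C0 C1 a \<longleftrightarrow>
     (\<forall>e\<in>E. AE x in lborel. x \<in> {0..l e} \<longrightarrow> C0 \<le> rep_l2 (a $ e) x \<and> rep_l2 (a $ e) x \<le> C1)"

definition H1 :: "('v::finite \<times> 'v) set \<Rightarrow> ('v \<times> 'v \<Rightarrow> real) \<Rightarrow> 'v net_fun set" where
  "H1 E l = {w \<in> L2 E l. \<forall>e\<in>E. \<exists>z. weak_deriv (l e) (w $ e) z}"

definition dx :: "('v::finite \<times> 'v) set \<Rightarrow> ('v \<times> 'v \<Rightarrow> real) \<Rightarrow> 'v net_fun \<Rightarrow> 'v net_fun" where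
  "dx E l w = (\<chi> e. if e \<in> E then (THE z. weak_deriv (l e) (w $ e) z) else 0)"

definition trace_at :: "('v \<times> 'v \<Rightarrow> real) \<Rightarrow> 'v::finite net_fun \<Rightarrow> 'v \<times> 'v \<Rightarrow> 'v \<Rightarrow> real" where
  "trace_at l w e v = point_value (l e) (w $ e) (if v = fst e then 0 else l e)"

definition H10 ::
  "'v::finite set \<Rightarrow> ('v \<times> 'v) set \<Rightarrow> ('v \<times> 'v \<Rightarrow> real) \<Rightarrow> 'v net_fun set" where
  "H10 V E l = {p \<in> H1 E l.
     (\<forall>v\<in>interior_vertices V E. \<forall>e\<in>edges_at E v. \<forall>e'\<in>edges_at E v.
        trace_at l p e v = trace_at l p e' v) \<and>
     (\<forall>v\<in>boundary_vertices V E. \<forall>e\<in>edges_at E v. trace_at l p e v = 0)}"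

definition Hdiv ::
  "'v::finite set \<Rightarrow> ('v \<times> 'v) set \<Rightarrow> ('v \<times> 'v \<Rightarrow> real) \<Rightarrow> 'v net_fun set" where
  "Hdiv V E l = {u \<in> H1 E l.
     \<forall>v\<in>interior_vertices V E. (\<Sum>e\<in>edges_at E v. incidence e v * trace_at l u e v) = 0}"

definition H0div ::
  "'v::finite set \<Rightarrow> ('v \<times> 'v) set \<Rightarrow> ('v \<times> 'v \<Rightarrow> real) \<Rightarrow> 'v net_fun set" where
  "H0div V E l = {u \<in> Hdiv V E l. dx E l u = 0}"

definition H1_norm :: "('v::finite \<times> 'v) set \<Rightarrow> ('v \<times> 'v \<Rightarrow> real) \<Rightarrow> 'v net_fun \<Rightarrow> real" where
  "H1_norm E l w = sqrt ((norm w)\<^sup>2 + (norm (dx E l w))\<^sup>2)"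


section \<open>Functions of time\<close>

(* One-sided derivatives at the end points of S, unlike C1_differentiable_on. *)
definition C1_within :: "real set \<Rightarrow> (real \<Rightarrow> 'a::real_normed_vector) \<Rightarrow> bool" where
  "C1_within S f \<longleftrightarrow>
     (\<exists>f'. (\<forall>t\<in>S. (f has_vector_derivative f' t) (at t within S)) \<and> continuous_on S f')"

definition H1_continuous_on ::
  "('v::finite \<times> 'v) set \<Rightarrow> ('v \<times> 'v \<Rightarrow> real) \<Rightarrow> real set \<Rightarrow> (real \<Rightarrow> 'v net_fun) \<Rightarrow> bool" where
  "H1_continuous_on E l S f \<longleftrightarrow>
     (\<forall>t\<in>S. ((\<lambda>s. H1_norm E l (f s - f t)) \<longlongrightarrow> 0) (at t within S))"

definition finite_dim_subspace :: "'a::real_vector set \<Rightarrow> bool" where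
  "finite_dim_subspace X \<longleftrightarrow> (\<exists>B. finite B \<and> X = span B)"

(* f is (the continuous representative of) an element of H^1(0,T;X), where X is finite
   dimensional, and f' is a representative of its weak derivative. *)
definition H1_time ::
  "real \<Rightarrow> 'a::real_normed_vector set \<Rightarrow> (real \<Rightarrow> 'a) \<Rightarrow> (real \<Rightarrow> 'a) \<Rightarrow> bool" where
  "H1_time T X f f' \<longleftrightarrow> (\<forall>t\<in>{0..T}. f t \<in> X \<and> f' t \<in> X) \<and>
     (\<forall>t\<in>{0..T}. (f' has_integral (f t - f 0)) {0..t}) \<and>
     (\<lambda>t. (norm (f' t))\<^sup>2) integrable_on {0..T}"


section \<open>The continuous and the discrete problems\<close>

definition stationary_solution ::
  "'v::finite set \<Rightarrow> ('v \<times> 'v) set \<Rightarrow> ('v \<times> 'v \<Rightarrow> real) \<Rightarrow> 'v net_fun \<Rightarrow>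
   'v net_fun \<Rightarrow> 'v net_fun \<Rightarrow> 'v net_fun \<Rightarrow> 'v net_fun \<Rightarrow> bool" where
  "stationary_solution V E l a f g u p \<longleftrightarrow> u \<in> Hdiv V E l \<and> p \<in> H10 V E l \<and>
     dx E l p + a \<odot> u = f \<and> dx E l u = g"

definition evolution_solution ::
  "'v::finite set \<Rightarrow> ('v \<times> 'v) set \<Rightarrow> ('v \<times> 'v \<Rightarrow> real) \<Rightarrow>
   'v net_fun \<Rightarrow> 'v net_fun \<Rightarrow> 'v net_fun \<Rightarrow> 'v net_fun \<Rightarrow> 'v net_fun \<Rightarrow>
   (real \<Rightarrow> 'v net_fun) \<Rightarrow> (real \<Rightarrow> 'v net_fun) \<Rightarrow> bool" where
  "evolution_solution V E l a b c f g u p \<longleftrightarrow>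
     (\<forall>t\<ge>0. u t \<in> L2 E l \<and> p t \<in> L2 E l) \<and> C1_within {0..} u \<and> C1_within {0..} p \<and>
     (\<forall>t\<ge>0. u t \<in> Hdiv V E l \<and> p t \<in> H10 V E l) \<and>
     H1_continuous_on E l {0..} u \<and> H1_continuous_on E l {0..} p \<and>
     (\<forall>t>0. c \<odot> vector_derivative u (at t within {0..}) + dx E l (p t) + a \<odot> u t = f \<and>
            b \<odot> vector_derivative p (at t within {0..}) + dx E l (u t) = g)"

definition discrete_stationary_solution ::
  "('v::finite \<times> 'v) set \<Rightarrow> ('v \<times> 'v \<Rightarrow> real) \<Rightarrow> 'v net_fun \<Rightarrow>
   'v net_fun set \<Rightarrow> 'v net_fun set \<Rightarrow> 'v net_fun \<Rightarrow> 'v net_fun \<Rightarrow>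
   'v net_fun \<Rightarrow> 'v net_fun \<Rightarrow> bool" where
  "discrete_stationary_solution E l a Vh Qh f g uh ph \<longleftrightarrow> uh \<in> Vh \<and> ph \<in> Qh \<and>
     (\<forall>v\<in>Vh. inner (a \<odot> uh) v - inner ph (dx E l v) = inner f v) \<and>
     (\<forall>q\<in>Qh. inner (dx E l uh) q = inner g q)"

definition elliptic_projection ::
  "('v::finite \<times> 'v) set \<Rightarrow> ('v \<times> 'v \<Rightarrow> real) \<Rightarrow> 'v net_fun \<Rightarrow>
   'v net_fun set \<Rightarrow> 'v net_fun set \<Rightarrow> 'v net_fun \<times> 'v net_fun \<Rightarrow> 'v net_fun \<times> 'v net_fun" where
  "elliptic_projection E l a Vh Qh = (\<lambda>(u, p). THE (uh, ph). uh \<in> Vh \<and> ph \<in> Qh \<and>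
     (\<forall>v\<in>Vh. inner (a \<odot> uh) v - inner ph (dx E l v) = inner (a \<odot> u) v - inner p (dx E l v)) \<and>
     (\<forall>q\<in>Qh. inner (dx E l uh) q = inner (dx E l u) q))"

definition semidiscrete_solution ::
  "('v::finite \<times> 'v) set \<Rightarrow> ('v \<times> 'v \<Rightarrow> real) \<Rightarrow>
   'v net_fun \<Rightarrow> 'v net_fun \<Rightarrow> 'v net_fun \<Rightarrow> 'v net_fun set \<Rightarrow> 'v net_fun set \<Rightarrow> real \<Rightarrow>
   'v net_fun \<Rightarrow> 'v net_fun \<Rightarrow> 'v net_fun \<Rightarrow> 'v net_fun \<Rightarrow>
   (real \<Rightarrow> 'v net_fun) \<Rightarrow> (real \<Rightarrow> 'v net_fun) \<Rightarrow> bool" where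
  "semidiscrete_solution E l a b c Vh Qh T f g u0 p0 uh ph \<longleftrightarrow>
     (uh 0, ph 0) = elliptic_projection E l a Vh Qh (u0, p0) \<and>
     (\<exists>uh' ph'. H1_time T Vh uh uh' \<and> H1_time T Qh ph ph' \<and>
        (\<forall>t\<in>{0..T}.
           (\<forall>v\<in>Vh. inner (c \<odot> uh' t) v - inner (ph t) (dx E l v) + inner (a \<odot> uh t) v = inner f v) \<and>
           (\<forall>q\<in>Qh. inner (b \<odot> ph' t) q + inner (dx E l (uh t)) q = inner g q)))"

end

theory Submission
  imports Defs
begin

text \<open>
  The difference \<open>(w, q)\<close> of two solutions satisfies the homogeneous equations, and its energy
  \<open>\<E> = ((c w, w) + (b q, q)) / 2\<close> dissipates only through \<open>w\<close>: \<open>\<E>' = - (a w, w)\<close>. Damping of \<open>q\<close> is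
  recovered by subtracting \<open>\<epsilon> (c w, v)\<close>, where \<open>v\<close> is the element of minimal \<open>L\<^sup>2\<close>-norm of \<open>H(div)\<close> with
  \<open>\<partial>\<^sub>x v = b q\<close>. Indeed \<open>(c w', v) = (q, b q) - (a w, v)\<close>, while \<open>\<partial>\<^sub>x v' = b q' = - \<partial>\<^sub>x w\<close> makes \<open>v'\<close> the
  negative of the component of \<open>w\<close> orthogonal to \<open>H\<^sup>0(div)\<close>, so that \<open>(c w, v')\<close> is bounded by \<open>w\<close>
  alone. A boundary vertex and connectedness give a bounded right inverse of the derivative on
  \<open>H(div)\<close>, hence \<open>v\<close> is bounded by \<open>q\<close>. Since \<open>V\<^sub>h\<close> contains \<open>H\<^sup>0(div)\<close>, the same \<open>v\<close>, with \<open>b q\<close>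
  replaced by its projection onto \<open>Q\<^sub>h\<close>, is admissible in the discrete problem, with the same
  constants. The estimate for time derivatives follows by applying the first one to difference
  quotients.
\<close>

text \<open>The argument never uses completeness of the space of network functions. Every orthogonal
  projection is onto a finite dimensional subspace; for the minimal lift this suffices because
  elements of \<open>H0div\<close> are constant on each edge. Weak derivatives are defined by
  testing. The du Bois-Reymond lemma turns them into a normal form, primitive plus constant, from
  which traces, uniqueness of the derivative and integration by parts are computed. One operator
  \<Lambda>, depending on the network only, serves both problems: it is applied to
  \<open>b \<odot> q\<close> or to a projection of it, and projections are contractions. So the
  decay constants see only \<open>C0\<close>, \<open>C1\<close> and the bound of \<Lambda>, not
  \<open>Vh\<close> or \<open>Qh\<close>. The size of \<epsilon> has two purposes: the perturbed
  energy must stay equivalent to the squared norms, and the \<open>w\<close>-part of the cross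
  terms, split off by Young's inequality, must be covered by half of the damping. Time derivatives
  are not known to lie in \<open>Hdiv\<close> or \<open>H10\<close>, hence the detour through
  difference quotients, which do.\<close>

lemma sq_integrable_rep [simp]: "sq_integrable (rep_l2 w)"
  using Quotient3_rel_rep[OF Quotient3_l2, of w w] by (simp add: l2_rel_def)

lemma measurable_rep [measurable, simp]: "rep_l2 w \<in> borel_measurable borel"
  using sq_integrable_rep[of w] by (simp add: sq_integrable_def)

text \<open>\<open>rep_l2\<close> picks some member of a class, so the original function is
  recovered only almost everywhere. This is why pointwise identities for \<open>l2\<close> are
  stated in that sense below.\<close>

lemma rep_abs_l2: "sq_integrable f \<Longrightarrow> AE x in lborel. rep_l2 (abs_l2 f) x = f x"
proof -
  assume f: "sq_integrable f"
  have "l2_rel (rep_l2 (abs_l2 f)) f"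
    using Quotient3_rel[OF Quotient3_l2, of "rep_l2 (abs_l2 f)" f]
      Quotient3_abs_rep[OF Quotient3_l2, of "abs_l2 f"] f
    by (simp add: l2_rel_def)
  then show ?thesis by (simp add: l2_rel_def)
qed

lemma l2_eqI: "(AE x in lborel. rep_l2 f x = rep_l2 g x) \<Longrightarrow> f = g"
  by (rule Quotient3_rel_rep[OF Quotient3_l2, of f g, THEN iffD1]) (simp add: l2_rel_def)

lemma rep_add: "AE x in lborel. rep_l2 (f + g) x = rep_l2 f x + rep_l2 g x"
  unfolding plus_l2_def map_fun_def comp_def id_def
  by (rule rep_abs_l2) (simp add: sq_integrable_add)

lemma rep_diff: "AE x in lborel. rep_l2 (f - g) x = rep_l2 f x - rep_l2 g x"
  unfolding minus_l2_def map_fun_def comp_def id_def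
  by (rule rep_abs_l2) (simp add: sq_integrable_diff)

lemma rep_scaleR: "AE x in lborel. rep_l2 (r *\<^sub>R f) x = r * rep_l2 f x"
  unfolding scaleR_l2_def map_fun_def comp_def id_def
  by (rule rep_abs_l2) (simp add: sq_integrable_scale)

lemma rep_zero: "AE x in lborel. rep_l2 0 x = 0"
  unfolding zero_l2_def by (rule rep_abs_l2) (simp add: sq_integrable_zero)

lemma inner_rep: "inner f g = (LINT x|lborel. rep_l2 f x * rep_l2 g x)"
  unfolding inner_l2_def by simp

lemma inner_rep_AE:
  assumes "AE x in lborel. rep_l2 f x = F x" "AE x in lborel. rep_l2 g x = G x"
   and "F \<in> borel_measurable borel" "G \<in> borel_measurable borel"
  shows "inner f g = (LINT x|lborel. F x * G x)"
  unfolding inner_rep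
proof (rule integral_cong_AE)
  show "AE x in lborel. rep_l2 f x * rep_l2 g x = F x * G x"
    using assms(1,2) by eventually_elim simp
qed (use assms in auto)

text \<open>Gives meaning to \<open>l2_mult\<close>: the class of a pointwise product has the
  expected values only if the product is square integrable.\<close>

lemma sq_integrable_bounded_mult:
  assumes "sq_integrable f" "g \<in> borel_measurable borel" "AE x in lborel. \<bar>g x\<bar> \<le> M"
  shows "sq_integrable (\<lambda>x. g x * f x)"
proof -
  have m: "f \<in> borel_measurable borel" and i: "integrable lborel (\<lambda>x. (f x)\<^sup>2)"
    using assms by (auto simp: sq_integrable_def)
  have "integrable lborel (\<lambda>x. (g x * f x)\<^sup>2)"
  proof (rule Bochner_Integration.integrable_bound)
    show "integrable lborel (\<lambda>x. M\<^sup>2 * (f x)\<^sup>2)" using i by simp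
    show "AE x in lborel. norm ((g x * f x)\<^sup>2) \<le> norm (M\<^sup>2 * (f x)\<^sup>2)"
      using assms(3)
    proof eventually_elim
      case (elim x)
      then have "(g x)\<^sup>2 \<le> M\<^sup>2" by (metis abs_le_square_iff abs_of_nonneg abs_ge_zero order_trans)
      then show ?case by (simp add: power_mult_distrib mult_right_mono)
    qed
  qed (use m assms in measurable)
  then show ?thesis using m assms by (simp add: sq_integrable_def)
qed

text \<open>Pairing with \<open>ind x\<close> integrates over \<open>[0,x]\<close>, so primitives
  become inner products and their bounds become instances of Cauchy-Schwarz. On an edge of length
  \<open>d\<close>, \<open>ind d\<close> is also the constant function 1.\<close>

definition ind :: "real \<Rightarrow> l2" where "ind x = abs_l2 (indicator {0..x})"

lemma sq_integrable_indicator [simp]: "sq_integrable (indicator {a..b})"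
proof -
  have e: "(\<lambda>x. (indicator {a..b} x)\<^sup>2 :: real) = indicator {a..b}"
    by (auto simp: indicator_def)
  show ?thesis unfolding sq_integrable_def e
    by (auto intro!: integrable_real_indicator simp: emeasure_lborel_Icc_eq)
qed

lemma rep_ind: "AE t in lborel. rep_l2 (ind x) t = indicator {0..x} t"
  unfolding ind_def by (rule rep_abs_l2) simp

lemma inner_ind: "inner z (ind x) = (LINT t:{0..x}|lborel. rep_l2 z t)"
proof -
  have "inner z (ind x) = (LINT t|lborel. rep_l2 z t * indicator {0..x} t)"
    by (rule inner_rep_AE[OF _ rep_ind]) auto
  then show ?thesis by (simp add: set_lebesgue_integral_def mult.commute)
qed

lemma integrable_rep_on: "set_integrable lborel {a..b} (rep_l2 z)"
  using sq_integrable_mult[OF sq_integrable_indicator sq_integrable_rep]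
  by (simp add: set_integrable_def)

lemma norm_ind: "0 \<le> x \<Longrightarrow> (norm (ind x))\<^sup>2 = x"
proof -
  assume x: "0 \<le> x"
  have e: "(\<lambda>t. indicator {0..x} t * indicator {0..x} t :: real) = indicator {0..x}"
    by (auto simp: indicator_def)
  have "inner (ind x) (ind x) = (LINT t|lborel. indicator {0..x} t * indicator {0..x} t)"
    by (rule inner_rep_AE[OF rep_ind rep_ind]) auto
  then show ?thesis using x by (simp add: power2_norm_eq_inner e)
qed

section \<open>The fundamental lemma of the calculus of variations\<close>

text \<open>A pi-lambda argument: open intervals form an intersection-stable generator of the Borel
  sets, and the sets over which \<open>h\<close> integrates to zero are closed under complements and
  disjoint countable unions. Uniqueness of densities then compares \<open>h\<close> with 0.\<close>

lemma AE_zero_if_integral_intervals_zero: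
  fixes h :: "real \<Rightarrow> real"
  assumes i: "integrable lborel h"
    and z: "\<And>a b. a < b \<Longrightarrow> (LINT x:{a<..<b}|lborel. h x) = 0"
  shows "AE x in lborel. h x = 0"
proof (rule density_unique_real[OF i])
  show "integrable lborel (\<lambda>x::real. 0::real)" by simp
  have [measurable]: "h \<in> borel_measurable borel" using i by auto
  have si: "set_integrable lborel A h" if "A \<in> sets borel" for A
    using integrable_mult_indicator[OF _ i, of A] that by (simp add: set_integrable_def)
  \<comment> \<open>The complement step of the induction needs the total integral. The intervals use
    \<open>real n + 1\<close> so that they are nonempty already for \<open>n = 0\<close>, as
    \<open>z\<close> requires.\<close>
  have UN: "(LINT x:UNIV|lborel. h x) = 0"
  proof -
    have "((\<lambda>n::nat. LINT x:{-(real n+1)<..<real n+1}|lborel. h x) \<longlongrightarrow> (LINT x:(\<Union>n::nat. {-(real n+1)<..<real n+1})|lborel. h x)) sequentially"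
      by (rule set_integral_cont_up) (auto intro: si simp: incseq_def)
    moreover have "(\<Union>n::nat. {-(real n+1)<..<real n+1}) = UNIV"
    proof -
      have "\<exists>n::nat. x \<in> {-(real n+1)<..<real n+1}" for x
      proof -
        obtain n::nat where "\<bar>x\<bar> < real n" using reals_Archimedean2 by blast
        then show ?thesis by (intro exI[of _ n]) auto
      qed
      then show ?thesis by blast
    qed
    ultimately have "(\<lambda>n::nat. 0::real) \<longlonglongrightarrow> (LINT x:UNIV|lborel. h x)" by (simp add: z)
    then show ?thesis by (metis LIMSEQ_const_iff)
  qed
  fix A :: "real set" assume "A \<in> sets lborel"
  then have A: "A \<in> sigma_sets UNIV (range (\<lambda>(a, b). {a<..<b}))"
    by (simp add: borel_eq_box)
  have sb: "sigma_sets UNIV (range (\<lambda>(a, b). {a<..<b::real})) = sets borel"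
    by (simp add: borel_eq_box)
  have stable: "Int_stable (range (\<lambda>(a, b). {a<..<b::real}))"
    by (auto simp: Int_stable_def)
  have "(LINT x:A|lborel. h x) = 0"
  proof (rule sigma_sets_induct_disjoint[OF stable _ A])
    fix A assume "A \<in> range (\<lambda>(a, b). {a<..<b::real})"
    then obtain a b where A: "A = {a<..<b}" by auto
    show "(LINT x:A|lborel. h x) = 0"
    proof (cases "a < b")
      case False
      then have "A = {}" using A by auto
      then show ?thesis by (simp add: set_lebesgue_integral_def)
    qed (simp add: A z)
  next
    fix A :: "real set" assume A: "A \<in> sigma_sets UNIV (range (\<lambda>(a, b). {a<..<b}))" "(LINT x:A|lborel. h x) = 0"
    have "(LINT x:UNIV|lborel. h x) = (LINT x:A|lborel. h x) + (LINT x:UNIV - A|lborel. h x)"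
      using set_integral_Un[of A "UNIV - A" lborel h] si A sb by auto
    then show "(LINT x:UNIV - A|lborel. h x) = 0" using UN A by simp
  next
    fix A :: "nat \<Rightarrow> real set" assume A: "disjoint_family A" "range A \<subseteq> sigma_sets UNIV (range (\<lambda>(a, b). {a<..<b}))"
       "\<And>i. (LINT x:A i|lborel. h x) = 0"
    have m: "A i \<in> sets lborel" for i using A sb by auto
    have "(LINT x:\<Union>(range A)|lborel. h x) = (\<Sum>i. LINT x:A i|lborel. h x)"
      by (rule lebesgue_integral_countable_add[OF m _ si]) (use A(1) m in \<open>auto simp: disjoint_family_on_def\<close>)
    then show "(LINT x:\<Union>(range A)|lborel. h x) = 0" using A by simp
  qed (auto simp: set_lebesgue_integral_def)
  then show "(LINT x:A|lborel. h x) = (LINT x:A|lborel. 0)" by simp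
qed

text \<open>A trapezoid under the indicator of \<open>(a,b)\<close>: 0 up to distance
  \<open>1/n\<close> from the end points, 1 from distance \<open>2/n\<close> on, slope
  \<open>n\<close> in between. Continuity with support strictly inside is enough, since it is to be
  used for the derivative of a C^1 test function.\<close>

definition trap :: "real \<Rightarrow> real \<Rightarrow> nat \<Rightarrow> real \<Rightarrow> real" where
  "trap a b n x = min 1 (max 0 (real n * min (x - a) (b - x) - 1))"

lemma continuous_trap: "continuous_on S (trap a b n)"
  unfolding trap_def by (intro continuous_intros)

lemma trap_bound: "\<bar>trap a b n x\<bar> \<le> 1" "0 \<le> trap a b n x"
  by (auto simp: trap_def)

lemma trap_support: "trap a b n x \<noteq> 0 \<Longrightarrow> n > 0 \<and> a + 1 / real n \<le> x \<and> x \<le> b - 1 / real n"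
proof -
  assume "trap a b n x \<noteq> 0"
  then have *: "real n * min (x - a) (b - x) > 1" by (auto simp: trap_def max_def min_def split: if_splits)
  then have n: "n > 0" by (cases n) auto
  define m where "m = min (x - a) (b - x)"
  have "m > 1 / real n" using * n unfolding m_def[symmetric] by (simp add: divide_simps mult.commute)
  then have "min (x - a) (b - x) > 1 / real n" by (simp add: m_def)
  then show ?thesis using n by auto
qed

lemma trap_outside: "x \<notin> {a<..<b} \<Longrightarrow> trap a b n x = 0"
proof (rule ccontr)
  assume "x \<notin> {a<..<b}" "trap a b n x \<noteq> 0"
  then show False using trap_support[of a b n x]
    by (smt (verit) greaterThanLessThan_iff divide_pos_pos of_nat_0_less_iff)
qed

lemma trap_tendsto: "(\<lambda>n. trap a b n x) \<longlonglongrightarrow> indicator {a<..<b} x"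
proof (cases "x \<in> {a<..<b}")
  case True
  define m where "m = min (x - a) (b - x)"
  have m: "m > 0" using True by (auto simp: m_def)
  obtain N :: nat where N: "real N > 2 / m" using reals_Archimedean2 by blast
  have "trap a b n x = 1" if "n \<ge> N" for n
  proof -
    have "real n > 2 / m" using N that by (smt (verit) of_nat_mono)
    then have "real n * m > 2" using m by (simp add: divide_simps)
    then show ?thesis unfolding trap_def m_def[symmetric] by auto
  qed
  then have "eventually (\<lambda>n. trap a b n x = 1) sequentially"
    by (auto simp: eventually_sequentially)
  then show ?thesis using True by (simp add: tendsto_eventually)
next
  case False
  then show ?thesis by (simp add: trap_outside)
qed

lemma integral_trap_tendsto:
  fixes h :: "real \<Rightarrow> real"
  assumes "integrable lborel h"
  shows "(\<lambda>n. LINT x|lborel. h x * trap a b n x) \<longlonglongrightarrow> (LINT x:{a<..<b}|lborel. h x)"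
proof -
  have [measurable]: "h \<in> borel_measurable borel" using assms by auto
  have [measurable]: "trap a b n \<in> borel_measurable borel" for n
    by (intro borel_measurable_continuous_onI continuous_trap)
  have "(\<lambda>n. LINT x|lborel. h x * trap a b n x) \<longlonglongrightarrow> (LINT x|lborel. h x * indicator {a<..<b} x)"
  proof (rule integral_dominated_convergence[where w = "\<lambda>x. \<bar>h x\<bar>"])
    show "AE x in lborel. (\<lambda>n. h x * trap a b n x) \<longlonglongrightarrow> h x * indicator {a<..<b} x"
      by (intro AE_I2 tendsto_intros trap_tendsto)
    show "AE x in lborel. norm (h x * trap a b n x) \<le> \<bar>h x\<bar>" for n
      using trap_bound(1)[of a b n] by (auto simp: abs_mult intro!: mult_left_le)
  qed (use assms in auto)
  then show ?thesis by (simp add: set_lebesgue_integral_def mult.commute)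
qed

text \<open>The antiderivative that vanishes to the left of \<open>r\<close> is constant to the
  right of \<open>s\<close>, and this constant is the integral of \<psi>. Mean zero is therefore
  exactly what makes it compactly supported.\<close>

lemma test_fun_antiderivative:
  assumes c: "continuous_on UNIV \<psi>" and r: "0 < r" "s < d" "r \<le> s"
    and supp: "\<And>x. x \<notin> {r..s} \<Longrightarrow> \<psi> x = 0"
    and mean: "(LINT x|lborel. \<psi> x) = 0"
  obtains \<phi> where "test_fun d \<phi> \<psi>"
proof -
  have "\<exists>F. \<forall>x :: real. -\<infinity> < ereal x \<longrightarrow> ereal x < \<infinity> \<longrightarrow> (F has_vector_derivative \<psi> x) (at x)"
    by (rule einterval_antiderivative) (use c in \<open>auto simp: continuous_on_eq_continuous_at\<close>)
  then obtain F where F: "\<And>x. (F has_real_derivative \<psi> x) (at x)"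
    by (auto simp: has_real_derivative_iff_has_vector_derivative)
  define \<phi> where "\<phi> x = F x - F r" for x
  have D: "(\<phi> has_real_derivative \<psi> x) (at x)" for x
    unfolding \<phi>_def using F[of x] by (auto intro!: derivative_eq_intros)
  have cp: "continuous_on S \<phi>" for S
    by (intro continuous_at_imp_continuous_on ballI DERIV_isCont[OF D])
  have left: "\<phi> x = 0" if "x < r" for x
  proof -
    have "\<phi> r = \<phi> x"
      by (rule DERIV_isconst_end[OF that cp]) (use D supp in \<open>metis atLeastAtMost_iff not_le\<close>)
    then show ?thesis by (simp add: \<phi>_def)
  qed
  have "(LBINT x. \<psi> x * indicator {r..s} x) = \<phi> s - \<phi> r"
    by (rule integral_FTC_Icc_real[OF r(3)]) (use D c in \<open>auto simp: continuous_on_eq_continuous_at\<close>)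
  moreover have "(\<lambda>x. \<psi> x * indicator {r..s} x) = \<psi>"
    using supp by (intro ext) (auto split: split_indicator)
  ultimately have s0: "\<phi> s = 0" using mean by (simp add: \<phi>_def)
  have right: "\<phi> x = 0" if "x > s" for x
  proof -
    have "\<phi> x = \<phi> s"
      by (rule DERIV_isconst_end[OF that cp]) (use D supp in \<open>metis atLeastAtMost_iff not_le\<close>)
    then show ?thesis by (simp add: s0)
  qed
  have "test_fun d \<phi> \<psi>"
    unfolding test_fun_def using D c r left right
    by (intro conjI allI exI[of _ r] exI[of _ s]) auto
  then show thesis by (rule that)
qed

text \<open>Testing with a trapezoid on \<open>(a,b)\<close>, corrected by a multiple of the one on
  \<open>(0,d)\<close> to have mean zero, shows in the limit that the integral of \<open>f\<close>
  over \<open>(a,b)\<close> is proportional to \<open>b - a\<close>. Hence \<open>f\<close> minus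
  its mean \<open>K\<close> integrates to zero over all intervals.\<close>

lemma du_Bois_Reymond:
  assumes d: "0 < d" and f: "set_integrable lborel {0..d} f"
    and z: "\<And>\<phi> \<phi>'. test_fun d \<phi> \<phi>' \<Longrightarrow> (LINT x:{0..d}|lborel. f x * \<phi>' x) = 0"
  shows "\<exists>K. AE x in lborel. x \<in> {0..d} \<longrightarrow> f x = K"
proof -
  define h where "h x = indicator {0..d} x * f x" for x
  have h: "integrable lborel h" using f by (simp add: set_integrable_def h_def[abs_def])
  define o1 where "o1 = (indicator {0..d} :: real \<Rightarrow> real)"
  have o1: "integrable lborel o1" using d
    by (auto simp: o1_def intro!: integrable_real_indicator)
  have one: "(LINT x:{a<..<b}|lborel. o1 x) = b - a" if "0 \<le> a" "a < b" "b \<le> d" for a b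
  proof -
    have "(\<lambda>x. indicator {a<..<b} x *\<^sub>R o1 x) = indicator {a<..<b}"
      using that by (auto simp: o1_def indicator_def)
    then show ?thesis using that by (simp add: set_lebesgue_integral_def)
  qed
  define K where "K = (LINT x:{0<..<d}|lborel. h x) / d"
  have key: "(LINT x:{a<..<b}|lborel. h x) = K * (b - a)" if ab: "0 \<le> a" "a < b" "b \<le> d" for a b
  proof -
    define m where "m n = (LINT x|lborel. o1 x * trap a b n x)" for n
    define M where "M n = (LINT x|lborel. o1 x * trap 0 d n x)" for n
    have mlim: "m \<longlonglongrightarrow> b - a" unfolding m_def[abs_def] using integral_trap_tendsto[OF o1, of a b] one ab by simp
    have Mlim: "M \<longlonglongrightarrow> d" unfolding M_def[abs_def] using integral_trap_tendsto[OF o1, of 0 d] one[of 0 d] d by simp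
    \<comment> \<open>Positivity of \<open>M n\<close> allows the division in the correction factor;
      \<open>n > 2 / d\<close> makes the support interval \<open>[1/n, d - 1/n]\<close>
      nonempty.\<close>
    have e0: "eventually (\<lambda>n. M n > 0) sequentially" using order_tendstoD(1)[OF Mlim d] .
    have en: "eventually (\<lambda>n. real n > 2 / d) sequentially"
      by (metis filterlim_at_top_dense filterlim_real_sequentially)
    have ev: "eventually (\<lambda>n. (LINT x|lborel. h x * trap a b n x) = m n / M n * (LINT x|lborel. h x * trap 0 d n x)) sequentially"
      using e0 en
    proof eventually_elim
      case (elim n)
      have np: "real n > 0" using elim(2) d by (meson divide_pos_pos less_trans zero_less_numeral)
      have n2: "1 / real n \<le> d - 1 / real n"
        using elim(2) d np by (simp add: field_simps)
      \<comment> \<open>The factor \<open>m n / M n\<close> is the ratio of the two masses, which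
        makes the mean of \<psi> zero.\<close>
      define \<psi> where "\<psi> x = trap a b n x - m n / M n * trap 0 d n x" for x
      have supp: "\<psi> x = 0" if "x \<notin> {1 / real n..d - 1 / real n}" for x
      proof -
        have "trap a b n x = 0" using trap_support[of a b n x] that ab
          by (cases "trap a b n x = 0") auto
        moreover have "trap 0 d n x = 0" using trap_support[of 0 d n x] that
          by (cases "trap 0 d n x = 0") auto
        ultimately show ?thesis by (simp add: \<psi>_def)
      qed
      have oi: "integrable lborel (\<lambda>x. k x * trap a' b' n x)" if "integrable lborel k" for k :: "real \<Rightarrow> real" and a' b'
      proof (rule Bochner_Integration.integrable_bound[OF that])
        show "(\<lambda>x. k x * trap a' b' n x) \<in> borel_measurable lborel"
          using that borel_measurable_continuous_onI[OF continuous_trap[of UNIV a' b' n]] by (auto intro!: borel_measurable_times)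
        show "AE x in lborel. norm (k x * trap a' b' n x) \<le> norm (k x)"
          using trap_bound(1)[of a' b' n] by (auto simp: abs_mult intro!: mult_left_le)
      qed
      have lin: "(LINT x|lborel. k x * \<psi> x) = (LINT x|lborel. k x * trap a b n x) - m n / M n * (LINT x|lborel. k x * trap 0 d n x)"
        if "integrable lborel k" for k :: "real \<Rightarrow> real"
      proof -
        have "(\<lambda>x. k x * \<psi> x) = (\<lambda>x. k x * trap a b n x - m n / M n * (k x * trap 0 d n x))"
          by (auto simp: \<psi>_def algebra_simps)
        then show ?thesis using oi[OF that] by simp
      qed
      have so: "(\<lambda>x. o1 x * \<psi> x) = \<psi>"
      proof
        fix x show "o1 x * \<psi> x = \<psi> x"
        proof (cases "x \<in> {0..d}")
          case False
          then have "x \<notin> {1 / real n..d - 1 / real n}" using np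
            by (smt (verit) atLeastAtMost_iff divide_nonneg_nonneg)
          then show ?thesis using supp by simp
        qed (simp add: o1_def)
      qed
      have mean: "(LINT x|lborel. \<psi> x) = 0"
        using lin[OF o1] elim(1) by (simp add: so m_def[symmetric] M_def[symmetric])
      have "continuous_on UNIV \<psi>" unfolding \<psi>_def by (intro continuous_intros continuous_trap)
      from test_fun_antiderivative[OF this _ _ n2 supp mean, of d] np
      obtain \<phi> where "test_fun d \<phi> \<psi>" by auto
      from z[OF this] have "(LINT x|lborel. h x * \<psi> x) = 0"
        by (simp add: set_lebesgue_integral_def h_def mult.assoc)
      then show ?case using lin[OF h] by simp
    qed
    have "(\<lambda>n. m n / M n * (LINT x|lborel. h x * trap 0 d n x)) \<longlonglongrightarrow> (b - a) / d * (LINT x:{0<..<d}|lborel. h x)"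
      by (intro tendsto_intros mlim Mlim integral_trap_tendsto h) (use d in auto)
    moreover have "(\<lambda>n. m n / M n * (LINT x|lborel. h x * trap 0 d n x)) \<longlonglongrightarrow> (LINT x:{a<..<b}|lborel. h x)"
      by (rule Lim_transform_eventually[OF integral_trap_tendsto[OF h] ev])
    ultimately show ?thesis using LIMSEQ_unique by (fastforce simp: K_def)
  qed
  \<comment> \<open>Cutting off to the open interval reduces an arbitrary interval to its
    intersection with \<open>(0,d)\<close>, where \<open>key\<close> applies. The lost end points
    are restored as null sets.\<close>
  define H where "H x = indicator {0<..<d} x * (h x - K * o1 x)" for x
  have hk: "integrable lborel (\<lambda>x. h x - K * o1 x)" using h o1 by simp
  have Hi: "integrable lborel H"
    using integrable_mult_indicator[OF _ hk, of "{0<..<d}"] by (simp add: H_def[abs_def])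
  have "AE x in lborel. H x = 0"
  proof (rule AE_zero_if_integral_intervals_zero[OF Hi])
    fix a b :: real assume "a < b"
    define a' b' where "a' = max a 0" and "b' = min b d"
    have i: "(\<lambda>x. indicator {a<..<b} x *\<^sub>R H x) = (\<lambda>x. indicator {a'<..<b'} x *\<^sub>R (h x - K * o1 x))"
      by (auto simp: H_def indicator_def a'_def b'_def)
    show "(LINT x:{a<..<b}|lborel. H x) = 0"
    proof (cases "a' < b'")
      case True
      have si: "set_integrable lborel {a'<..<b'} h" "set_integrable lborel {a'<..<b'} o1"
        using integrable_mult_indicator[OF _ h, of "{a'<..<b'}"] integrable_mult_indicator[OF _ o1, of "{a'<..<b'}"]
        by (auto simp: set_integrable_def)
      have r: "0 \<le> a'" "b' \<le> d" by (auto simp: a'_def b'_def)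
      have "(LINT x:{a<..<b}|lborel. H x) = (LINT x:{a'<..<b'}|lborel. h x - K * o1 x)"
        unfolding set_lebesgue_integral_def i ..
      also have "\<dots> = (LINT x:{a'<..<b'}|lborel. h x) - K * (LINT x:{a'<..<b'}|lborel. o1 x)"
        using si by (subst set_integral_diff) auto
      also have "\<dots> = 0" using key[OF r(1) True r(2)] one[OF r(1) True r(2)] by simp
      finally show ?thesis .
    next
      case False
      then have "{a'<..<b'} = {}" by auto
      then show ?thesis unfolding set_lebesgue_integral_def i by simp
    qed
  qed
  moreover have "AE x in lborel. x \<noteq> 0" "AE x in lborel. x \<noteq> d"
    by (rule AE_lborel_singleton)+
  ultimately have "AE x in lborel. x \<in> {0..d} \<longrightarrow> f x = K"
    by eventually_elim (auto simp: H_def h_def o1_def)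
  then show ?thesis by blast
qed

section \<open>Primitives\<close>

text \<open>Integration by parts through Fubini, valid for merely integrable functions:
  \<open>z x * y t\<close> is integrated over the plane, split along the diagonal. The half
  \<open>t \<le> x\<close> gives the first summand and the half \<open>t > x\<close> the
  second.\<close>

lemma integral_mult_primitive:
  fixes z y :: "real \<Rightarrow> real"
  assumes z: "integrable lborel z" and y: "integrable lborel y"
  shows "(LINT x|lborel. z x * (LINT t:{..x}|lborel. y t)) + (LINT x|lborel. y x * (LINT t:{..x}|lborel. z t))
    = (LINT x|lborel. z x) * (LINT x|lborel. y x)"
proof -
  have [measurable]: "z \<in> borel_measurable borel" "y \<in> borel_measurable borel" using z y by auto
  define F where "F = (\<lambda>(x, t). z x * y t)"
  define A where "A = {p :: real \<times> real. snd p \<le> fst p}"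
  have A_borel [measurable]: "A \<in> sets (borel \<Otimes>\<^sub>M borel)"
    unfolding A_def borel_prod by (intro borel_closed closed_Collect_le continuous_intros)
  have [measurable]: "- A \<in> sets (borel \<Otimes>\<^sub>M borel)"
    using A_borel unfolding borel_prod by (rule borel_comp)
  have F: "integrable (lborel \<Otimes>\<^sub>M lborel) F"
    unfolding F_def
  proof (rule lborel_pair.Fubini_integrable)
    show "integrable lborel (\<lambda>x. LINT t|lborel. norm (case (x, t) of (x, t) \<Rightarrow> z x * y t))"
      using z by (simp add: abs_mult)
    show "AE x in lborel. integrable lborel (\<lambda>t. case (x, t) of (x, t) \<Rightarrow> z x * y t)"
      using y by simp
  qed measurable
  have i1: "integrable (lborel \<Otimes>\<^sub>M lborel) (\<lambda>p. indicator A p *\<^sub>R F p)"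
    by (rule integrable_mult_indicator[OF _ F]) measurable
  have i2: "integrable (lborel \<Otimes>\<^sub>M lborel) (\<lambda>p. indicator (- A) p *\<^sub>R F p)"
    by (rule integrable_mult_indicator[OF _ F]) measurable
  have "(LINT p|(lborel \<Otimes>\<^sub>M lborel). indicator A p *\<^sub>R F p)
      = (LINT x|lborel. (LINT t|lborel. indicator A (x, t) *\<^sub>R F (x, t)))"
    using lborel_pair.integral_fst'[OF i1] by simp
  also have "\<dots> = (LINT x|lborel. z x * (LINT t:{..x}|lborel. y t))"
  proof (rule Bochner_Integration.integral_cong[OF refl])
    fix x
    have "(LINT t|lborel. indicator A (x, t) *\<^sub>R F (x, t)) = (LINT t|lborel. z x * (indicator {..x} t *\<^sub>R y t))"
      by (rule Bochner_Integration.integral_cong) (auto simp: A_def F_def indicator_def)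
    then show "(LINT t|lborel. indicator A (x, t) *\<^sub>R F (x, t)) = z x * (LINT t:{..x}|lborel. y t)"
      by (simp add: set_lebesgue_integral_def)
  qed
  finally have 1: "(LINT p|(lborel \<Otimes>\<^sub>M lborel). indicator A p *\<^sub>R F p) = (LINT x|lborel. z x * (LINT t:{..x}|lborel. y t))" .
  have "(LINT p|(lborel \<Otimes>\<^sub>M lborel). indicator (- A) p *\<^sub>R F p)
      = (LINT x|lborel. (LINT t|lborel. indicator (- A) (t, x) *\<^sub>R F (t, x)))"
    using lborel_pair.integral_snd[of "\<lambda>x y. indicator (- A) (x, y) *\<^sub>R F (x, y)"] i2 by (simp add: case_prod_unfold)
  also have "\<dots> = (LINT x|lborel. y x * (LINT t:{..x}|lborel. z t))"
  proof (rule Bochner_Integration.integral_cong[OF refl])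
    fix x
    have "(LINT t|lborel. indicator (- A) (t, x) *\<^sub>R F (t, x)) = (LINT t|lborel. y x * (indicator {..x} t *\<^sub>R z t))"
    proof (rule integral_cong_AE)
      \<comment> \<open>The complement yields the open half line below \<open>x\<close>; it differs
        from \<open>{..x}\<close> by one point, that is, by a null set.\<close>
      show "AE t in lborel. indicator (- A) (t, x) *\<^sub>R F (t, x) = y x * (indicator {..x} t *\<^sub>R z t)"
        using AE_lborel_singleton[of x] by eventually_elim (auto simp: A_def F_def indicator_def)
      show "(\<lambda>t. indicator (- A) (t, x) *\<^sub>R F (t, x)) \<in> borel_measurable lborel"
        unfolding F_def prod.case by measurable
    qed measurable
    then show "(LINT t|lborel. indicator (- A) (t, x) *\<^sub>R F (t, x)) = y x * (LINT t:{..x}|lborel. z t)"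
      by (simp add: set_lebesgue_integral_def)
  qed
  finally have 2: "(LINT p|(lborel \<Otimes>\<^sub>M lborel). indicator (- A) p *\<^sub>R F p) = (LINT x|lborel. y x * (LINT t:{..x}|lborel. z t))" .
  have "(LINT p|(lborel \<Otimes>\<^sub>M lborel). F p) = (LINT x|lborel. (LINT t|lborel. F (x, t)))"
    using lborel_pair.integral_fst'[OF F] by simp
  also have "\<dots> = (LINT x|lborel. z x) * (LINT x|lborel. y x)"
    by (simp add: F_def)
  finally have 3: "(LINT p|(lborel \<Otimes>\<^sub>M lborel). F p) = (LINT x|lborel. z x) * (LINT x|lborel. y x)" .
  have "(LINT p|(lborel \<Otimes>\<^sub>M lborel). F p)
     = (LINT p|(lborel \<Otimes>\<^sub>M lborel). indicator A p *\<^sub>R F p + indicator (- A) p *\<^sub>R F p)"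
    by (rule Bochner_Integration.integral_cong) (auto simp: indicator_def)
  also have "\<dots> = (LINT p|(lborel \<Otimes>\<^sub>M lborel). indicator A p *\<^sub>R F p) + (LINT p|(lborel \<Otimes>\<^sub>M lborel). indicator (- A) p *\<^sub>R F p)"
    by (rule Bochner_Integration.integral_add[OF i1 i2])
  finally show ?thesis unfolding 1 2 3 by simp
qed

text \<open>Both functions are cut off to \<open>[0,d]\<close>, so that integrals over
  \<open>{..x}\<close> become integrals over \<open>[0,x]\<close> for \<open>x\<close> in
  \<open>[0,d]\<close>.\<close>

lemma parts_ind:
  "(LINT x:{0..d}|lborel. rep_l2 z x * inner y (ind x)) + (LINT x:{0..d}|lborel. rep_l2 y x * inner z (ind x))
    = inner z (ind d) * inner y (ind d)"
proof -
  define R where "R w x = indicator {0..d} x * rep_l2 w x" for w x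
  have R: "integrable lborel (R w)" for w
    using integrable_rep_on[of 0 d w] by (simp add: set_integrable_def R_def[abs_def])
  have int: "(LINT x|lborel. R w x) = inner w (ind d)" for w
    by (simp add: inner_ind R_def set_lebesgue_integral_def)
  have pr: "(LINT t:{..x}|lborel. R w t) = inner w (ind x)" if "x \<in> {0..d}" for w x
    unfolding inner_ind set_lebesgue_integral_def
    by (rule Bochner_Integration.integral_cong) (use that in \<open>auto simp: R_def indicator_def\<close>)
  have m: "(LINT x|lborel. R w x * (LINT t:{..x}|lborel. R w' t)) = (LINT x:{0..d}|lborel. rep_l2 w x * inner w' (ind x))" for w w'
    unfolding set_lebesgue_integral_def[of lborel "{0..d}"]
    by (rule Bochner_Integration.integral_cong) (auto simp: R_def[of w] indicator_def pr)
  show ?thesis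
    using integral_mult_primitive[OF R R, of z y] by (simp add: m int)
qed

lemma continuous_on_inner_ind: "continuous_on {0..d} (\<lambda>x. inner z (ind x))"
proof -
  have "inner z (ind x) = integral {0..x} (rep_l2 z)" for x
    unfolding inner_ind using integrable_rep_on by (rule set_borel_integral_eq_integral(2))
  moreover have "continuous_on {0..d} (\<lambda>x. integral {0..x} (rep_l2 z))"
    by (rule indefinite_integral_continuous_1) (rule set_borel_integral_eq_integral(1)[OF integrable_rep_on])
  ultimately show ?thesis by simp
qed

lemma measurable_inner_ind [measurable]: "(\<lambda>x. inner z (ind x)) \<in> borel_measurable borel"
proof -
  have e: "indicator {0..x} t *\<^sub>R rep_l2 z t = (if 0 \<le> t \<and> t \<le> x then rep_l2 z t else 0)" for x t
    by (simp add: indicator_def)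
  show ?thesis unfolding inner_ind set_lebesgue_integral_def e by measurable
qed

lemma inner_ind_0 [simp]: "inner z (ind 0) = 0"
  using norm_ind[of 0] by simp

lemma inner_ind_bound: "0 \<le> x \<Longrightarrow> x \<le> d \<Longrightarrow> \<bar>inner z (ind x)\<bar> \<le> sqrt d * norm z"
proof -
  assume x: "0 \<le> x" "x \<le> d"
  have "norm (ind x) = sqrt x" using norm_ind[OF x(1)] by (metis norm_ge_zero real_sqrt_unique)
  then have "\<bar>inner z (ind x)\<bar> \<le> norm z * sqrt x" by (metis Cauchy_Schwarz_ineq2)
  also have "\<dots> \<le> norm z * sqrt d" using x by (intro mult_left_mono) auto
  finally show ?thesis by (simp add: mult.commute)
qed

section \<open>Continuous representatives, point values and weak derivatives on an interval\<close>

lemma continuous_AE_eq: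
  fixes f g :: "real \<Rightarrow> real"
  assumes d: "0 < d" and c: "continuous_on {0..d} f" "continuous_on {0..d} g"
    and ae: "AE x in lborel. x \<in> {0..d} \<longrightarrow> f x = g x" and x: "x \<in> {0..d}"
  shows "f x = g x"
proof -
  have c': "continuous_on {0..d} (\<lambda>x. \<bar>f x - g x\<bar>)" by (intro continuous_intros c)
  have "(LINT x:{0..d}|lborel. \<bar>f x - g x\<bar>) = (LINT x:{0..d}|lborel. 0)"
    unfolding set_lebesgue_integral_def
  proof (rule integral_cong_AE)
    show "(\<lambda>x. indicator {0..d} x *\<^sub>R \<bar>f x - g x\<bar>) \<in> borel_measurable lborel"
      using borel_measurable_continuous_on_indicator[OF _ c'] by simp
    show "AE x in lborel. indicator {0..d} x *\<^sub>R \<bar>f x - g x\<bar> = indicator {0..d} x *\<^sub>R 0"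
      using ae by eventually_elim (auto simp: indicator_def)
  qed simp
  then have "(LINT x:{0..d}|lborel. \<bar>f x - g x\<bar>) = 0" by simp
  moreover have "set_integrable lborel {0..d} (\<lambda>x. \<bar>f x - g x\<bar>)"
    by (rule borel_integrable_atLeastAtMost'[OF c'])
  ultimately have "((\<lambda>x. \<bar>f x - g x\<bar>) has_integral 0) (cbox 0 d)"
    using has_integral_set_lebesgue set_borel_integral_eq_integral by (metis box_real(2) integrable_integral)
  then have "\<bar>f x - g x\<bar> = 0"
    by (rule has_integral_0_cbox_imp_0[rotated 2]) (use d x c' in auto)
  then show ?thesis by simp
qed

text \<open>The choice inside \<open>point_value\<close> is harmless: two continuous functions that
  agree almost everywhere on an interval of positive length agree everywhere on it, so any
  continuous representative computes the trace.\<close>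

lemma point_value_eq:
  assumes d: "0 < d" and g: "continuous_on {0..d} g"
    and ae: "AE x in lborel. x \<in> {0..d} \<longrightarrow> rep_l2 w x = g x" and y: "y \<in> {0..d}"
  shows "point_value d w y = g y"
proof -
  let ?P = "\<lambda>g. continuous_on {0..d} g \<and> (AE x in lborel. x \<in> {0..d} \<longrightarrow> rep_l2 w x = g x)"
  define k where "k = (SOME g. ?P g)"
  have "?P k" unfolding k_def by (rule someI[of ?P g]) (use g ae in simp)
  then have k: "continuous_on {0..d} k" "AE x in lborel. x \<in> {0..d} \<longrightarrow> rep_l2 w x = k x" by auto
  have "AE x in lborel. x \<in> {0..d} \<longrightarrow> k x = g x"
    using k(2) ae by eventually_elim simp
  from continuous_AE_eq[OF d k(1) g this y] show ?thesis
    by (simp add: point_value_def k_def)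
qed

lemma L2_on_add:
  assumes "f \<in> L2_on d" "g \<in> L2_on d"
  shows "f + g \<in> L2_on d"
proof -
  have "AE x in lborel. x \<notin> {0..d} \<longrightarrow> rep_l2 f x = 0" "AE x in lborel. x \<notin> {0..d} \<longrightarrow> rep_l2 g x = 0"
    using assms by (simp_all add: L2_on_def)
  then have "AE x in lborel. x \<notin> {0..d} \<longrightarrow> rep_l2 (f + g) x = 0"
    using rep_add[of f g] by eventually_elim auto
  then show ?thesis by (simp add: L2_on_def)
qed

lemma L2_on_scaleR:
  assumes "f \<in> L2_on d"
  shows "r *\<^sub>R f \<in> L2_on d"
proof -
  have "AE x in lborel. x \<notin> {0..d} \<longrightarrow> rep_l2 f x = 0"
    using assms by (simp add: L2_on_def)
  then have "AE x in lborel. x \<notin> {0..d} \<longrightarrow> rep_l2 (r *\<^sub>R f) x = 0"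
    using rep_scaleR[of r f] by eventually_elim auto
  then show ?thesis by (simp add: L2_on_def)
qed

lemma L2_on_ind [simp]: "ind d \<in> L2_on d"
  unfolding L2_on_def mem_Collect_eq using rep_ind[of d] by eventually_elim auto

lemma L2_on_zero [simp]: "0 \<in> L2_on d"
  unfolding L2_on_def mem_Collect_eq using rep_zero by eventually_elim auto

text \<open>Realises the derivative of a test function as an element \<open>y\<close> of
  \<open>l2\<close> whose primitive is \<phi>. The testing identity thereby becomes a case of
  \<open>parts_ind\<close>.\<close>

lemma test_fun_primitive:
  assumes d: "0 < d" and t: "test_fun d \<phi> \<phi>'"
  obtains y where "\<And>x. x \<in> {0..d} \<Longrightarrow> inner y (ind x) = \<phi> x" "\<phi> d = 0"
    "AE x in lborel. rep_l2 y x = indicator {0..d} x * \<phi>' x"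
proof -
  have D: "(\<phi> has_real_derivative \<phi>' x) (at x)" for x using t by (simp add: test_fun_def)
  have c: "continuous_on UNIV \<phi>'" using t by (simp add: test_fun_def)
  obtain r s where rs: "0 < r" "s < d" "\<And>x. x \<notin> {r..s} \<Longrightarrow> \<phi> x = 0" using t unfolding test_fun_def by blast
  have "bounded (\<phi>' ` {0..d})"
    by (intro compact_imp_bounded compact_continuous_image continuous_on_subset[OF c]) auto
  then obtain M where M: "\<forall>x\<in>{0..d}. \<bar>\<phi>' x\<bar> \<le> M"
    unfolding bounded_iff by auto
  have mm: "\<phi>' \<in> borel_measurable borel" using c by (rule borel_measurable_continuous_onI)
  \<comment> \<open>The indicator is doubled: one copy makes \<phi>' bounded, the other is the
    square integrable factor.\<close>
  have "sq_integrable (\<lambda>x. (indicator {0..d} x * \<phi>' x) * indicator {0..d} x)"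
  proof (rule sq_integrable_bounded_mult[where M = "\<bar>M\<bar>"])
    show "AE x in lborel. \<bar>indicator {0..d} x * \<phi>' x\<bar> \<le> \<bar>M\<bar>"
      using M by (intro AE_I2) (auto split: split_indicator intro: order_trans[OF _ abs_ge_self])
    show "(\<lambda>x. indicator {0..d} x * \<phi>' x) \<in> borel_measurable borel"
      using mm by simp
  qed simp
  moreover have "(\<lambda>x. (indicator {0..d} x * \<phi>' x) * indicator {0..d} x) = (\<lambda>x. indicator {0..d} x * \<phi>' x)"
    by (auto simp: indicator_def)
  ultimately have sq: "sq_integrable (\<lambda>x. indicator {0..d} x * \<phi>' x)" by simp
  define y where "y = abs_l2 (\<lambda>x. indicator {0..d} x * \<phi>' x)"
  have rep: "AE x in lborel. rep_l2 y x = indicator {0..d} x * \<phi>' x"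
    unfolding y_def by (rule rep_abs_l2[OF sq])
  have "inner y (ind x) = \<phi> x" if x: "x \<in> {0..d}" for x
  proof -
    have "inner y (ind x) = (LINT t|lborel. indicator {0..d} t * \<phi>' t * indicator {0..x} t)"
      by (rule inner_rep_AE[OF rep rep_ind]) (use mm in auto)
    also have "\<dots> = (LINT t|lborel. \<phi>' t * indicator {0..x} t)"
      by (rule Bochner_Integration.integral_cong) (use x in \<open>auto simp: indicator_def\<close>)
    also have "\<dots> = \<phi> x - \<phi> 0"
      by (rule integral_FTC_Icc_real) (use x D c in \<open>auto simp: continuous_on_eq_continuous_at\<close>)
    finally show ?thesis using rs by simp
  qed
  moreover have "\<phi> d = 0" using rs by simp
  ultimately show thesis using that rep by blast
qed

text \<open>Forwards, \<open>w\<close> minus the primitive of \<open>z\<close> is annihilated by all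
  derivatives of test functions, hence constant by \<open>du_Bois_Reymond\<close>. Backwards, it is
  integration by parts against the test function.\<close>

lemma weak_deriv_iff:
  assumes d: "0 < d"
  shows "weak_deriv d w z \<longleftrightarrow> w \<in> L2_on d \<and> z \<in> L2_on d \<and>
    (\<exists>\<alpha>. AE x in lborel. x \<in> {0..d} \<longrightarrow> rep_l2 w x = \<alpha> + inner z (ind x))"
proof -
  have id: "integrable lborel (\<lambda>x. indicator {0..d} x :: real)" using d
    by (auto intro!: integrable_real_indicator)
  have Iz: "set_integrable lborel {0..d} (\<lambda>x. inner z (ind x))"
    by (rule borel_integrable_atLeastAtMost'[OF continuous_on_inner_ind])
  \<comment> \<open>Both directions rest on these two facts: the boundary term drops because \<phi>
    vanishes at \<open>d\<close>, and the additive constant \<alpha> drops because \<phi>' has mean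
    zero.\<close>
  have parts: "(LINT x:{0..d}|lborel. inner z (ind x) * \<phi>' x) = - (LINT x:{0..d}|lborel. rep_l2 z x * \<phi> x)"
    and mean: "(LINT x:{0..d}|lborel. \<phi>' x) = 0" if t: "test_fun d \<phi> \<phi>'" for \<phi> \<phi>'
  proof -
    from test_fun_primitive[OF d t] obtain y where
      y: "\<And>x. x \<in> {0..d} \<Longrightarrow> inner y (ind x) = \<phi> x" "\<phi> d = 0"
      "AE x in lborel. rep_l2 y x = indicator {0..d} x * \<phi>' x" by blast
    have mm: "\<phi>' \<in> borel_measurable borel" using t unfolding test_fun_def by (auto intro: borel_measurable_continuous_onI)
    have 1: "(LINT x:{0..d}|lborel. rep_l2 y x * k x) = (LINT x:{0..d}|lborel. k x * \<phi>' x)"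
      if "k \<in> borel_measurable borel" for k
      unfolding set_lebesgue_integral_def
    proof (rule integral_cong_AE)
      show "AE x in lborel. indicator {0..d} x *\<^sub>R (rep_l2 y x * k x) = indicator {0..d} x *\<^sub>R (k x * \<phi>' x)"
        using y(3) by eventually_elim (auto simp: indicator_def)
    qed (use that mm in measurable)
    have 2: "(LINT x:{0..d}|lborel. rep_l2 z x * inner y (ind x)) = (LINT x:{0..d}|lborel. rep_l2 z x * \<phi> x)"
      by (rule set_lebesgue_integral_cong) (auto simp: y)
    have "(LINT x:{0..d}|lborel. rep_l2 z x * \<phi> x) + (LINT x:{0..d}|lborel. inner z (ind x) * \<phi>' x)
        = inner z (ind d) * inner y (ind d)"
      using parts_ind[of d z y] unfolding 2 1[OF measurable_inner_ind] .
    then show "(LINT x:{0..d}|lborel. inner z (ind x) * \<phi>' x) = - (LINT x:{0..d}|lborel. rep_l2 z x * \<phi> x)"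
      using y d by simp
    show "(LINT x:{0..d}|lborel. \<phi>' x) = 0"
      using 1[of "\<lambda>_. 1"] y d inner_ind[of y d] by simp
  qed
  show ?thesis
  proof
    assume wd: "weak_deriv d w z"
    have "\<exists>K. AE x in lborel. x \<in> {0..d} \<longrightarrow> rep_l2 w x - inner z (ind x) = K"
    proof (rule du_Bois_Reymond[OF d])
      show "set_integrable lborel {0..d} (\<lambda>x. rep_l2 w x - inner z (ind x))"
        by (rule set_integral_diff(1)[OF integrable_rep_on Iz])
      fix \<phi> \<phi>' assume t: "test_fun d \<phi> \<phi>'"
      have cc: "continuous_on UNIV \<phi>'" using t by (simp add: test_fun_def)
      from test_fun_primitive[OF d t] obtain y where
        y: "AE x in lborel. rep_l2 y x = indicator {0..d} x * \<phi>' x" by blast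
      have mm: "\<phi>' \<in> borel_measurable borel" using cc by (rule borel_measurable_continuous_onI)
      have i1: "set_integrable lborel {0..d} (\<lambda>x. rep_l2 w x * \<phi>' x)"
      proof -
        have "integrable lborel (\<lambda>x. rep_l2 w x * rep_l2 y x)" by (intro sq_integrable_mult) auto
        then show ?thesis unfolding set_integrable_def
        proof (rule integrable_cong_AE_imp)
          show "AE x in lborel. rep_l2 w x * rep_l2 y x = indicator {0..d} x *\<^sub>R (rep_l2 w x * \<phi>' x)"
            using y by eventually_elim auto
        qed (use mm in measurable)
      qed
      have i2: "set_integrable lborel {0..d} (\<lambda>x. inner z (ind x) * \<phi>' x)"
        by (rule borel_integrable_atLeastAtMost') (intro continuous_intros continuous_on_inner_ind continuous_on_subset[OF cc], simp)
      have "(LINT x:{0..d}|lborel. (rep_l2 w x - inner z (ind x)) * \<phi>' x)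
         = (LINT x:{0..d}|lborel. rep_l2 w x * \<phi>' x) - (LINT x:{0..d}|lborel. inner z (ind x) * \<phi>' x)"
        using set_integral_diff(2)[OF i1 i2] by (simp add: left_diff_distrib)
      then show "(LINT x:{0..d}|lborel. (rep_l2 w x - inner z (ind x)) * \<phi>' x) = 0"
        using wd t parts[OF t] by (simp add: weak_deriv_def)
    qed
    then obtain K where "AE x in lborel. x \<in> {0..d} \<longrightarrow> rep_l2 w x - inner z (ind x) = K" by blast
    then have "AE x in lborel. x \<in> {0..d} \<longrightarrow> rep_l2 w x = K + inner z (ind x)"
      by eventually_elim auto
    then show "w \<in> L2_on d \<and> z \<in> L2_on d \<and> (\<exists>\<alpha>. AE x in lborel. x \<in> {0..d} \<longrightarrow> rep_l2 w x = \<alpha> + inner z (ind x))"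
      using wd by (auto simp: weak_deriv_def)
  next
    assume a: "w \<in> L2_on d \<and> z \<in> L2_on d \<and> (\<exists>\<alpha>. AE x in lborel. x \<in> {0..d} \<longrightarrow> rep_l2 w x = \<alpha> + inner z (ind x))"
    then obtain \<alpha> where al: "AE x in lborel. x \<in> {0..d} \<longrightarrow> rep_l2 w x = \<alpha> + inner z (ind x)" by blast
    have "(LINT x:{0..d}|lborel. rep_l2 w x * \<phi>' x) = - (LINT x:{0..d}|lborel. rep_l2 z x * \<phi> x)"
      if t: "test_fun d \<phi> \<phi>'" for \<phi> \<phi>'
    proof -
      have cc: "continuous_on UNIV \<phi>'" using t by (simp add: test_fun_def)
      have mm: "\<phi>' \<in> borel_measurable borel" using cc by (rule borel_measurable_continuous_onI)
      have i1: "set_integrable lborel {0..d} (\<lambda>x. \<alpha> * \<phi>' x)"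
        by (rule borel_integrable_atLeastAtMost') (intro continuous_intros continuous_on_subset[OF cc], simp)
      have i2: "set_integrable lborel {0..d} (\<lambda>x. inner z (ind x) * \<phi>' x)"
        by (rule borel_integrable_atLeastAtMost') (intro continuous_intros continuous_on_inner_ind continuous_on_subset[OF cc], simp)
      have "(LINT x:{0..d}|lborel. rep_l2 w x * \<phi>' x) = (LINT x:{0..d}|lborel. \<alpha> * \<phi>' x + inner z (ind x) * \<phi>' x)"
        unfolding set_lebesgue_integral_def
      proof (rule integral_cong_AE)
        show "AE x in lborel. indicator {0..d} x *\<^sub>R (rep_l2 w x * \<phi>' x) = indicator {0..d} x *\<^sub>R (\<alpha> * \<phi>' x + inner z (ind x) * \<phi>' x)"
          using al by eventually_elim (auto simp: indicator_def algebra_simps)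
      qed (use mm in measurable)
      also have "\<dots> = \<alpha> * (LINT x:{0..d}|lborel. \<phi>' x) + (LINT x:{0..d}|lborel. inner z (ind x) * \<phi>' x)"
        using set_integral_add(2)[OF i1 i2] by simp
      finally show ?thesis using parts[OF t] mean[OF t] by simp
    qed
    then show "weak_deriv d w z" using a by (auto simp: weak_deriv_def)
  qed
qed

text \<open>The primitive that vanishes at 0, cut off outside \<open>[0,d]\<close> so that it stays
  in \<open>L2_on d\<close>. It is the linear building block of all H^1 functions on the
  interval.\<close>

definition prim :: "real \<Rightarrow> l2 \<Rightarrow> l2" where
  "prim d z = abs_l2 (\<lambda>x. indicator {0..d} x * inner z (ind x))"

lemma rep_prim: "AE x in lborel. rep_l2 (prim d z) x = indicator {0..d} x * inner z (ind x)"
  unfolding prim_def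
proof (rule rep_abs_l2)
  have "sq_integrable (\<lambda>x. (indicator {0..d} x * inner z (ind x)) * indicator {0..d} x)"
  proof (rule sq_integrable_bounded_mult[where M = "\<bar>sqrt d * norm z\<bar>"])
    show "AE x in lborel. \<bar>indicator {0..d} x * inner z (ind x)\<bar> \<le> \<bar>sqrt d * norm z\<bar>"
      by (intro AE_I2) (auto split: split_indicator intro: order_trans[OF inner_ind_bound])
  qed auto
  moreover have "(\<lambda>x. (indicator {0..d} x * inner z (ind x)) * indicator {0..d} x) = (\<lambda>x. indicator {0..d} x * inner z (ind x))"
    by (auto split: split_indicator)
  ultimately show "sq_integrable (\<lambda>x. indicator {0..d} x * inner z (ind x))" by simp
qed

lemma prim_add: "prim d (z + y) = prim d z + prim d y"
proof (rule l2_eqI)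
  show "AE x in lborel. rep_l2 (prim d (z + y)) x = rep_l2 (prim d z + prim d y) x"
    using rep_prim[of d "z + y"] rep_prim[of d z] rep_prim[of d y] rep_add[of "prim d z" "prim d y"]
    by eventually_elim (simp add: inner_add_left algebra_simps)
qed

lemma prim_scaleR: "prim d (r *\<^sub>R z) = r *\<^sub>R prim d z"
proof (rule l2_eqI)
  show "AE x in lborel. rep_l2 (prim d (r *\<^sub>R z)) x = rep_l2 (r *\<^sub>R prim d z) x"
    using rep_prim[of d "r *\<^sub>R z"] rep_prim[of d z] rep_scaleR[of r "prim d z"]
    by eventually_elim simp
qed

lemma norm_prim_le:
  assumes d: "0 \<le> d"
  shows "norm (prim d z) \<le> norm z * d"
proof -
  have "(norm (prim d z))\<^sup>2 = (LINT x|lborel. (indicator {0..d} x * inner z (ind x)) * (indicator {0..d} x * inner z (ind x)))"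
    unfolding power2_norm_eq_inner by (rule inner_rep_AE[OF rep_prim rep_prim]) auto
  also have "\<dots> \<le> (LINT x|lborel. (d * (norm z)\<^sup>2) * indicator {0..d} x)"
  proof (rule Bochner_Integration.integral_mono')
    show "integrable lborel (\<lambda>x. (d * (norm z)\<^sup>2) * indicator {0..d} x)"
      using d by (intro integrable_mult_right integrable_real_indicator) auto
    fix x :: real
    show "(indicator {0..d} x * inner z (ind x)) * (indicator {0..d} x * inner z (ind x)) \<le> (d * (norm z)\<^sup>2) * indicator {0..d} x"
    proof (cases "x \<in> {0..d}")
      case True
      then have "\<bar>inner z (ind x)\<bar> \<le> sqrt d * norm z" by (intro inner_ind_bound) auto
      then have "(inner z (ind x))\<^sup>2 \<le> (sqrt d * norm z)\<^sup>2" by (metis abs_ge_zero power2_abs power_mono)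
      then have "(inner z (ind x))\<^sup>2 \<le> d * (norm z)\<^sup>2" using d by (simp add: power_mult_distrib)
      then show ?thesis using True by (simp add: power2_eq_square)
    qed simp
  qed (use d in \<open>auto split: split_indicator\<close>)
  also have "\<dots> = (norm z * d)\<^sup>2" using d by (simp add: power2_eq_square)
  finally show ?thesis using d by (simp add: power2_le_iff_abs_le)
qed

lemma bounded_linear_prim: "0 \<le> d \<Longrightarrow> bounded_linear (prim d)"
  by (rule bounded_linear_intro[where K = d]) (auto simp: prim_add prim_scaleR norm_prim_le)

lemma prim_L2_on [simp]: "prim d z \<in> L2_on d"
  unfolding L2_on_def mem_Collect_eq using rep_prim[of d z] by eventually_elim auto

lemma rep_prim_ind:
  "AE x in lborel. rep_l2 (prim d z + \<alpha> *\<^sub>R ind d) x = indicator {0..d} x * (\<alpha> + inner z (ind x))"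
  using rep_prim[of d z] rep_add[of "prim d z" "\<alpha> *\<^sub>R ind d"] rep_scaleR[of \<alpha> "ind d"] rep_ind[of d]
  by eventually_elim (simp add: algebra_simps)

lemma weak_deriv_prim:
  assumes "0 < d" "z \<in> L2_on d"
  shows "weak_deriv d (prim d z + \<alpha> *\<^sub>R ind d) z"
  unfolding weak_deriv_iff[OF assms(1)]
proof (intro conjI exI)
  show "AE x in lborel. x \<in> {0..d} \<longrightarrow> rep_l2 (prim d z + \<alpha> *\<^sub>R ind d) x = \<alpha> + inner z (ind x)"
    using rep_prim_ind[of d z \<alpha>] by eventually_elim auto
qed (auto intro!: L2_on_add L2_on_scaleR assms)

lemma point_value_prim:
  assumes "0 < d" "y \<in> {0..d}"
  shows "point_value d (prim d z + \<alpha> *\<^sub>R ind d) y = \<alpha> + inner z (ind y)"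
proof (rule point_value_eq[OF assms(1) _ _ assms(2)])
  show "continuous_on {0..d} (\<lambda>x. \<alpha> + inner z (ind x))"
    by (intro continuous_intros continuous_on_inner_ind)
  show "AE x in lborel. x \<in> {0..d} \<longrightarrow> rep_l2 (prim d z + \<alpha> *\<^sub>R ind d) x = \<alpha> + inner z (ind x)"
    using rep_prim_ind[of d z \<alpha>] by eventually_elim auto
qed

text \<open>The normal form behind the calculus of traces: an H^1 function is the primitive of its
  derivative plus its value at 0. Linearity of traces and integration by parts reduce to linear
  algebra with \<open>prim\<close> and \<open>ind\<close>.\<close>

lemma weak_deriv_decomp:
  assumes d: "0 < d" and w: "weak_deriv d w z"
  shows "w = prim d z + point_value d w 0 *\<^sub>R ind d"
proof -
  have L: "AE x in lborel. x \<notin> {0..d} \<longrightarrow> rep_l2 w x = 0"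
    using w by (simp add: weak_deriv_def L2_on_def)
  obtain \<alpha> where \<alpha>: "AE x in lborel. x \<in> {0..d} \<longrightarrow> rep_l2 w x = \<alpha> + inner z (ind x)"
    using w weak_deriv_iff[OF d] by blast
  have "w = prim d z + \<alpha> *\<^sub>R ind d"
  proof (rule l2_eqI)
    show "AE x in lborel. rep_l2 w x = rep_l2 (prim d z + \<alpha> *\<^sub>R ind d) x"
      using \<alpha> rep_prim_ind[of d z \<alpha>] L by eventually_elim (auto split: split_indicator)
  qed
  then show ?thesis using point_value_prim[OF d, of 0 z \<alpha>] d by simp
qed

text \<open>Two derivatives of \<open>w\<close> reproduce the same point values of \<open>w\<close>,
  so they have equal integrals over every \<open>[0,x]\<close>, hence over every interval. This
  makes the definite description in \<open>dx\<close> meaningful.\<close>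

lemma weak_deriv_unique:
  assumes d: "0 < d" and w: "weak_deriv d w z" "weak_deriv d w z'"
  shows "z = z'"
proof -
  define y where "y = z - z'"
  have J: "inner y (ind x) = 0" if "x \<in> {0..d}" for x
    using point_value_prim[OF d that, of z "point_value d w 0"] point_value_prim[OF d that, of z' "point_value d w 0"]
      weak_deriv_decomp[OF d w(1)] weak_deriv_decomp[OF d w(2)]
    by (simp add: y_def inner_diff_left)
  define h where "h x = indicator {0..d} x * rep_l2 y x" for x
  have hi: "integrable lborel h"
    using integrable_rep_on[of 0 d y] by (simp add: set_integrable_def h_def[abs_def])
  have "AE x in lborel. h x = 0"
  proof (rule AE_zero_if_integral_intervals_zero[OF hi])
    fix a b :: real assume "a < b"
    define a' b' where "a' = max a 0" and "b' = min b d"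
    have ae: "AE x in lborel. x \<noteq> a" "AE x in lborel. x \<noteq> b" by (rule AE_lborel_singleton)+
    show "(LINT x:{a<..<b}|lborel. h x) = 0"
    proof (cases "a' \<le> b'")
      case True
      have si: "set_integrable lborel A (rep_l2 y)" if "A \<in> {{0..b'}, {0..a'}}" for A
        using that integrable_rep_on by auto
      have "(LINT x:{a<..<b}|lborel. h x) = (LINT x|lborel. indicator {0..b'} x *\<^sub>R rep_l2 y x - indicator {0..a'} x *\<^sub>R rep_l2 y x)"
        unfolding set_lebesgue_integral_def
      proof (rule integral_cong_AE)
        show "AE x in lborel. indicator {a<..<b} x *\<^sub>R h x = indicator {0..b'} x *\<^sub>R rep_l2 y x - indicator {0..a'} x *\<^sub>R rep_l2 y x"
          using ae AE_lborel_singleton[of 0]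
          by eventually_elim (use True in \<open>auto simp: h_def a'_def b'_def indicator_def max_def min_def split: if_splits\<close>)
      qed (use hi in \<open>auto simp: h_def\<close>)
      also have "\<dots> = inner y (ind b') - inner y (ind a')"
        using si unfolding inner_ind set_lebesgue_integral_def set_integrable_def by simp
      also have "\<dots> = 0"
        using J[of b'] J[of a'] True d by (auto simp: a'_def b'_def)
      finally show ?thesis .
    next
      case False
      then have "(\<lambda>x. indicator {a<..<b} x *\<^sub>R h x) = (\<lambda>x. 0)"
        by (auto simp: h_def a'_def b'_def indicator_def max_def min_def split: if_splits)
      then show ?thesis by (simp add: set_lebesgue_integral_def)
    qed
  qed
  moreover have "AE x in lborel. x \<notin> {0..d} \<longrightarrow> rep_l2 z x = 0" "AE x in lborel. x \<notin> {0..d} \<longrightarrow> rep_l2 z' x = 0"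
    using w by (auto simp: weak_deriv_def L2_on_def)
  ultimately have "AE x in lborel. rep_l2 z x = rep_l2 z' x"
    using rep_diff[of z z'] unfolding y_def[symmetric]
    by eventually_elim (auto simp: h_def indicator_def split: if_splits)
  then show ?thesis by (rule l2_eqI)
qed

lemma point_value_weak:
  assumes "0 < d" "weak_deriv d w z" "y \<in> {0..d}"
  shows "point_value d w y = point_value d w 0 + inner z (ind y)"
  using point_value_prim[OF assms(1,3)] weak_deriv_decomp[OF assms(1,2)] by metis

lemma weak_deriv_add:
  assumes d: "0 < d" and "weak_deriv d w z" "weak_deriv d w' z'"
  shows "weak_deriv d (w + w') (z + z')"
    and "y \<in> {0..d} \<Longrightarrow> point_value d (w + w') y = point_value d w y + point_value d w' y"
proof -
  have e: "w + w' = prim d (z + z') + (point_value d w 0 + point_value d w' 0) *\<^sub>R ind d"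
    by (subst weak_deriv_decomp[OF d assms(2)], subst weak_deriv_decomp[OF d assms(3)])
      (simp add: prim_add scaleR_add_left)
  show "weak_deriv d (w + w') (z + z')"
    unfolding e using assms by (intro weak_deriv_prim L2_on_add) (auto simp: weak_deriv_def)
  show "point_value d (w + w') y = point_value d w y + point_value d w' y" if "y \<in> {0..d}"
    unfolding e point_value_prim[OF d that]
    using point_value_weak[OF d assms(2) that] point_value_weak[OF d assms(3) that] by (simp add: inner_add_left)
qed

lemma weak_deriv_scaleR:
  assumes d: "0 < d" and "weak_deriv d w z"
  shows "weak_deriv d (r *\<^sub>R w) (r *\<^sub>R z)"
    and "y \<in> {0..d} \<Longrightarrow> point_value d (r *\<^sub>R w) y = r * point_value d w y"
proof -
  have e: "r *\<^sub>R w = prim d (r *\<^sub>R z) + (r * point_value d w 0) *\<^sub>R ind d"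
    by (subst weak_deriv_decomp[OF d assms(2)]) (simp add: prim_scaleR scaleR_add_right)
  show "weak_deriv d (r *\<^sub>R w) (r *\<^sub>R z)"
    unfolding e using assms by (intro weak_deriv_prim L2_on_scaleR) (auto simp: weak_deriv_def)
  show "point_value d (r *\<^sub>R w) y = r * point_value d w y" if "y \<in> {0..d}"
    unfolding e point_value_prim[OF d that]
    using point_value_weak[OF d assms(2) that] by (simp add: algebra_simps)
qed

lemma inner_prim: "inner z (prim d y) + inner (prim d z) y = inner z (ind d) * inner y (ind d)"
proof -
  have "inner z (prim d y) = (LINT x:{0..d}|lborel. rep_l2 z x * inner y (ind x))" for z y
  proof -
    have "inner z (prim d y) = (LINT x|lborel. rep_l2 z x * (indicator {0..d} x * inner y (ind x)))"
      by (rule inner_rep_AE[OF _ rep_prim]) auto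
    then show ?thesis by (simp add: set_lebesgue_integral_def mult.left_commute)
  qed
  then show ?thesis using parts_ind[of d z y] by (simp add: inner_commute[of "prim d z"])
qed

text \<open>With both functions in normal form, \<open>inner_prim\<close> gives the product of the
  total increments and the constants give the cross terms; together they complete the product of the
  values at \<open>d\<close>.\<close>

lemma weak_deriv_parts:
  assumes d: "0 < d" and w: "weak_deriv d w z" and q: "weak_deriv d q r"
  shows "inner z q + inner w r = point_value d w d * point_value d q d - point_value d w 0 * point_value d q 0"
proof -
  define \<alpha> \<beta> where "\<alpha> = point_value d w 0" and "\<beta> = point_value d q 0"
  have w': "w = prim d z + \<alpha> *\<^sub>R ind d" and q': "q = prim d r + \<beta> *\<^sub>R ind d"
    using weak_deriv_decomp[OF d w] weak_deriv_decomp[OF d q] by (auto simp: \<alpha>_def \<beta>_def)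
  have d': "d \<in> {0..d}" using d by simp
  have pv: "point_value d w d = \<alpha> + inner z (ind d)" "point_value d q d = \<beta> + inner r (ind d)"
    using point_value_weak[OF d w d'] point_value_weak[OF d q d'] by (auto simp: \<alpha>_def \<beta>_def)
  have "inner z q + inner w r = inner z (prim d r) + inner (prim d z) r + \<beta> * inner z (ind d) + \<alpha> * inner r (ind d)"
    unfolding w' q' by (simp add: inner_add_left inner_add_right inner_commute[of "ind d" r])
  also have "\<dots> = (\<alpha> + inner z (ind d)) * (\<beta> + inner r (ind d)) - \<alpha> * \<beta>"
    unfolding inner_prim by (simp add: algebra_simps)
  finally show ?thesis unfolding pv \<alpha>_def[symmetric] \<beta>_def[symmetric] .
qed

section \<open>Multiplication operators\<close>

lemma rep_l2_mult:
  assumes "AE x in lborel. \<bar>rep_l2 a x\<bar> \<le> M"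
  shows "AE x in lborel. rep_l2 (l2_mult a w) x = rep_l2 a x * rep_l2 w x"
  unfolding l2_mult_def by (rule rep_abs_l2, rule sq_integrable_bounded_mult[OF _ _ assms]) auto

lemma l2_mult_add:
  assumes "AE x in lborel. \<bar>rep_l2 a x\<bar> \<le> M"
  shows "l2_mult a (w + z) = l2_mult a w + l2_mult a z"
proof (rule l2_eqI)
  note r = rep_l2_mult[OF assms]
  show "AE x in lborel. rep_l2 (l2_mult a (w + z)) x = rep_l2 (l2_mult a w + l2_mult a z) x"
    using r[of "w + z"] r[of w] r[of z] rep_add[of w z] rep_add[of "l2_mult a w" "l2_mult a z"]
    by eventually_elim (simp add: algebra_simps)
qed

lemma l2_mult_scaleR:
  assumes "AE x in lborel. \<bar>rep_l2 a x\<bar> \<le> M"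
  shows "l2_mult a (k *\<^sub>R w) = k *\<^sub>R l2_mult a w"
proof (rule l2_eqI)
  note r = rep_l2_mult[OF assms]
  show "AE x in lborel. rep_l2 (l2_mult a (k *\<^sub>R w)) x = rep_l2 (k *\<^sub>R l2_mult a w) x"
    using r[of "k *\<^sub>R w"] r[of w] rep_scaleR[of k w] rep_scaleR[of k "l2_mult a w"]
    by eventually_elim simp
qed

lemma inner_l2_mult:
  assumes "AE x in lborel. \<bar>rep_l2 a x\<bar> \<le> M"
  shows "inner (l2_mult a w) z = (LINT x|lborel. rep_l2 a x * (rep_l2 w x * rep_l2 z x))"
proof -
  have "inner (l2_mult a w) z = (LINT x|lborel. (rep_l2 a x * rep_l2 w x) * rep_l2 z x)"
    by (rule inner_rep_AE[OF rep_l2_mult[OF assms]]) auto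
  then show ?thesis by (simp add: mult.assoc)
qed

lemma inner_l2_mult_commute:
  assumes "AE x in lborel. \<bar>rep_l2 a x\<bar> \<le> M"
  shows "inner (l2_mult a w) z = inner w (l2_mult a z)"
  unfolding inner_commute[of w] inner_l2_mult[OF assms] by (simp add: mult.commute)

lemma norm_l2_mult_le:
  assumes M: "AE x in lborel. \<bar>rep_l2 a x\<bar> \<le> M" "0 \<le> M"
  shows "(norm (l2_mult a w))\<^sup>2 \<le> M\<^sup>2 * (norm w)\<^sup>2"
proof -
  have i: "integrable lborel (\<lambda>x. rep_l2 w x * rep_l2 w x)" for w
    by (intro sq_integrable_mult) auto
  have "inner (l2_mult a w) (l2_mult a w) \<le> (LINT x|lborel. M\<^sup>2 * (rep_l2 w x * rep_l2 w x))"
    unfolding inner_rep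
  proof (rule integral_mono_AE)
    show "AE x in lborel. rep_l2 (l2_mult a w) x * rep_l2 (l2_mult a w) x \<le> M\<^sup>2 * (rep_l2 w x * rep_l2 w x)"
      using rep_l2_mult[OF M(1), of w] M(1)
    proof eventually_elim
      case (elim x)
      then have "(rep_l2 a x)\<^sup>2 \<le> M\<^sup>2" using M(2) by (simp add: power2_le_iff_abs_le)
      then have "(rep_l2 a x)\<^sup>2 * (rep_l2 w x)\<^sup>2 \<le> M\<^sup>2 * (rep_l2 w x)\<^sup>2" by (rule mult_right_mono) simp
      then show ?case using elim by (simp add: power2_eq_square algebra_simps)
    qed
  qed (use i in auto)
  then show ?thesis by (simp add: power2_norm_eq_inner inner_rep)
qed

lemma l2_mult_L2_on:
  assumes M: "AE x in lborel. \<bar>rep_l2 a x\<bar> \<le> M" and w: "w \<in> L2_on d"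
  shows "l2_mult a w \<in> L2_on d"
proof -
  have "AE x in lborel. x \<notin> {0..d} \<longrightarrow> rep_l2 w x = 0"
    using w by (simp add: L2_on_def)
  then have "AE x in lborel. x \<notin> {0..d} \<longrightarrow> rep_l2 (l2_mult a w) x = 0"
    using rep_l2_mult[OF M, of w] by eventually_elim auto
  then show ?thesis by (simp add: L2_on_def)
qed

text \<open>A coefficient is zero off its edge, so the lower bound is asked for only on
  \<open>[0,d]\<close>; outside, \<open>w\<close> itself vanishes.\<close>

lemma l2_mult_coercive:
  assumes M: "AE x in lborel. \<bar>rep_l2 a x\<bar> \<le> M" and w: "w \<in> L2_on d"
    and m: "AE x in lborel. x \<in> {0..d} \<longrightarrow> m \<le> rep_l2 a x"
  shows "m * (norm w)\<^sup>2 \<le> inner (l2_mult a w) w"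
proof -
  have i: "integrable lborel (\<lambda>x. rep_l2 w x * rep_l2 z x)" for w z
    by (intro sq_integrable_mult) auto
  have L: "AE x in lborel. x \<notin> {0..d} \<longrightarrow> rep_l2 w x = 0"
    using w by (simp add: L2_on_def)
  have "(LINT x|lborel. m * (rep_l2 w x * rep_l2 w x)) \<le> (LINT x|lborel. rep_l2 (l2_mult a w) x * rep_l2 w x)"
  proof (rule integral_mono_AE)
    show "AE x in lborel. m * (rep_l2 w x * rep_l2 w x) \<le> rep_l2 (l2_mult a w) x * rep_l2 w x"
      using L m rep_l2_mult[OF M, of w]
    proof eventually_elim
      case (elim x)
      show ?case
      proof (cases "x \<in> {0..d}")
        case True
        then have "m * (rep_l2 w x * rep_l2 w x) \<le> rep_l2 a x * (rep_l2 w x * rep_l2 w x)"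
          using elim(2) by (intro mult_right_mono) auto
        then show ?thesis using elim(3) by simp
      qed (use elim in simp)
    qed
  qed (use i in auto)
  then show ?thesis by (simp add: power2_norm_eq_inner inner_rep)
qed

section \<open>Orthogonal projections and finite dimensional subspaces\<close>

lemma orthogonal_expansion:
  fixes B :: "'a::real_inner set"
  assumes "finite B"
  obtains C where "finite C" "span C = span B"
    "\<And>x y. y \<in> span B \<Longrightarrow> inner (x - (\<Sum>b\<in>C. (inner x b / inner b b) *\<^sub>R b)) y = 0"
    "\<And>x. x \<in> span B \<Longrightarrow> (\<Sum>b\<in>C. (inner x b / inner b b) *\<^sub>R b) = x"
proof -
  obtain C where C: "finite C" "span C = span B" "pairwise orthogonal C"
    using basis_orthogonal[OF assms] by blast
  define P where "P x = (\<Sum>b\<in>C. (inner x b / inner b b) *\<^sub>R b)" for x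
  have sp: "P x \<in> span B" for x
    unfolding P_def C(2)[symmetric] by (intro span_sum span_scale span_base)
  have ob: "inner (x - P x) c = 0" if c: "c \<in> C" for x c
  proof -
    have "inner (P x) c = (\<Sum>b\<in>C. (inner x b / inner b b) * inner b c)"
      by (simp add: P_def inner_sum_left)
    also have "\<dots> = (\<Sum>b\<in>C. if b = c then inner x c else 0)"
    proof (rule sum.cong[OF refl])
      fix b assume b: "b \<in> C"
      \<comment> \<open>The orthogonal family is not normalised and may contain 0. Since division by
        zero yields 0, that vector contributes nothing, and \<open>inner x 0 = 0\<close>
        agrees.\<close>
      show "(inner x b / inner b b) * inner b c = (if b = c then inner x c else 0)"
        using C(3) b c by (auto simp: pairwise_def orthogonal_def)
    qed
    also have "\<dots> = inner x c" using C(1) c by simp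
    finally show ?thesis by (simp add: inner_diff_left)
  qed
  have o: "inner (x - P x) y = 0" if "y \<in> span B" for x y
  proof -
    have "y \<in> span C" using that C by simp
    then show ?thesis
      by (induction rule: span_induct_alt) (auto simp: ob inner_add_right)
  qed
  have "P x = x" if "x \<in> span B" for x
    using o[OF span_diff[OF that sp], of x x] by simp
  then show thesis using that C o unfolding P_def by blast
qed

lemma orthogonal_projection_span:
  fixes B :: "'a::real_inner set"
  assumes "finite B"
  obtains P where "bounded_linear P" "\<And>x. P x \<in> span B" "\<And>x y. y \<in> span B \<Longrightarrow> inner (x - P x) y = 0"
proof -
  obtain C where C: "finite C" "span C = span B"
    "\<And>x y. y \<in> span B \<Longrightarrow> inner (x - (\<Sum>b\<in>C. (inner x b / inner b b) *\<^sub>R b)) y = 0"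
    "\<And>x. x \<in> span B \<Longrightarrow> (\<Sum>b\<in>C. (inner x b / inner b b) *\<^sub>R b) = x"
    by (rule orthogonal_expansion[OF assms]) blast
  show thesis
  proof (rule that)
    show "bounded_linear (\<lambda>x. \<Sum>b\<in>C. (inner x b / inner b b) *\<^sub>R b)"
      by (intro bounded_linear_sum bounded_linear_compose[OF bounded_linear_scaleR_left]
          bounded_linear_compose[OF bounded_linear_divide] bounded_linear_inner_left)
    show "(\<Sum>b\<in>C. (inner x b / inner b b) *\<^sub>R b) \<in> span B" for x
      unfolding C(2)[symmetric] by (intro span_sum span_scale span_base)
  qed (rule C(3))
qed

text \<open>Pythagoras. With \<open>y\<close> the projection of \<open>x\<close> it shows that
  removing the projection shrinks the norm; with \<open>y\<close> the remainder it shows that the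
  projection is a contraction.\<close>

lemma norm_minus_projection_le:
  fixes x :: "'a::real_inner"
  assumes "inner (x - y) y = 0"
  shows "norm (x - y) \<le> norm x"
proof -
  have "x = (x - y) + y" by simp
  then have "inner x x = inner (x - y) (x - y) + inner y y"
    using assms by (metis add.right_neutral add_0 inner_add_left inner_add_right inner_commute)
  then show ?thesis by (simp add: norm_le)
qed

text \<open>Linearity is required on the span only, because \<open>dx\<close> is known to be linear
  only on \<open>H1\<close>. The resulting inverse inequality has a constant depending on the
  subspace; it enters the time regularity of discrete solutions but no decay constant.\<close>

lemma linear_bound_on_span:
  fixes B :: "'a::real_inner set" and f :: "'a \<Rightarrow> 'b::real_normed_vector"
  assumes "finite B"
    and add: "\<And>x y. x \<in> span B \<Longrightarrow> y \<in> span B \<Longrightarrow> f (x + y) = f x + f y"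
    and sc: "\<And>r x. x \<in> span B \<Longrightarrow> f (r *\<^sub>R x) = r *\<^sub>R f x"
  obtains K where "0 \<le> K" "\<And>x. x \<in> span B \<Longrightarrow> norm (f x) \<le> K * norm x"
proof -
  obtain C where C: "finite C" "span C = span B"
    "\<And>x y. y \<in> span B \<Longrightarrow> inner (x - (\<Sum>b\<in>C. (inner x b / inner b b) *\<^sub>R b)) y = 0"
    "\<And>x. x \<in> span B \<Longrightarrow> (\<Sum>b\<in>C. (inner x b / inner b b) *\<^sub>R b) = x"
    by (rule orthogonal_expansion[OF assms(1)]) blast
  note ex = C(4)
  have CB: "C \<subseteq> span B" using C(2) span_superset by blast
  have f0: "f 0 = 0" using sc[of 0 0] by (simp add: span_zero)
  have fs: "f (\<Sum>b\<in>D. k b *\<^sub>R b) = (\<Sum>b\<in>D. k b *\<^sub>R f b)" if "D \<subseteq> C" for D k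
    using finite_subset[OF that C(1)] that
  proof (induction D rule: finite_induct)
    case (insert b D)
    then have "(\<Sum>b\<in>D. k b *\<^sub>R b) \<in> span B" using CB by (intro span_sum span_scale) auto
    then show ?case using insert CB by (simp add: add sc span_scale subset_iff)
  qed (simp add: f0)
  show thesis
  proof (rule that)
    show "0 \<le> (\<Sum>b\<in>C. norm b / inner b b * norm (f b))" by (intro sum_nonneg) simp
    fix x assume x: "x \<in> span B"
    have "norm (f x) = norm (\<Sum>b\<in>C. (inner x b / inner b b) *\<^sub>R f b)"
      by (subst ex[OF x, symmetric]) (simp add: fs)
    also have "\<dots> \<le> (\<Sum>b\<in>C. norm ((inner x b / inner b b) *\<^sub>R f b))" by (rule norm_sum)
    also have "\<dots> \<le> (\<Sum>b\<in>C. (norm b / inner b b * norm (f b)) * norm x)"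
    proof (rule sum_mono)
      fix b
      have "\<bar>inner x b\<bar> / inner b b \<le> norm x * norm b / inner b b"
        by (intro divide_right_mono Cauchy_Schwarz_ineq2) simp
      then have "\<bar>inner x b\<bar> / inner b b * norm (f b) \<le> norm x * norm b / inner b b * norm (f b)"
        by (rule mult_right_mono) simp
      then show "norm ((inner x b / inner b b) *\<^sub>R f b) \<le> (norm b / inner b b * norm (f b)) * norm x"
        by (simp add: mult.commute mult.left_commute)
    qed
    also have "\<dots> = (\<Sum>b\<in>C. norm b / inner b b * norm (f b)) * norm x" by (simp add: sum_distrib_right)
    finally show "norm (f x) \<le> (\<Sum>b\<in>C. norm b / inner b b * norm (f b)) * norm x" .
  qed
qed

lemma bounded_linear_vec_lambda:
  fixes F :: "'i::finite \<Rightarrow> 'a::real_normed_vector \<Rightarrow> 'b::real_inner"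
  assumes "\<And>i. bounded_linear (F i)"
  shows "bounded_linear (\<lambda>h. \<chi> i. F i h)"
proof -
  have "\<exists>K. \<forall>h. norm (F i h) \<le> norm h * K" for i
    using bounded_linear.bounded[OF assms] by blast
  then obtain K where K: "\<And>i h. norm (F i h) \<le> norm h * K i" by metis
  show ?thesis
  proof (rule bounded_linear_intro[where K = "\<Sum>i\<in>UNIV. K i"])
    fix h
    have "norm (\<chi> i. F i h) \<le> (\<Sum>i\<in>UNIV. norm (F i h))"
      unfolding norm_vec_def by (simp add: L2_set_le_sum)
    also have "\<dots> \<le> (\<Sum>i\<in>UNIV. norm h * K i)" by (rule sum_mono) (rule K)
    finally show "norm (\<chi> i. F i h) \<le> norm h * (\<Sum>i\<in>UNIV. K i)" by (simp add: sum_distrib_left)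
  qed (auto simp: vec_eq_iff linear_add[OF bounded_linear.linear[OF assms]] linear_scale[OF bounded_linear.linear[OF assms]])
qed

section \<open>Function spaces on a network\<close>

lemma norm_net_fun: "(norm (w :: 'v::finite net_fun))\<^sup>2 = (\<Sum>e\<in>UNIV. (norm (w $ e))\<^sup>2)"
  by (simp add: power2_norm_eq_inner inner_vec_def)

lemma L2_add: "w \<in> L2 E l \<Longrightarrow> z \<in> L2 E l \<Longrightarrow> w + z \<in> L2 E l"
  by (auto simp: L2_def intro: L2_on_add)

lemma L2_outside: "w \<in> L2 E l \<Longrightarrow> e \<notin> E \<Longrightarrow> w $ e = 0"
  unfolding L2_def by blast

lemma L2_scaleR: "w \<in> L2 E l \<Longrightarrow> r *\<^sub>R w \<in> L2 E l"
  by (auto simp: L2_def intro: L2_on_scaleR)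

text \<open>Off the interval of an edge, and on pairs that are not edges, the coefficient is zero,
  so the two-sided bound on the edges gives a bound of the modulus on the whole line.\<close>

lemma ae_between_bounded:
  assumes a: "a \<in> L2 E l" "ae_between E l C0 C1 a" and C: "0 < C0" "0 < C1"
  shows "AE x in lborel. \<bar>rep_l2 (a $ e) x\<bar> \<le> C1"
proof (cases "e \<in> E")
  case True
  then have "AE x in lborel. x \<in> {0..l e} \<longrightarrow> C0 \<le> rep_l2 (a $ e) x \<and> rep_l2 (a $ e) x \<le> C1"
    and "AE x in lborel. x \<notin> {0..l e} \<longrightarrow> rep_l2 (a $ e) x = 0"
    using a by (auto simp: ae_between_def L2_def L2_on_def)
  then show ?thesis by eventually_elim (use C in auto)
next
  case False
  then have "a $ e = 0" using a L2_outside by blast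
  then show ?thesis using rep_zero C by auto
qed

section \<open>Multiplication by a coefficient as a bounded, symmetric and coercive operator\<close>

context
  fixes a :: "'v::finite net_fun" and E l C0 C1
  assumes a: "a \<in> L2 E l" "ae_between E l C0 C1 a" and C: "0 < C0" "0 < C1"
begin

lemma norm_net_mult_le: "norm (a \<odot> w) \<le> C1 * norm w"
proof -
  have "(norm (a \<odot> w))\<^sup>2 \<le> (\<Sum>e\<in>UNIV. C1\<^sup>2 * (norm (w $ e))\<^sup>2)"
    unfolding norm_net_fun
    by (intro sum_mono) (use C in \<open>simp add: net_mult_def norm_l2_mult_le[OF ae_between_bounded[OF a C]]\<close>)
  also have "\<dots> = (C1 * norm w)\<^sup>2" by (simp add: norm_net_fun power_mult_distrib sum_distrib_left)
  finally show ?thesis using C by (simp add: power2_le_iff_abs_le)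
qed

lemma bounded_linear_net_mult: "bounded_linear ((\<odot>) a)"
proof (rule bounded_linear_intro[where K = C1])
  note b = ae_between_bounded[OF a C]
  show "a \<odot> (x + y) = a \<odot> x + a \<odot> y" for x y
    by (simp add: net_mult_def vec_eq_iff l2_mult_add[OF b])
  show "a \<odot> (r *\<^sub>R x) = r *\<^sub>R (a \<odot> x)" for r x
    by (simp add: net_mult_def vec_eq_iff l2_mult_scaleR[OF b])
  show "norm (a \<odot> x) \<le> norm x * C1" for x
    using norm_net_mult_le by (simp add: mult.commute)
qed

lemma inner_net_mult_commute: "inner (a \<odot> w) z = inner w (a \<odot> z)"
  by (simp add: inner_vec_def net_mult_def inner_l2_mult_commute[OF ae_between_bounded[OF a C]])

lemma net_mult_L2: "w \<in> L2 E l \<Longrightarrow> a \<odot> w \<in> L2 E l"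
  using l2_mult_L2_on[OF ae_between_bounded[OF a C]] linear_0[OF bounded_linear.linear[OF bounded_linear_net_mult]]
  by (auto simp: L2_def net_mult_def vec_eq_iff l2_mult_scaleR[OF ae_between_bounded[OF a C], of _ 0, simplified])

lemma net_mult_coercive:
  assumes w: "w \<in> L2 E l"
  shows "C0 * (norm w)\<^sup>2 \<le> inner (a \<odot> w) w"
proof -
  have "C0 * (norm (w $ e))\<^sup>2 \<le> inner (l2_mult (a $ e) (w $ e)) (w $ e)" for e
  proof (cases "e \<in> E")
    case True
    then have "AE x in lborel. x \<in> {0..l e} \<longrightarrow> C0 \<le> rep_l2 (a $ e) x" "w $ e \<in> L2_on (l e)"
      using a(2) w by (auto simp: ae_between_def L2_def)
    then show ?thesis by (intro l2_mult_coercive[OF ae_between_bounded[OF a C]]) auto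
  next
    case False
    then show ?thesis using L2_outside[OF w] by (simp add: l2_mult_scaleR[OF ae_between_bounded[OF a C], of _ 0, simplified])
  qed
  then show ?thesis
    by (simp add: norm_net_fun inner_vec_def net_mult_def sum_distrib_left sum_mono)
qed

end

locale finite_network =
  fixes V :: "'v::finite set" and E :: "('v \<times> 'v) set" and l :: "'v \<times> 'v \<Rightarrow> real"
  assumes network: "network V E l"
begin

lemma length_pos: "e \<in> E \<Longrightarrow> 0 < l e"
  and no_loop: "e \<in> E \<Longrightarrow> fst e \<noteq> snd e"
  and edge_ends: "e \<in> E \<Longrightarrow> fst e \<in> V \<and> snd e \<in> V"
  using network by (auto simp: network_def)

lemma weak_deriv_dx: "w \<in> H1 E l \<Longrightarrow> e \<in> E \<Longrightarrow> weak_deriv (l e) (w $ e) (dx E l w $ e)"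
proof -
  assume w: "w \<in> H1 E l" and e: "e \<in> E"
  then obtain z where z: "weak_deriv (l e) (w $ e) z" by (auto simp: H1_def)
  have "weak_deriv (l e) (w $ e) (THE z. weak_deriv (l e) (w $ e) z)"
    by (rule theI[of _ z]) (use z weak_deriv_unique[OF length_pos[OF e]] in auto)
  then show ?thesis using e by (simp add: dx_def)
qed

lemma dx_eqI:
  assumes "w \<in> L2 E l" "\<And>e. e \<in> E \<Longrightarrow> weak_deriv (l e) (w $ e) (z $ e)" "\<And>e. e \<notin> E \<Longrightarrow> z $ e = 0"
  shows "w \<in> H1 E l" "dx E l w = z"
proof -
  show w: "w \<in> H1 E l" using assms by (auto simp: H1_def)
  show "dx E l w = z"
    using weak_deriv_unique[OF length_pos weak_deriv_dx[OF w] assms(2)] assms(3)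
    by (auto simp: vec_eq_iff) (simp add: dx_def)
qed

lemma H1_L2: "w \<in> H1 E l \<Longrightarrow> w \<in> L2 E l" by (simp add: H1_def)

lemma dx_outside: "e \<notin> E \<Longrightarrow> dx E l w $ e = 0" by (simp add: dx_def)

lemma dx_L2: "w \<in> H1 E l \<Longrightarrow> dx E l w \<in> L2 E l"
  using weak_deriv_dx by (auto simp: L2_def weak_deriv_def dx_outside)

lemma end_point_in: "e \<in> E \<Longrightarrow> (if v = fst e then 0 else l e) \<in> {0..l e}"
  using length_pos[of e] by auto

lemma
  assumes w: "w \<in> H1 E l" and z: "z \<in> H1 E l"
  shows H1_add: "w + z \<in> H1 E l" and dx_add: "dx E l (w + z) = dx E l w + dx E l z"
    and trace_add: "e \<in> E \<Longrightarrow> trace_at l (w + z) e v = trace_at l w e v + trace_at l z e v"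
proof -
  have d: "weak_deriv (l e) ((w + z) $ e) ((dx E l w + dx E l z) $ e)" if e: "e \<in> E" for e
    using weak_deriv_add(1)[OF length_pos[OF e] weak_deriv_dx[OF w e] weak_deriv_dx[OF z e]] by simp
  show "w + z \<in> H1 E l" "dx E l (w + z) = dx E l w + dx E l z"
    using dx_eqI[OF L2_add[OF H1_L2[OF w] H1_L2[OF z]] d] by (auto simp: dx_outside)
  show "trace_at l (w + z) e v = trace_at l w e v + trace_at l z e v" if e: "e \<in> E"
    unfolding trace_at_def vector_add_component
    by (rule weak_deriv_add(2)[OF length_pos[OF e] weak_deriv_dx[OF w e] weak_deriv_dx[OF z e] end_point_in[OF e]])
qed

lemma
  assumes w: "w \<in> H1 E l"
  shows H1_scaleR: "r *\<^sub>R w \<in> H1 E l" and dx_scaleR: "dx E l (r *\<^sub>R w) = r *\<^sub>R dx E l w"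
    and trace_scaleR: "e \<in> E \<Longrightarrow> trace_at l (r *\<^sub>R w) e v = r * trace_at l w e v"
proof -
  have d: "weak_deriv (l e) ((r *\<^sub>R w) $ e) ((r *\<^sub>R dx E l w) $ e)" if e: "e \<in> E" for e
    using weak_deriv_scaleR(1)[OF length_pos[OF e] weak_deriv_dx[OF w e]] by simp
  show "r *\<^sub>R w \<in> H1 E l" "dx E l (r *\<^sub>R w) = r *\<^sub>R dx E l w"
    using dx_eqI[OF L2_scaleR[OF H1_L2[OF w]] d] by (auto simp: dx_outside)
  show "trace_at l (r *\<^sub>R w) e v = r * trace_at l w e v" if e: "e \<in> E"
    unfolding trace_at_def vector_scaleR_component
    by (rule weak_deriv_scaleR(2)[OF length_pos[OF e] weak_deriv_dx[OF w e] end_point_in[OF e]])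
qed

lemma edges_atD: "e \<in> edges_at E v \<Longrightarrow> e \<in> E" by (simp add: edges_at_def)

lemma Hdiv_H1: "u \<in> Hdiv V E l \<Longrightarrow> u \<in> H1 E l" by (simp add: Hdiv_def)
lemma H10_H1: "u \<in> H10 V E l \<Longrightarrow> u \<in> H1 E l" by (simp add: H10_def)

lemma Hdiv_add: "u \<in> Hdiv V E l \<Longrightarrow> w \<in> Hdiv V E l \<Longrightarrow> u + w \<in> Hdiv V E l"
  by (auto simp: Hdiv_def H1_add trace_add edges_atD distrib_left sum.distrib cong: sum.cong)

lemma Hdiv_scaleR: "u \<in> Hdiv V E l \<Longrightarrow> r *\<^sub>R u \<in> Hdiv V E l"
  by (auto simp: Hdiv_def H1_scaleR trace_scaleR edges_atD mult.left_commute sum_distrib_left[symmetric] cong: sum.cong)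

lemma H10_interior:
  "p \<in> H10 V E l \<Longrightarrow> v \<in> interior_vertices V E \<Longrightarrow> e \<in> edges_at E v \<Longrightarrow> e' \<in> edges_at E v \<Longrightarrow>
    trace_at l p e v = trace_at l p e' v"
  unfolding H10_def by blast

lemma H10_boundary:
  "p \<in> H10 V E l \<Longrightarrow> v \<in> boundary_vertices V E \<Longrightarrow> e \<in> edges_at E v \<Longrightarrow> trace_at l p e v = 0"
  unfolding H10_def by blast

lemma H10_add:
  assumes "p \<in> H10 V E l" "q \<in> H10 V E l"
  shows "p + q \<in> H10 V E l"
proof -
  have t: "trace_at l (p + q) e v = trace_at l p e v + trace_at l q e v" if "e \<in> edges_at E v" for e v
    using that by (intro trace_add assms H10_H1 edges_atD)
  show ?thesis
    unfolding H10_def mem_Collect_eq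
  proof (intro conjI ballI)
    fix v e e' assume v: "v \<in> interior_vertices V E" "e \<in> edges_at E v" "e' \<in> edges_at E v"
    then show "trace_at l (p + q) e v = trace_at l (p + q) e' v"
      using H10_interior[OF assms(1) v] H10_interior[OF assms(2) v] t v by simp
  qed (simp_all add: t H1_add H10_H1 assms H10_boundary)
qed

lemma H10_scaleR:
  assumes "p \<in> H10 V E l"
  shows "r *\<^sub>R p \<in> H10 V E l"
proof -
  have t: "trace_at l (r *\<^sub>R p) e v = r * trace_at l p e v" if "e \<in> edges_at E v" for e v
    using that by (intro trace_scaleR assms H10_H1 edges_atD)
  show ?thesis
    unfolding H10_def mem_Collect_eq
  proof (intro conjI ballI)
    fix v e e' assume v: "v \<in> interior_vertices V E" "e \<in> edges_at E v" "e' \<in> edges_at E v"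
    then show "trace_at l (r *\<^sub>R p) e v = trace_at l (r *\<^sub>R p) e' v"
      using H10_interior[OF assms v] t v by simp
  qed (simp_all add: t H1_scaleR H10_H1 assms H10_boundary)
qed

lemma dx_diff: "u \<in> H1 E l \<Longrightarrow> w \<in> H1 E l \<Longrightarrow> dx E l (u - w) = dx E l u - dx E l w"
  using dx_add[of u "(-1) *\<^sub>R w"] H1_scaleR[of w "-1"] dx_scaleR[of w "-1"] by simp

lemma Hdiv_diff: "u \<in> Hdiv V E l \<Longrightarrow> w \<in> Hdiv V E l \<Longrightarrow> u - w \<in> Hdiv V E l"
  using Hdiv_add[of u "(-1) *\<^sub>R w"] Hdiv_scaleR[of w "-1"] by simp

lemma H10_diff: "u \<in> H10 V E l \<Longrightarrow> w \<in> H10 V E l \<Longrightarrow> u - w \<in> H10 V E l"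
  using H10_add[of u "(-1) *\<^sub>R w"] H10_scaleR[of w "-1"] by simp

section \<open>Integration by parts on the network\<close>

lemma sum_incidence_ends:
  assumes "e \<in> E"
  shows "(\<Sum>v\<in>UNIV. incidence e v * F v) = F (snd e) - F (fst e)"
proof -
  have "(\<Sum>v\<in>UNIV. incidence e v * F v) = (\<Sum>v\<in>UNIV. (if v = snd e then F v else 0) - (if v = fst e then F v else 0))"
    by (rule sum.cong) (use no_loop[OF assms] in \<open>auto simp: incidence_def\<close>)
  then show ?thesis by (simp add: sum_subtractf)
qed

lemma sum_edges_at: "(\<Sum>e\<in>edges_at E v. incidence e v * F e) = (\<Sum>e\<in>E. incidence e v * F e)"
  by (rule sum.mono_neutral_left) (auto simp: edges_at_def incidence_def)

text \<open>The end point terms of the edges are regrouped by vertices. At an interior vertex the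
  common value of \<open>p\<close> factors out and the flux balance of \<open>u\<close> remains; at
  a boundary vertex \<open>p\<close> vanishes.\<close>

lemma inner_dx_H10_Hdiv:
  assumes u: "u \<in> Hdiv V E l" and p: "p \<in> H10 V E l"
  shows "inner (dx E l p) u = - inner p (dx E l u)"
proof -
  note uH = Hdiv_H1[OF u] and pH = H10_H1[OF p]
  have "inner (dx E l p) u + inner p (dx E l u)
      = (\<Sum>e\<in>UNIV. inner (dx E l p $ e) (u $ e) + inner (p $ e) (dx E l u $ e))"
    by (simp add: inner_vec_def sum.distrib)
  also have "\<dots> = (\<Sum>e\<in>E. inner (dx E l p $ e) (u $ e) + inner (p $ e) (dx E l u $ e))"
    by (rule sum.mono_neutral_right) (auto simp: dx_outside)
  also have "\<dots> = (\<Sum>e\<in>E. \<Sum>v\<in>UNIV. incidence e v * (trace_at l p e v * trace_at l u e v))"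
  proof (rule sum.cong[OF refl])
    fix e assume e: "e \<in> E"
    show "inner (dx E l p $ e) (u $ e) + inner (p $ e) (dx E l u $ e)
      = (\<Sum>v\<in>UNIV. incidence e v * (trace_at l p e v * trace_at l u e v))"
      unfolding sum_incidence_ends[OF e]
      using weak_deriv_parts[OF length_pos[OF e] weak_deriv_dx[OF pH e] weak_deriv_dx[OF uH e]] no_loop[OF e]
      by (simp add: trace_at_def)
  qed
  also have "\<dots> = (\<Sum>v\<in>UNIV. \<Sum>e\<in>E. incidence e v * (trace_at l p e v * trace_at l u e v))"
    by (rule sum.swap)
  also have "\<dots> = (\<Sum>v\<in>UNIV. \<Sum>e\<in>edges_at E v. incidence e v * (trace_at l p e v * trace_at l u e v))"
    by (simp add: sum_edges_at)
  also have "\<dots> = 0"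
  proof (rule sum.neutral, rule ballI)
    fix v
    show "(\<Sum>e\<in>edges_at E v. incidence e v * (trace_at l p e v * trace_at l u e v)) = 0"
    proof (cases "v \<in> interior_vertices V E")
      case True
      then have "edges_at E v \<noteq> {}" by (auto simp: interior_vertices_def)
      then obtain e0 where e0: "e0 \<in> edges_at E v" by blast
      have "(\<Sum>e\<in>edges_at E v. incidence e v * (trace_at l p e v * trace_at l u e v))
         = trace_at l p e0 v * (\<Sum>e\<in>edges_at E v. incidence e v * trace_at l u e v)"
        unfolding sum_distrib_left
      proof (rule sum.cong[OF refl])
        fix e assume "e \<in> edges_at E v"
        then have "trace_at l p e v = trace_at l p e0 v" using H10_interior[OF p True] e0 by blast
        then show "incidence e v * (trace_at l p e v * trace_at l u e v) = trace_at l p e0 v * (incidence e v * trace_at l u e v)"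
          by simp
      qed
      then show ?thesis using u True by (simp add: Hdiv_def)
    next
      case False
      have "trace_at l p e v = 0" if e: "e \<in> edges_at E v" for e
      proof -
        have "v \<in> V" using e edge_ends[of e] by (auto simp: edges_at_def)
        then have "v \<in> boundary_vertices V E" using False by (simp add: boundary_vertices_def)
        then show ?thesis using H10_boundary[OF p] e by blast
      qed
      then show ?thesis by simp
    qed
  qed
  finally show ?thesis by simp
qed

section \<open>A bounded right inverse of the derivative\<close>

text \<open>Sends one unit along an undirected path: the values \<open>x e\<close> are edgewise
  constant fluxes whose net imbalance is \<open>+1\<close> at \<open>v\<close>, \<open>-1\<close> at
  \<open>w\<close> and zero elsewhere. Consecutive path edges cancel at the vertex they
  share.\<close>

lemma path_flow:
  assumes "(v, w) \<in> (E \<union> E\<inverse>)\<^sup>*"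
  shows "\<exists>x. \<forall>y. (\<Sum>e\<in>E. incidence e y * x e) = of_bool (y = v) - of_bool (y = w)"
  using assms
proof (induction rule: rtrancl_induct)
  case base
  show ?case by (intro exI[of _ "\<lambda>_. 0"]) simp
next
  case (step w w')
  then obtain x where x: "\<And>y. (\<Sum>e\<in>E. incidence e y * x e) = of_bool (y = v) - of_bool (y = w)" by blast
  have fin: "finite E" by simp
  \<comment> \<open>The step from \<open>w\<close> to \<open>w'\<close> moves the sink of the flow.
    An edge traversed along its orientation needs the value \<open>-1\<close>, since its incidence
    at the tail is \<open>-1\<close>; against it, \<open>1\<close>.\<close>
  obtain e0 k where e0: "e0 \<in> E" and k: "\<And>y. incidence e0 y * k = of_bool (y = w) - of_bool (y = w')"
  proof (cases "(w, w') \<in> E")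
    case True
    then show thesis using no_loop[OF True] by (intro that[of "(w, w')" "-1"]) (auto simp: incidence_def)
  next
    case False
    then have "(w', w) \<in> E" using step by auto
    then show thesis using no_loop[of "(w', w)"] by (intro that[of "(w', w)" "1"]) (auto simp: incidence_def)
  qed
  have "(\<Sum>e\<in>E. incidence e y * (x e + (if e = e0 then k else 0))) = of_bool (y = v) - of_bool (y = w')" for y
  proof -
    have "(\<Sum>e\<in>E. incidence e y * (x e + (if e = e0 then k else 0)))
       = (\<Sum>e\<in>E. incidence e y * x e) + (\<Sum>e\<in>E. if e = e0 then incidence e0 y * k else 0)"
      unfolding sum.distrib[symmetric] by (rule sum.cong) (auto simp: distrib_left)
    then show ?thesis using e0 x k by simp
  qed
  then show ?case by (intro exI[of _ "\<lambda>e. x e + (if e = e0 then k else 0)"]) blast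
qed

text \<open>Edgewise primitives have the right derivative but violate the balance at interior
  vertices. The defect at each of them is removed by a multiple of a unit flow to a boundary vertex,
  which is constant on edges and so does not affect the derivative.\<close>

lemma bounded_lift:
  assumes bd: "boundary_vertices V E \<noteq> {}"
  obtains L where "bounded_linear L" "\<And>h. h \<in> L2 E l \<Longrightarrow> L h \<in> Hdiv V E l \<and> dx E l (L h) = h"
proof -
  obtain vb where vb: "vb \<in> V" "vb \<notin> interior_vertices V E" using bd by (auto simp: boundary_vertices_def)
  \<comment> \<open>The sink of the flow lies at \<open>vb\<close>, where no balance is imposed, so
    on interior vertices only the source at \<open>v\<close> is visible.\<close>
  have "\<exists>x. \<forall>y\<in>interior_vertices V E. (\<Sum>e\<in>E. incidence e y * x e) = of_bool (y = v)" if "v \<in> interior_vertices V E" for v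
  proof -
    have "(v, vb) \<in> (E \<union> E\<inverse>)\<^sup>*" using that vb network by (auto simp: network_def interior_vertices_def)
    from path_flow[OF this] obtain x
      where "\<And>y. (\<Sum>e\<in>E. incidence e y * x e) = of_bool (y = v) - of_bool (y = vb)" by blast
    then have "(\<Sum>e\<in>E. incidence e y * x e) = of_bool (y = v)" if "y \<in> interior_vertices V E" for y
      using vb that by auto
    then show ?thesis by blast
  qed
  then obtain R where R: "\<And>v y. v \<in> interior_vertices V E \<Longrightarrow> y \<in> interior_vertices V E \<Longrightarrow> (\<Sum>e\<in>E. incidence e y * R v e) = of_bool (y = v)"
    by metis
  \<comment> \<open>The imbalance of the primitives at \<open>v\<close>: they vanish at the left end
    of each edge, so only edges that end in \<open>v\<close> contribute, each with its total
    integral.\<close>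
  define inflow where "inflow v h = (\<Sum>e\<in>E. if snd e = v then inner (h $ e) (ind (l e)) else 0)" for v and h :: "'v net_fun"
  define \<rho> where "\<rho> e h = - (\<Sum>v\<in>interior_vertices V E. R v e * inflow v h)" for e and h :: "'v net_fun"
  define F where "F e h = (if e \<in> E then prim (l e) (h $ e) + \<rho> e h *\<^sub>R ind (l e) else 0)" for e and h :: "'v net_fun"
  have bi: "bounded_linear (inflow v)" for v
  proof -
    have "bounded_linear (\<lambda>h :: 'v net_fun. if snd e = v then inner (h $ e) (ind (l e)) else 0)" for e
      by (cases "snd e = v") (auto intro!: bounded_linear_zero bounded_linear_compose[OF bounded_linear_inner_left] bounded_linear_vec_nth)
    then show ?thesis unfolding inflow_def by (intro bounded_linear_sum)
  qed
  have br: "bounded_linear (\<rho> e)" for e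
    unfolding \<rho>_def by (intro bounded_linear_minus bounded_linear_sum bounded_linear_const_mult bi)
  have bF: "bounded_linear (F e)" for e
  proof (cases "e \<in> E")
    case True
    then have "F e = (\<lambda>h. prim (l e) (h $ e) + \<rho> e h *\<^sub>R ind (l e))" by (simp add: F_def fun_eq_iff)
    moreover have "bounded_linear (\<lambda>h. prim (l e) (h $ e) + \<rho> e h *\<^sub>R ind (l e))"
      using length_pos[OF True]
      by (intro bounded_linear_add bounded_linear_compose[OF bounded_linear_prim] bounded_linear_vec_nth
          bounded_linear_compose[OF bounded_linear_scaleR_left] br) auto
    ultimately show ?thesis by simp
  next
    case False
    then have "F e = (\<lambda>h. 0)" by (simp add: F_def fun_eq_iff)
    then show ?thesis by (simp add: bounded_linear_zero)
  qed
  define L where "L h = (\<chi> e. F e h)" for h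
  have bL: "bounded_linear L" unfolding L_def by (rule bounded_linear_vec_lambda[OF bF])
  have "L h \<in> Hdiv V E l \<and> dx E l (L h) = h" if h: "h \<in> L2 E l" for h
  proof -
    have wd: "weak_deriv (l e) (L h $ e) (h $ e)" if e: "e \<in> E" for e
      using h e weak_deriv_prim[OF length_pos[OF e]] by (simp add: L_def F_def L2_def)
    have LL: "L h \<in> L2 E l"
      using wd by (auto simp: L2_def weak_deriv_def) (simp add: L_def F_def)
    have h0: "h $ e = 0" if "e \<notin> E" for e using L2_outside[OF h that] .
    note H = dx_eqI[OF LL wd h0]
    have tr: "incidence e v * trace_at l (L h) e v = incidence e v * \<rho> e h + (if snd e = v then inner (h $ e) (ind (l e)) else 0)"
      if e: "e \<in> E" for e v
    proof -
      have "trace_at l (L h) e v = \<rho> e h + inner (h $ e) (ind (if v = fst e then 0 else l e))"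
        unfolding trace_at_def using point_value_prim[OF length_pos[OF e] end_point_in[OF e]] e
        by (simp add: L_def F_def)
      then show ?thesis using no_loop[OF e] by (auto simp: incidence_def)
    qed
    have "(\<Sum>e\<in>edges_at E v. incidence e v * trace_at l (L h) e v) = 0" if v: "v \<in> interior_vertices V E" for v
    proof -
      have "(\<Sum>e\<in>E. incidence e v * \<rho> e h) = - (\<Sum>e\<in>E. \<Sum>v'\<in>interior_vertices V E. incidence e v * (R v' e * inflow v' h))"
        by (simp add: \<rho>_def sum_distrib_left sum_negf)
      also have "\<dots> = - (\<Sum>v'\<in>interior_vertices V E. \<Sum>e\<in>E. incidence e v * (R v' e * inflow v' h))"
        by (subst sum.swap) simp
      also have "\<dots> = - (\<Sum>v'\<in>interior_vertices V E. if v' = v then inflow v h else 0)"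
      proof -
        have "(\<Sum>e\<in>E. incidence e v * (R v' e * inflow v' h)) = (if v' = v then inflow v h else 0)"
          if "v' \<in> interior_vertices V E" for v'
        proof -
          have "(\<Sum>e\<in>E. incidence e v * (R v' e * inflow v' h)) = (\<Sum>e\<in>E. incidence e v * R v' e) * inflow v' h"
            by (simp add: sum_distrib_right mult.assoc)
          then show ?thesis using R[OF that v] by auto
        qed
        then show ?thesis by simp
      qed
      also have "\<dots> = - inflow v h" using v by simp
      finally have "(\<Sum>e\<in>E. incidence e v * \<rho> e h) = - inflow v h" .
      then show ?thesis unfolding sum_edges_at by (simp add: tr sum.distrib inflow_def)
    qed
    then show ?thesis using H by (auto simp: Hdiv_def)
  qed
  then show thesis using that bL by blast
qed

text \<open>A zero derivative means a constant on each edge, so \<open>H0div\<close> lies in the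
  span of the edge indicators \<open>T\<close>.\<close>

lemma H0div_finite_span: obtains B where "finite B" "span B = H0div V E l"
proof -
  define T where "T = (\<lambda>e. axis e (ind (l e)) :: 'v net_fun) ` E"
  have sub: "H0div V E l \<subseteq> span T"
  proof
    fix u assume u: "u \<in> H0div V E l"
    then have uH: "u \<in> H1 E l" and u0: "dx E l u = 0" by (auto simp: H0div_def Hdiv_def)
    have "u = (\<Sum>e\<in>E. point_value (l e) (u $ e) 0 *\<^sub>R axis e (ind (l e)))"
      unfolding vec_eq_iff
    proof
      fix e
      have s: "(\<Sum>e\<in>E. point_value (l e) (u $ e) 0 *\<^sub>R axis e (ind (l e))) $ e
        = (\<Sum>e'\<in>E. if e' = e then point_value (l e) (u $ e) 0 *\<^sub>R ind (l e) else 0)"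
        unfolding sum_component by (rule sum.cong) (auto simp: axis_def)
      show "u $ e = (\<Sum>e\<in>E. point_value (l e) (u $ e) 0 *\<^sub>R axis e (ind (l e))) $ e"
      proof (cases "e \<in> E")
        case True
        have "prim (l e) 0 = 0" using prim_scaleR[of "l e" 0 0] by simp
        then show ?thesis unfolding s
          using weak_deriv_decomp[OF length_pos[OF True] weak_deriv_dx[OF uH True]] True u0 by simp
      next
        case False
        then show ?thesis unfolding s using L2_outside[OF H1_L2[OF uH]] by simp
      qed
    qed
    also have "\<dots> \<in> span T" by (intro span_sum span_scale span_base) (auto simp: T_def)
    finally show "u \<in> span T" .
  qed
  \<comment> \<open>The flux balance may exclude individual elements of \<open>T\<close>, so a basis
    is taken inside \<open>H0div\<close>; independence within the span of the finite set
    \<open>T\<close> makes it finite.\<close>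
  obtain B where B: "B \<subseteq> H0div V E l" "independent B" "H0div V E l \<subseteq> span B"
    using maximal_independent_subset by blast
  have "finite B"
    using independent_span_bound[of T B] B sub by (auto simp: T_def)
  moreover have "span B = H0div V E l"
  proof
    have "subspace (H0div V E l)"
      unfolding subspace_def
    proof (intro conjI ballI allI)
      have "weak_deriv (l e) 0 0" if "e \<in> E" for e
        using weak_deriv_prim[OF length_pos[OF that], of 0 0] prim_scaleR[of "l e" 0 0] by simp
      then have H: "0 \<in> H1 E l" "dx E l 0 = 0"
        using dx_eqI[of 0 0] by (auto simp: L2_def)
      then have "trace_at l 0 e v = 0" if "e \<in> E" for e v
        using trace_scaleR[OF H(1) that, of 0 v] by simp
      then show "0 \<in> H0div V E l"
        using H by (auto simp: H0div_def Hdiv_def edges_atD)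
    qed (auto simp: H0div_def Hdiv_add Hdiv_scaleR dx_add dx_scaleR Hdiv_H1)
    then show "span B \<subseteq> H0div V E l" using B(1) by (rule span_minimal[rotated])
  qed (rule B(3))
  ultimately show thesis by (rule that)
qed

end

section \<open>The Lyapunov argument\<close>

text \<open>The first condition keeps the cross term below half of the energy, the second lets the
  dissipation of \<open>w\<close> pay for the cross terms, and \<open>\<epsilon> \<le> 1\<close>
  equalises the two rates. \<open>D\<close> is the sum of everything to be dominated and \<epsilon>
  is \<open>m / (2 * D)\<close>.\<close>

lemma damping_constants:
  fixes m M K :: real
  assumes "0 < m" "0 < M" "0 \<le> K"
  obtains \<epsilon> where "0 < \<epsilon>" "\<epsilon> * (M * K) \<le> m / 2" "\<epsilon> * (M + M\<^sup>2 * K\<^sup>2 / (2 * m)) \<le> m / 2" "\<epsilon> \<le> 1"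
proof -
  define D where "D = M * K + (M + M\<^sup>2 * K\<^sup>2 / (2 * m)) + m"
  have p: "0 \<le> M * K" "0 \<le> M + M\<^sup>2 * K\<^sup>2 / (2 * m)" using assms by auto
  then have "D > 0" using assms unfolding D_def by (intro add_nonneg_pos add_nonneg_nonneg) auto
  with p have D: "D > 0" "M * K \<le> D" "M + M\<^sup>2 * K\<^sup>2 / (2 * m) \<le> D" "m \<le> D" using assms by (auto simp: D_def)
  have le: "m / (2 * D) * x \<le> m / 2" if "x \<le> D" for x
  proof -
    have "m / (2 * D) * x \<le> m / (2 * D) * D" using that D(1) assms by (intro mult_left_mono) auto
    then show ?thesis using D(1) by simp
  qed
  show thesis
    by (rule that[of "m / (2 * D)"]) (use D assms le in auto)
qed

text \<open>Completing the square \<open>(m * y - M * K * x)^2 / (2 * m)\<close> charges the mixed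
  term half to \<open>m * y^2\<close> and the rest to \<open>x^2\<close>. The second smallness
  condition takes at most half of \<open>m * x^2\<close>; the other half is then reduced by
  \<open>\<epsilon> \<le> 1\<close>.\<close>

lemma lyapunov_dissipation:
  fixes x y m M K \<epsilon> :: real
  assumes "0 < m" "0 < \<epsilon>" "\<epsilon> \<le> 1" "\<epsilon> * (M + M\<^sup>2 * K\<^sup>2 / (2 * m)) \<le> m / 2"
  shows "- m * x\<^sup>2 - \<epsilon> * (m * y\<^sup>2 - M * K * x * y - M * x\<^sup>2) \<le> - (\<epsilon> * m / 2) * (x\<^sup>2 + y\<^sup>2)"
proof -
  define S where "S = M\<^sup>2 * K\<^sup>2 / (2 * m)"
  have "0 \<le> (m * y - M * K * x)\<^sup>2 / (2 * m)" using assms by simp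
  also have "\<dots> = m / 2 * y\<^sup>2 - M * K * x * y + S * x\<^sup>2"
    using assms by (simp add: S_def field_simps power2_eq_square)
  finally have 1: "M * K * x * y \<le> m / 2 * y\<^sup>2 + S * x\<^sup>2" by simp
  have 2: "\<epsilon> * (M * K * x * y) \<le> \<epsilon> * (m / 2 * y\<^sup>2 + S * x\<^sup>2)"
    using mult_left_mono[OF 1, of \<epsilon>] assms by simp
  have 3: "\<epsilon> * (M + S) * x\<^sup>2 \<le> m / 2 * x\<^sup>2"
    by (rule mult_right_mono[OF assms(4)[folded S_def]]) simp
  have 4: "\<epsilon> * (m / 2 * x\<^sup>2) \<le> 1 * (m / 2 * x\<^sup>2)" by (rule mult_right_mono) (use assms in auto)
  show ?thesis using 2 3 4 by (simp add: algebra_simps)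
qed

lemma inner_has_real_derivative:
  fixes f g :: "real \<Rightarrow> 'a::real_inner"
  assumes "(f has_vector_derivative f') (at t within S)" "(g has_vector_derivative g') (at t within S)"
  shows "((\<lambda>t. inner (f t) (g t)) has_real_derivative (inner (f t) g' + inner f' (g t))) (at t within S)"
  unfolding has_real_derivative_iff_has_vector_derivative
  by (rule bounded_bilinear.has_vector_derivative[OF bounded_bilinear_inner assms])

text \<open>Here \<open>A\<close>, \<open>B\<close>, \<open>D\<close> stand for multiplication by
  \<open>a\<close>, \<open>b\<close>, \<open>c\<close>, and \<open>v\<close> is the auxiliary
  function paired with \<open>D w\<close>. The constants are fixed before all operators and
  trajectories, which yields uniformity over the discrete spaces. The identities are demanded on the
  open interval only, as the evolution equations are not imposed at time 0.\<close>

lemma lyapunov_decay: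
  fixes m M K :: real
  assumes pos: "0 < m" "0 < M" "0 \<le> K"
  obtains C \<gamma> where "0 < C" "0 < \<gamma>"
    "\<And>A B D (w :: real \<Rightarrow> 'a::real_inner) w' (q :: real \<Rightarrow> 'a) q' v v' s t. \<lbrakk>
      s \<le> t;
      bounded_linear B; bounded_linear D;
      \<And>x y. inner (B x) y = inner x (B y); \<And>x y. inner (D x) y = inner x (D y);
      \<And>x. norm (A x) \<le> M * norm x; \<And>x. norm (B x) \<le> M * norm x; \<And>x. norm (D x) \<le> M * norm x;
      \<And>\<tau>. \<tau> \<in> {s..t} \<Longrightarrow> m * (norm (w \<tau>))\<^sup>2 \<le> inner (A (w \<tau>)) (w \<tau>);
      \<And>\<tau>. \<tau> \<in> {s..t} \<Longrightarrow> m * (norm (w \<tau>))\<^sup>2 \<le> inner (D (w \<tau>)) (w \<tau>);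
      \<And>\<tau>. \<tau> \<in> {s..t} \<Longrightarrow> m * (norm (q \<tau>))\<^sup>2 \<le> inner (B (q \<tau>)) (q \<tau>);
      \<And>\<tau>. \<tau> \<in> {s..t} \<Longrightarrow> (w has_vector_derivative w' \<tau>) (at \<tau> within {s..t});
      \<And>\<tau>. \<tau> \<in> {s..t} \<Longrightarrow> (q has_vector_derivative q' \<tau>) (at \<tau> within {s..t});
      \<And>\<tau>. \<tau> \<in> {s..t} \<Longrightarrow> (v has_vector_derivative v' \<tau>) (at \<tau> within {s..t});
      \<And>\<tau>. \<tau> \<in> {s..t} \<Longrightarrow> norm (v \<tau>) \<le> K * norm (q \<tau>);
      \<And>\<tau>. \<tau> \<in> {s<..<t} \<Longrightarrow> norm (v' \<tau>) \<le> norm (w \<tau>);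
      \<And>\<tau>. \<tau> \<in> {s<..<t} \<Longrightarrow> inner (D (w' \<tau>)) (w \<tau>) + inner (B (q' \<tau>)) (q \<tau>) = - inner (A (w \<tau>)) (w \<tau>);
      \<And>\<tau>. \<tau> \<in> {s<..<t} \<Longrightarrow> inner (D (w' \<tau>)) (v \<tau>) = inner (q \<tau>) (B (q \<tau>)) - inner (A (w \<tau>)) (v \<tau>)\<rbrakk>
      \<Longrightarrow> (norm (w t))\<^sup>2 + (norm (q t))\<^sup>2 \<le> C * exp (- \<gamma> * (t - s)) * ((norm (w s))\<^sup>2 + (norm (q s))\<^sup>2)"
proof -
  obtain \<epsilon> where \<epsilon>: "0 < \<epsilon>" "\<epsilon> * (M * K) \<le> m / 2" "\<epsilon> * (M + M\<^sup>2 * K\<^sup>2 / (2 * m)) \<le> m / 2" "\<epsilon> \<le> 1"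
    using damping_constants[OF pos] by blast
  \<comment> \<open>\<open>C\<close> is the quotient of the equivalence constants
    \<open>M + m\<close> and \<open>m / 4\<close> between \<open>L\<close> and \<open>N\<close>
    below; \<gamma> is the dissipation rate \<open>\<epsilon> * m / 2\<close> of \<open>N\<close>,
    divided by the upper constant.\<close>
  define C where "C = 4 * (M + m) / m"
  define \<gamma> where "\<gamma> = (\<epsilon> * m / 2) / (M + m)"
  have C: "0 < C" and \<gamma>: "0 < \<gamma>" using pos \<epsilon> by (auto simp: C_def \<gamma>_def)
  show thesis
  proof (rule that[OF C \<gamma>])
    fix A B D :: "'a \<Rightarrow> 'a" and w w' q q' v v' :: "real \<Rightarrow> 'a" and s t
    assume st: "s \<le> t"
      and bl: "bounded_linear B" "bounded_linear D"
      and sym: "\<And>x y. inner (B x) y = inner x (B y)" "\<And>x y. inner (D x) y = inner x (D y)"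
      and bd: "\<And>x. norm (A x) \<le> M * norm x" "\<And>x. norm (B x) \<le> M * norm x" "\<And>x. norm (D x) \<le> M * norm x"
      and co: "\<And>\<tau>. \<tau> \<in> {s..t} \<Longrightarrow> m * (norm (w \<tau>))\<^sup>2 \<le> inner (A (w \<tau>)) (w \<tau>)"
        "\<And>\<tau>. \<tau> \<in> {s..t} \<Longrightarrow> m * (norm (w \<tau>))\<^sup>2 \<le> inner (D (w \<tau>)) (w \<tau>)"
        "\<And>\<tau>. \<tau> \<in> {s..t} \<Longrightarrow> m * (norm (q \<tau>))\<^sup>2 \<le> inner (B (q \<tau>)) (q \<tau>)"
      and der: "\<And>\<tau>. \<tau> \<in> {s..t} \<Longrightarrow> (w has_vector_derivative w' \<tau>) (at \<tau> within {s..t})"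
        "\<And>\<tau>. \<tau> \<in> {s..t} \<Longrightarrow> (q has_vector_derivative q' \<tau>) (at \<tau> within {s..t})"
        "\<And>\<tau>. \<tau> \<in> {s..t} \<Longrightarrow> (v has_vector_derivative v' \<tau>) (at \<tau> within {s..t})"
      and v: "\<And>\<tau>. \<tau> \<in> {s..t} \<Longrightarrow> norm (v \<tau>) \<le> K * norm (q \<tau>)"
      and v': "\<And>\<tau>. \<tau> \<in> {s<..<t} \<Longrightarrow> norm (v' \<tau>) \<le> norm (w \<tau>)"
      and en: "\<And>\<tau>. \<tau> \<in> {s<..<t} \<Longrightarrow> inner (D (w' \<tau>)) (w \<tau>) + inner (B (q' \<tau>)) (q \<tau>) = - inner (A (w \<tau>)) (w \<tau>)"
      and cr: "\<And>\<tau>. \<tau> \<in> {s<..<t} \<Longrightarrow> inner (D (w' \<tau>)) (v \<tau>) = inner (q \<tau>) (B (q \<tau>)) - inner (A (w \<tau>)) (v \<tau>)"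
    define N where "N \<tau> = (norm (w \<tau>))\<^sup>2 + (norm (q \<tau>))\<^sup>2" for \<tau>
    define L where "L \<tau> = (inner (D (w \<tau>)) (w \<tau>) + inner (B (q \<tau>)) (q \<tau>)) / 2 - \<epsilon> * inner (D (w \<tau>)) (v \<tau>)" for \<tau>
    define L' where "L' \<tau> = (inner (D (w \<tau>)) (w' \<tau>) + inner (D (w' \<tau>)) (w \<tau>) + (inner (B (q \<tau>)) (q' \<tau>) + inner (B (q' \<tau>)) (q \<tau>))) / 2
        - \<epsilon> * (inner (D (w \<tau>)) (v' \<tau>) + inner (D (w' \<tau>)) (v \<tau>))" for \<tau>
    have ib: "\<bar>inner (F x) y\<bar> \<le> M * norm x * norm y" if "\<And>x. norm (F x) \<le> M * norm x" for F :: "'a \<Rightarrow> 'a" and x y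
      by (rule order_trans[OF Cauchy_Schwarz_ineq2 mult_right_mono[OF that]]) simp
    have cross: "\<bar>\<epsilon> * inner (D (w \<tau>)) (v \<tau>)\<bar> \<le> m / 4 * N \<tau>" if \<tau>: "\<tau> \<in> {s..t}" for \<tau>
    proof -
      have "\<bar>inner (D (w \<tau>)) (v \<tau>)\<bar> \<le> M * norm (w \<tau>) * norm (v \<tau>)" by (rule ib[OF bd(3)])
      also have "\<dots> \<le> M * norm (w \<tau>) * (K * norm (q \<tau>))"
        using v[OF \<tau>] pos by (intro mult_left_mono) auto
      finally have "\<epsilon> * \<bar>inner (D (w \<tau>)) (v \<tau>)\<bar> \<le> \<epsilon> * (M * K) * (norm (w \<tau>) * norm (q \<tau>))"
        using mult_left_mono[of _ _ \<epsilon>] \<epsilon>(1) by (fastforce simp: mult_ac)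
      also have "\<dots> \<le> m / 2 * (norm (w \<tau>) * norm (q \<tau>))"
        by (rule mult_right_mono[OF \<epsilon>(2)]) simp
      also have "\<dots> \<le> m / 2 * (N \<tau> / 2)"
        using pos sum_squares_bound[of "norm (w \<tau>)" "norm (q \<tau>)"] by (intro mult_left_mono) (auto simp: N_def)
      finally show ?thesis using \<epsilon>(1) by (simp add: abs_mult)
    qed
    \<comment> \<open>Coercivity gives the energy at least \<open>m / 2 * N\<close>, and the cross
      term costs at most half of that.\<close>
    have lower: "m / 4 * N \<tau> \<le> L \<tau>" if \<tau>: "\<tau> \<in> {s..t}" for \<tau>
      using co(2,3)[OF \<tau>] cross[OF \<tau>] by (simp add: L_def N_def algebra_simps)
    have upper: "L \<tau> \<le> (M + m) * N \<tau>" if \<tau>: "\<tau> \<in> {s..t}" for \<tau>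
    proof -
      have "inner (D (w \<tau>)) (w \<tau>) \<le> M * (norm (w \<tau>))\<^sup>2" "inner (B (q \<tau>)) (q \<tau>) \<le> M * (norm (q \<tau>))\<^sup>2"
        using ib[of D "w \<tau>" "w \<tau>", OF bd(3)] ib[of B "q \<tau>" "q \<tau>", OF bd(2)] by (auto simp: power2_eq_square mult_ac)
      moreover have "M * N \<tau> = M * (norm (w \<tau>))\<^sup>2 + M * (norm (q \<tau>))\<^sup>2"
        by (simp add: N_def distrib_left)
      ultimately have "(inner (D (w \<tau>)) (w \<tau>) + inner (B (q \<tau>)) (q \<tau>)) / 2 \<le> M * N \<tau> / 2" by simp
      moreover have "- (\<epsilon> * inner (D (w \<tau>)) (v \<tau>)) \<le> m / 4 * N \<tau>" using cross[OF \<tau>] by (simp add: abs_le_iff)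
      ultimately have "L \<tau> \<le> M * N \<tau> / 2 + m / 4 * N \<tau>" unfolding L_def by (simp only: diff_conv_add_uminus add_mono)
      also have "\<dots> \<le> (M + m) * N \<tau>"
      proof -
        have "0 \<le> M * N \<tau>" "0 \<le> m * N \<tau>" using pos by (auto simp: N_def)
        then show ?thesis by (simp add: algebra_simps)
      qed
      finally show ?thesis .
    qed
    have LD: "(L has_real_derivative L' \<tau>) (at \<tau> within {s..t})" if \<tau>: "\<tau> \<in> {s..t}" for \<tau>
      unfolding L_def L'_def
      by (intro DERIV_diff DERIV_cdivide DERIV_add DERIV_cmult inner_has_real_derivative
          bounded_linear.has_vector_derivative[OF bl(1)] bounded_linear.has_vector_derivative[OF bl(2)] der \<tau>)
    have diss: "L' \<tau> \<le> - \<gamma> * L \<tau>" if \<tau>: "\<tau> \<in> {s<..<t}" for \<tau>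
    proof -
      have \<tau>': "\<tau> \<in> {s..t}" using \<tau> by auto
      \<comment> \<open>By symmetry of \<open>B\<close> and \<open>D\<close> the two summands from
        each quadratic term coincide, which cancels the factor one half; then both identities are
        inserted.\<close>
      have "L' \<tau> = - inner (A (w \<tau>)) (w \<tau>) - \<epsilon> * (inner (D (w \<tau>)) (v' \<tau>) + (inner (B (q \<tau>)) (q \<tau>) - inner (A (w \<tau>)) (v \<tau>)))"
        using en[OF \<tau>] cr[OF \<tau>] sym(1)[of "q \<tau>" "q' \<tau>"] sym(2)[of "w \<tau>" "w' \<tau>"]
        by (simp add: L'_def sym inner_commute)
      also have "\<dots> \<le> - m * (norm (w \<tau>))\<^sup>2 - \<epsilon> * (m * (norm (q \<tau>))\<^sup>2 - M * K * norm (w \<tau>) * norm (q \<tau>) - M * (norm (w \<tau>))\<^sup>2)"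
      proof -
        have "\<bar>inner (D (w \<tau>)) (v' \<tau>)\<bar> \<le> M * norm (w \<tau>) * norm (v' \<tau>)" by (rule ib[OF bd(3)])
        also have "\<dots> \<le> M * norm (w \<tau>) * norm (w \<tau>)" using v'[OF \<tau>] pos by (intro mult_left_mono) auto
        finally have 1: "\<bar>inner (D (w \<tau>)) (v' \<tau>)\<bar> \<le> M * (norm (w \<tau>))\<^sup>2" by (simp add: power2_eq_square mult_ac)
        have "\<bar>inner (A (w \<tau>)) (v \<tau>)\<bar> \<le> M * norm (w \<tau>) * norm (v \<tau>)" by (rule ib[OF bd(1)])
        also have "\<dots> \<le> M * norm (w \<tau>) * (K * norm (q \<tau>))" using v[OF \<tau>'] pos by (intro mult_left_mono) auto
        finally have 2: "\<bar>inner (A (w \<tau>)) (v \<tau>)\<bar> \<le> M * K * norm (w \<tau>) * norm (q \<tau>)" by (simp add: mult_ac)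
        have "\<epsilon> * (m * (norm (q \<tau>))\<^sup>2 - M * K * norm (w \<tau>) * norm (q \<tau>) - M * (norm (w \<tau>))\<^sup>2)
          \<le> \<epsilon> * (inner (D (w \<tau>)) (v' \<tau>) + (inner (B (q \<tau>)) (q \<tau>) - inner (A (w \<tau>)) (v \<tau>)))"
          using 1 2 co(3)[OF \<tau>'] \<epsilon>(1) by (intro mult_left_mono) auto
        then show ?thesis using co(1)[OF \<tau>'] by simp
      qed
      also have "\<dots> \<le> - (\<epsilon> * m / 2) * N \<tau>"
        unfolding N_def by (rule lyapunov_dissipation[OF pos(1) \<epsilon>(1,4,3)])
      also have "\<dots> = - \<gamma> * ((M + m) * N \<tau>)"
      proof -
        have "M + m \<noteq> 0" using pos by simp
        then have "\<gamma> * (M + m) = \<epsilon> * m / 2" using nonzero_eq_divide_eq \<gamma>_def by blast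
        then show ?thesis by (metis mult.assoc mult_minus_left)
      qed
      also have "\<dots> \<le> - \<gamma> * L \<tau>" using upper[OF \<tau>'] \<gamma> by simp
      finally show ?thesis .
    qed
    \<comment> \<open>Gronwall with an integrating factor: \<Phi> is continuous on the closed
      interval and its derivative is nonpositive inside.\<close>
    define \<Phi> where "\<Phi> \<tau> = exp (\<gamma> * (\<tau> - s)) * L \<tau>" for \<tau>
    have \<Phi>D: "(\<Phi> has_real_derivative exp (\<gamma> * (\<tau> - s)) * (\<gamma> * L \<tau> + L' \<tau>)) (at \<tau> within {s..t})" if \<tau>: "\<tau> \<in> {s..t}" for \<tau>
      unfolding \<Phi>_def by (rule derivative_eq_intros LD[OF \<tau>] refl)+ (simp add: algebra_simps)
    have "\<Phi> t \<le> \<Phi> s"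
    proof (rule DERIV_nonpos_imp_decreasing_open[OF st])
      fix \<tau> assume \<tau>: "s < \<tau>" "\<tau> < t"
      have "(\<Phi> has_real_derivative exp (\<gamma> * (\<tau> - s)) * (\<gamma> * L \<tau> + L' \<tau>)) (at \<tau>)"
        using \<Phi>D[of \<tau>] \<tau> by (simp add: at_within_Icc_at)
      moreover have "exp (\<gamma> * (\<tau> - s)) * (\<gamma> * L \<tau> + L' \<tau>) \<le> 0"
        using diss[of \<tau>] \<tau> by (simp add: mult_le_0_iff)
      ultimately show "\<exists>y. (\<Phi> has_real_derivative y) (at \<tau>) \<and> y \<le> 0" by blast
    next
      show "continuous_on {s..t} \<Phi>"
        using DERIV_continuous[OF \<Phi>D] by (simp add: continuous_on_eq_continuous_within)
    qed
    then have "exp (\<gamma> * (t - s)) * L t \<le> L s" by (simp add: \<Phi>_def)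
    moreover have "exp (\<gamma> * (t - s)) * (m / 4 * N t) \<le> exp (\<gamma> * (t - s)) * L t"
      using lower[of t] st by (intro mult_left_mono) auto
    moreover have "L s \<le> (M + m) * N s" using upper[of s] st by auto
    ultimately have "exp (\<gamma> * (t - s)) * (m / 4 * N t) \<le> (M + m) * N s" by linarith
    moreover define e where "e = exp (\<gamma> * (t - s))"
    ultimately have "e * (m * N t) \<le> 4 * ((M + m) * N s)" by simp
    moreover have e: "0 < e" "exp (- \<gamma> * (t - s)) = inverse e" by (simp_all add: e_def exp_minus)
    ultimately have "N t \<le> C * exp (- \<gamma> * (t - s)) * N s"
      unfolding C_def e(2) using pos e(1) by (simp add: field_simps)
    then show "(norm (w t))\<^sup>2 + (norm (q t))\<^sup>2 \<le> C * exp (- \<gamma> * (t - s)) * ((norm (w s))\<^sup>2 + (norm (q s))\<^sup>2)"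
      by (simp add: N_def)
  qed
qed

section \<open>Decay of homogeneous solutions\<close>

context finite_network
begin

text \<open>\<Lambda> subtracts from the lift its projection onto \<open>H0div\<close>, which leaves
  the derivative unchanged. For \<open>u\<close> in \<open>Hdiv\<close>, the lift of
  \<open>dx E l u\<close> differs from \<open>u\<close> by an element of \<open>H0div\<close>, hence
  \<Lambda> returns \<open>u - P u\<close>: independent of the chosen lift and no longer than
  \<open>u\<close>.\<close>

lemma minimal_lift:
  assumes bd: "boundary_vertices V E \<noteq> {}"
  obtains \<Lambda> K where "bounded_linear \<Lambda>" "0 \<le> K" "\<And>h. norm (\<Lambda> h) \<le> K * norm h"
    "\<And>h. h \<in> L2 E l \<Longrightarrow> \<Lambda> h \<in> Hdiv V E l" "\<And>h. h \<in> L2 E l \<Longrightarrow> dx E l (\<Lambda> h) = h"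
    "\<And>u. u \<in> Hdiv V E l \<Longrightarrow> \<Lambda> (dx E l u) - u \<in> H0div V E l"
    "\<And>u. u \<in> Hdiv V E l \<Longrightarrow> norm (\<Lambda> (dx E l u)) \<le> norm u"
proof -
  obtain L where L: "bounded_linear L" "\<And>h. h \<in> L2 E l \<Longrightarrow> L h \<in> Hdiv V E l \<and> dx E l (L h) = h"
    using bounded_lift[OF bd] by blast
  obtain B where B: "finite B" "span B = H0div V E l" using H0div_finite_span by blast
  obtain P where P: "bounded_linear P" "\<And>x. P x \<in> H0div V E l" "\<And>x y. y \<in> H0div V E l \<Longrightarrow> inner (x - P x) y = 0"
    using orthogonal_projection_span[OF B(1)] unfolding B(2) by blast
  have sub: "x - y \<in> H0div V E l" if "x \<in> H0div V E l" "y \<in> H0div V E l" for x y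
    using that unfolding B(2)[symmetric] by (rule span_diff)
  have Pz: "P z = z" if "z \<in> H0div V E l" for z
    using P(3)[OF sub[OF that P(2)], of z z] by simp
  interpret P: bounded_linear P by (rule P(1))
  define \<Lambda> where "\<Lambda> h = L h - P (L h)" for h
  have bl: "bounded_linear \<Lambda>"
    unfolding \<Lambda>_def by (intro bounded_linear_sub L(1) bounded_linear_compose[OF P(1)])
  obtain K where K: "0 \<le> K" "\<And>h. norm (\<Lambda> h) \<le> norm h * K"
    using bounded_linear.nonneg_bounded[OF bl] by blast
  have z: "P x \<in> Hdiv V E l" "dx E l (P x) = 0" for x using P(2)[of x] by (auto simp: H0div_def)
  have h: "\<Lambda> h \<in> Hdiv V E l" "dx E l (\<Lambda> h) = h" if "h \<in> L2 E l" for h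
    using L(2)[OF that] z[of "L h"] by (auto simp: \<Lambda>_def Hdiv_diff dx_diff Hdiv_H1)
  have dxL: "dx E l u \<in> L2 E l" if "u \<in> Hdiv V E l" for u using that by (intro dx_L2 Hdiv_H1)
  have u: "\<Lambda> (dx E l u) = u - P u" if u: "u \<in> Hdiv V E l" for u
  proof -
    have "L (dx E l u) - u \<in> H0div V E l"
      using L(2)[OF dxL[OF u]] u by (auto simp: H0div_def Hdiv_diff dx_diff Hdiv_H1)
    from Pz[OF this] show ?thesis by (simp add: \<Lambda>_def P.diff algebra_simps)
  qed
  have P0: "0 - P u \<in> H0div V E l" for u
    using sub[OF P(2) P(2), of 0 u] P.zero by simp
  show thesis
  proof (rule that[OF bl K(1)])
    show "norm (\<Lambda> h) \<le> K * norm h" for h using K(2)[of h] by (simp add: mult.commute)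
    show "\<Lambda> (dx E l u) - u \<in> H0div V E l" if "u \<in> Hdiv V E l" for u
      using P0[of u] u[OF that] by simp
    show "norm (\<Lambda> (dx E l u)) \<le> norm u" if "u \<in> Hdiv V E l" for u
      unfolding u[OF that] by (rule norm_minus_projection_le[OF P(3)[OF P(2)]])
  qed (use h in auto)
qed

end

locale damped_network = finite_network V E l for V :: "'v::finite set" and E l +
  fixes a b c :: "'v net_fun" and C0 C1 :: real
  assumes boundary: "boundary_vertices V E \<noteq> {}"
    and coeff: "a \<in> L2 E l" "b \<in> L2 E l" "c \<in> L2 E l"
      "ae_between E l C0 C1 a" "ae_between E l C0 C1 b" "ae_between E l C0 C1 c"
    and pos: "0 < C0" "0 < C1"
begin

lemmas mult_linear = bounded_linear_net_mult[OF coeff(1,4) pos] bounded_linear_net_mult[OF coeff(2,5) pos]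
  bounded_linear_net_mult[OF coeff(3,6) pos]
lemmas mult_norm = norm_net_mult_le[OF coeff(1,4) pos] norm_net_mult_le[OF coeff(2,5) pos]
  norm_net_mult_le[OF coeff(3,6) pos]
lemmas mult_sym = inner_net_mult_commute[OF coeff(1,4) pos] inner_net_mult_commute[OF coeff(2,5) pos]
  inner_net_mult_commute[OF coeff(3,6) pos]
lemmas mult_coercive = net_mult_coercive[OF coeff(1,4) pos] net_mult_coercive[OF coeff(2,5) pos]
  net_mult_coercive[OF coeff(3,6) pos]

text \<open>The projection \<open>R\<close> onto the pressure space is the identity for the continuous problem and the
  \<open>L\<^sup>2\<close>-projection onto \<open>Q\<^sub>h\<close> for the discrete one.\<close>

lemma weak_solution_decay:
  obtains C \<gamma> where "0 < C" "0 < \<gamma>"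
    "\<And>X Q R w w' q q' s t. \<lbrakk>s \<le> t; X \<subseteq> Hdiv V E l; Q \<subseteq> L2 E l; bounded_linear R;
      \<And>x. norm (R x) \<le> norm x; \<And>x. x \<in> L2 E l \<Longrightarrow> R x \<in> Q; \<And>x y. y \<in> Q \<Longrightarrow> inner (R x) y = inner x y;
      Q \<subseteq> dx E l ` X; \<And>x z. x \<in> X \<Longrightarrow> z \<in> H0div V E l \<Longrightarrow> x + z \<in> X;
      \<And>\<tau>. \<tau> \<in> {s..t} \<Longrightarrow> (w has_vector_derivative w' \<tau>) (at \<tau> within {s..t});
      \<And>\<tau>. \<tau> \<in> {s..t} \<Longrightarrow> (q has_vector_derivative q' \<tau>) (at \<tau> within {s..t});
      \<And>\<tau>. \<tau> \<in> {s..t} \<Longrightarrow> w \<tau> \<in> X; \<And>\<tau>. \<tau> \<in> {s..t} \<Longrightarrow> q \<tau> \<in> Q;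
      \<And>\<tau> v. \<tau> \<in> {s<..<t} \<Longrightarrow> v \<in> X \<Longrightarrow>
        inner (c \<odot> w' \<tau>) v - inner (q \<tau>) (dx E l v) + inner (a \<odot> w \<tau>) v = 0;
      \<And>\<tau>. \<tau> \<in> {s<..<t} \<Longrightarrow> R (b \<odot> q' \<tau>) = - dx E l (w \<tau>)\<rbrakk>
      \<Longrightarrow> (norm (w t))\<^sup>2 + (norm (q t))\<^sup>2 \<le> C * exp (- \<gamma> * (t - s)) * ((norm (w s))\<^sup>2 + (norm (q s))\<^sup>2)"
proof -
  obtain \<Lambda> K where \<Lambda>: "bounded_linear \<Lambda>" "0 \<le> K" "\<And>h. norm (\<Lambda> h) \<le> K * norm h"
    "\<And>h. h \<in> L2 E l \<Longrightarrow> \<Lambda> h \<in> Hdiv V E l" "\<And>h. h \<in> L2 E l \<Longrightarrow> dx E l (\<Lambda> h) = h"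
    "\<And>u. u \<in> Hdiv V E l \<Longrightarrow> \<Lambda> (dx E l u) - u \<in> H0div V E l"
    "\<And>u. u \<in> Hdiv V E l \<Longrightarrow> norm (\<Lambda> (dx E l u)) \<le> norm u"
    by (rule minimal_lift[OF boundary]) blast
  \<comment> \<open>The auxiliary function is \<Lambda> applied to \<open>R (b \<odot> q)\<close>,
    so its bound by \<open>q\<close> is the product of \<open>K\<close>, the contraction bound of
    \<open>R\<close> and \<open>C1\<close>.\<close>
  have K: "0 \<le> K * C1" using \<Lambda>(2) pos by simp
  interpret \<Lambda>: bounded_linear \<Lambda> by (rule \<Lambda>(1))
  show thesis
  proof (rule lyapunov_decay[OF pos K, where 'a = "'v net_fun"])
    fix C \<gamma> :: real
    assume C: "0 < C" "0 < \<gamma>" and decay: "\<And>A B D (w :: real \<Rightarrow> 'v net_fun) w' (q :: real \<Rightarrow> 'v net_fun) q' v v' s t. \<lbrakk>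
      s \<le> t;
      bounded_linear B; bounded_linear D;
      \<And>x y. inner (B x) y = inner x (B y); \<And>x y. inner (D x) y = inner x (D y);
      \<And>x. norm (A x) \<le> C1 * norm x; \<And>x. norm (B x) \<le> C1 * norm x; \<And>x. norm (D x) \<le> C1 * norm x;
      \<And>\<tau>. \<tau> \<in> {s..t} \<Longrightarrow> C0 * (norm (w \<tau>))\<^sup>2 \<le> inner (A (w \<tau>)) (w \<tau>);
      \<And>\<tau>. \<tau> \<in> {s..t} \<Longrightarrow> C0 * (norm (w \<tau>))\<^sup>2 \<le> inner (D (w \<tau>)) (w \<tau>);
      \<And>\<tau>. \<tau> \<in> {s..t} \<Longrightarrow> C0 * (norm (q \<tau>))\<^sup>2 \<le> inner (B (q \<tau>)) (q \<tau>);
      \<And>\<tau>. \<tau> \<in> {s..t} \<Longrightarrow> (w has_vector_derivative w' \<tau>) (at \<tau> within {s..t});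
      \<And>\<tau>. \<tau> \<in> {s..t} \<Longrightarrow> (q has_vector_derivative q' \<tau>) (at \<tau> within {s..t});
      \<And>\<tau>. \<tau> \<in> {s..t} \<Longrightarrow> (v has_vector_derivative v' \<tau>) (at \<tau> within {s..t});
      \<And>\<tau>. \<tau> \<in> {s..t} \<Longrightarrow> norm (v \<tau>) \<le> K * C1 * norm (q \<tau>);
      \<And>\<tau>. \<tau> \<in> {s<..<t} \<Longrightarrow> norm (v' \<tau>) \<le> norm (w \<tau>);
      \<And>\<tau>. \<tau> \<in> {s<..<t} \<Longrightarrow> inner (D (w' \<tau>)) (w \<tau>) + inner (B (q' \<tau>)) (q \<tau>) = - inner (A (w \<tau>)) (w \<tau>);
      \<And>\<tau>. \<tau> \<in> {s<..<t} \<Longrightarrow> inner (D (w' \<tau>)) (v \<tau>) = inner (q \<tau>) (B (q \<tau>)) - inner (A (w \<tau>)) (v \<tau>)\<rbrakk>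
      \<Longrightarrow> (norm (w t))\<^sup>2 + (norm (q t))\<^sup>2 \<le> C * exp (- \<gamma> * (t - s)) * ((norm (w s))\<^sup>2 + (norm (q s))\<^sup>2)"
    show thesis
    proof (rule that[OF C])
      fix X Q R w w' q q' s t
      assume st: "s \<le> t" and XQ: "X \<subseteq> Hdiv V E l" "Q \<subseteq> L2 E l"
        and R: "bounded_linear R" "\<And>x. norm (R x) \<le> norm x" "\<And>x. x \<in> L2 E l \<Longrightarrow> R x \<in> Q" "\<And>x y. y \<in> Q \<Longrightarrow> inner (R x) y = inner x y"
        and comp: "Q \<subseteq> dx E l ` X" "\<And>x z. x \<in> X \<Longrightarrow> z \<in> H0div V E l \<Longrightarrow> x + z \<in> X"
        and der: "\<And>\<tau>. \<tau> \<in> {s..t} \<Longrightarrow> (w has_vector_derivative w' \<tau>) (at \<tau> within {s..t})"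
          "\<And>\<tau>. \<tau> \<in> {s..t} \<Longrightarrow> (q has_vector_derivative q' \<tau>) (at \<tau> within {s..t})"
        and mem: "\<And>\<tau>. \<tau> \<in> {s..t} \<Longrightarrow> w \<tau> \<in> X" "\<And>\<tau>. \<tau> \<in> {s..t} \<Longrightarrow> q \<tau> \<in> Q"
        and eq1: "\<And>\<tau> v. \<tau> \<in> {s<..<t} \<Longrightarrow> v \<in> X \<Longrightarrow>
          inner (c \<odot> w' \<tau>) v - inner (q \<tau>) (dx E l v) + inner (a \<odot> w \<tau>) v = 0"
        and eq2: "\<And>\<tau>. \<tau> \<in> {s<..<t} \<Longrightarrow> R (b \<odot> q' \<tau>) = - dx E l (w \<tau>)"
      define T where "T x = \<Lambda> (R (b \<odot> x))" for x
      have T: "bounded_linear T"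
        unfolding T_def by (intro bounded_linear_compose[OF \<Lambda>(1)] bounded_linear_compose[OF R(1)] mult_linear)
      have w2: "w \<tau> \<in> Hdiv V E l" "w \<tau> \<in> L2 E l" if "\<tau> \<in> {s..t}" for \<tau>
        using mem(1)[OF that] XQ(1) H1_L2 Hdiv_H1 by auto
      have q2: "q \<tau> \<in> L2 E l" if "\<tau> \<in> {s..t}" for \<tau> using mem(2)[OF that] XQ(2) by auto
      have Tq: "T (q \<tau>) \<in> X" "dx E l (T (q \<tau>)) = R (b \<odot> q \<tau>)" if \<tau>: "\<tau> \<in> {s..t}" for \<tau>
      proof -
        have RQ: "R (b \<odot> q \<tau>) \<in> Q" using net_mult_L2[OF coeff(2,5) pos q2[OF \<tau>]] by (rule R(3))
        then show "dx E l (T (q \<tau>)) = R (b \<odot> q \<tau>)" using XQ(2) \<Lambda>(5) by (auto simp: T_def)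
        \<comment> \<open>Some preimage exists in \<open>X\<close>; the minimal lift differs from it
          by an element of \<open>H0div\<close>, under whose addition \<open>X\<close> is stable.
          This is where compatibility of the spaces enters.\<close>
        obtain x where x: "x \<in> X" "dx E l x = R (b \<odot> q \<tau>)" using RQ comp(1) by (metis image_iff subset_iff)
        have "\<Lambda> (dx E l x) - x \<in> H0div V E l" using \<Lambda>(6) x(1) XQ(1) by blast
        from comp(2)[OF x(1) this] show "T (q \<tau>) \<in> X" by (simp add: T_def x(2))
      qed
      show "(norm (w t))\<^sup>2 + (norm (q t))\<^sup>2 \<le> C * exp (- \<gamma> * (t - s)) * ((norm (w s))\<^sup>2 + (norm (q s))\<^sup>2)"
      proof (rule decay[OF st mult_linear(2,3) mult_sym(2,3) mult_norm(1,2,3)])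
        fix \<tau> assume \<tau>: "\<tau> \<in> {s..t}"
        show "C0 * (norm (w \<tau>))\<^sup>2 \<le> inner (a \<odot> w \<tau>) (w \<tau>)" "C0 * (norm (w \<tau>))\<^sup>2 \<le> inner (c \<odot> w \<tau>) (w \<tau>)"
          "C0 * (norm (q \<tau>))\<^sup>2 \<le> inner (b \<odot> q \<tau>) (q \<tau>)"
          using mult_coercive w2[OF \<tau>] q2[OF \<tau>] by auto
        show "((\<lambda>\<tau>. T (q \<tau>)) has_vector_derivative T (q' \<tau>)) (at \<tau> within {s..t})"
          by (rule bounded_linear.has_vector_derivative[OF T der(2)[OF \<tau>]])
        have "norm (T (q \<tau>)) \<le> K * norm (R (b \<odot> q \<tau>))" unfolding T_def by (rule \<Lambda>(3))
        also have "\<dots> \<le> K * (C1 * norm (q \<tau>))"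
          by (intro mult_left_mono order_trans[OF R(2) mult_norm(2)] \<Lambda>(2))
        finally show "norm (T (q \<tau>)) \<le> K * C1 * norm (q \<tau>)" by (simp add: mult.assoc)
      next
        fix \<tau> assume \<tau>: "\<tau> \<in> {s<..<t}"
        then have \<tau>': "\<tau> \<in> {s..t}" by auto
        \<comment> \<open>The pressure equation replaces \<open>R (b \<odot> q')\<close> by
          \<open>- dx E l w\<close>, and lifting a derivative back costs no norm. So no bound on
          \<open>q'\<close> or on the derivative of \<open>w\<close> is involved.\<close>
        show "norm (T (q' \<tau>)) \<le> norm (w \<tau>)"
          unfolding T_def eq2[OF \<tau>] \<Lambda>.neg using \<Lambda>(7)[OF w2(1)[OF \<tau>']] by simp
        have "inner (b \<odot> q' \<tau>) (q \<tau>) = inner (- dx E l (w \<tau>)) (q \<tau>)"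
          using R(4)[OF mem(2)[OF \<tau>'], of "b \<odot> q' \<tau>"] by (simp add: eq2[OF \<tau>])
        then show "inner (c \<odot> w' \<tau>) (w \<tau>) + inner (b \<odot> q' \<tau>) (q \<tau>) = - inner (a \<odot> w \<tau>) (w \<tau>)"
          using eq1[OF \<tau> mem(1)[OF \<tau>']] by (simp add: inner_commute)
        \<comment> \<open>Because \<open>q\<close> lies in \<open>Q\<close>, the projection
          disappears from the pairing and the coercivity of \<open>b\<close> is kept.\<close>
        have "inner (q \<tau>) (R (b \<odot> q \<tau>)) = inner (q \<tau>) (b \<odot> q \<tau>)"
          using R(4)[OF mem(2)[OF \<tau>'], of "b \<odot> q \<tau>"] by (simp add: inner_commute)
        then show "inner (c \<odot> w' \<tau>) (T (q \<tau>)) = inner (q \<tau>) (b \<odot> q \<tau>) - inner (a \<odot> w \<tau>) (T (q \<tau>))"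
          using eq1[OF \<tau> Tq(1)[OF \<tau>']] Tq(2)[OF \<tau>'] by simp
      qed (use der in auto)
    qed
  qed
qed

text \<open>Both settings are instances of one decay statement, hence the common constants. In the
  continuous one the spaces are \<open>Hdiv\<close> and \<open>L2\<close>,
  \<open>bounded_lift\<close> gives surjectivity of the derivative, and membership of
  \<open>q\<close> in \<open>H10\<close> serves to pass to the weak equation. In the discrete one,
  testing the second equation within \<open>Qh\<close> becomes an identity for the
  projection.\<close>

lemma homogeneous_decay:
  obtains C \<gamma> where "0 < C" "0 < \<gamma>"
    "\<And>w w' q q' s t. \<lbrakk>s \<le> t;
      \<And>\<tau>. \<tau> \<in> {s..t} \<Longrightarrow> (w has_vector_derivative w' \<tau>) (at \<tau> within {s..t});
      \<And>\<tau>. \<tau> \<in> {s..t} \<Longrightarrow> (q has_vector_derivative q' \<tau>) (at \<tau> within {s..t});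
      \<And>\<tau>. \<tau> \<in> {s..t} \<Longrightarrow> w \<tau> \<in> Hdiv V E l; \<And>\<tau>. \<tau> \<in> {s..t} \<Longrightarrow> q \<tau> \<in> H10 V E l;
      \<And>\<tau>. \<tau> \<in> {s<..<t} \<Longrightarrow> c \<odot> w' \<tau> + dx E l (q \<tau>) + a \<odot> w \<tau> = 0;
      \<And>\<tau>. \<tau> \<in> {s<..<t} \<Longrightarrow> b \<odot> q' \<tau> + dx E l (w \<tau>) = 0\<rbrakk>
      \<Longrightarrow> (norm (w t))\<^sup>2 + (norm (q t))\<^sup>2 \<le> C * exp (- \<gamma> * (t - s)) * ((norm (w s))\<^sup>2 + (norm (q s))\<^sup>2)"
    "\<And>Vh Qh w w' q q' s t. \<lbrakk>s \<le> t; finite_dim_subspace Vh; Vh \<subseteq> Hdiv V E l;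
      finite_dim_subspace Qh; Qh \<subseteq> L2 E l; dx E l ` Vh = Qh; H0div V E l \<subseteq> Vh;
      \<And>\<tau>. \<tau> \<in> {s..t} \<Longrightarrow> (w has_vector_derivative w' \<tau>) (at \<tau> within {s..t});
      \<And>\<tau>. \<tau> \<in> {s..t} \<Longrightarrow> (q has_vector_derivative q' \<tau>) (at \<tau> within {s..t});
      \<And>\<tau>. \<tau> \<in> {s..t} \<Longrightarrow> w \<tau> \<in> Vh; \<And>\<tau>. \<tau> \<in> {s..t} \<Longrightarrow> q \<tau> \<in> Qh;
      \<And>\<tau> v. \<tau> \<in> {s..t} \<Longrightarrow> v \<in> Vh \<Longrightarrow>
        inner (c \<odot> w' \<tau>) v - inner (q \<tau>) (dx E l v) + inner (a \<odot> w \<tau>) v = 0;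
      \<And>\<tau> r. \<tau> \<in> {s..t} \<Longrightarrow> r \<in> Qh \<Longrightarrow> inner (b \<odot> q' \<tau>) r + inner (dx E l (w \<tau>)) r = 0\<rbrakk>
      \<Longrightarrow> (norm (w t))\<^sup>2 + (norm (q t))\<^sup>2 \<le> C * exp (- \<gamma> * (t - s)) * ((norm (w s))\<^sup>2 + (norm (q s))\<^sup>2)"
proof (rule weak_solution_decay)
  fix C \<gamma> :: real
  assume C: "0 < C" "0 < \<gamma>" and decay: "\<And>X Q R w w' q q' s t. \<lbrakk>s \<le> t; X \<subseteq> Hdiv V E l; Q \<subseteq> L2 E l; bounded_linear R;
      \<And>x. norm (R x) \<le> norm x; \<And>x. x \<in> L2 E l \<Longrightarrow> R x \<in> Q; \<And>x y. y \<in> Q \<Longrightarrow> inner (R x) y = inner x y;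
      Q \<subseteq> dx E l ` X; \<And>x z. x \<in> X \<Longrightarrow> z \<in> H0div V E l \<Longrightarrow> x + z \<in> X;
      \<And>\<tau>. \<tau> \<in> {s..t} \<Longrightarrow> (w has_vector_derivative w' \<tau>) (at \<tau> within {s..t});
      \<And>\<tau>. \<tau> \<in> {s..t} \<Longrightarrow> (q has_vector_derivative q' \<tau>) (at \<tau> within {s..t});
      \<And>\<tau>. \<tau> \<in> {s..t} \<Longrightarrow> w \<tau> \<in> X; \<And>\<tau>. \<tau> \<in> {s..t} \<Longrightarrow> q \<tau> \<in> Q;
      \<And>\<tau> v. \<tau> \<in> {s<..<t} \<Longrightarrow> v \<in> X \<Longrightarrow>
        inner (c \<odot> w' \<tau>) v - inner (q \<tau>) (dx E l v) + inner (a \<odot> w \<tau>) v = 0;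
      \<And>\<tau>. \<tau> \<in> {s<..<t} \<Longrightarrow> R (b \<odot> q' \<tau>) = - dx E l (w \<tau>)\<rbrakk>
      \<Longrightarrow> (norm (w t))\<^sup>2 + (norm (q t))\<^sup>2 \<le> C * exp (- \<gamma> * (t - s)) * ((norm (w s))\<^sup>2 + (norm (q s))\<^sup>2)"
  show thesis
  proof (rule that[OF C])
    fix w w' q q' s t
    assume st: "s \<le> t"
      and der: "\<And>\<tau>. \<tau> \<in> {s..t} \<Longrightarrow> (w has_vector_derivative w' \<tau>) (at \<tau> within {s..t})"
        "\<And>\<tau>. \<tau> \<in> {s..t} \<Longrightarrow> (q has_vector_derivative q' \<tau>) (at \<tau> within {s..t})"
      and mem: "\<And>\<tau>. \<tau> \<in> {s..t} \<Longrightarrow> w \<tau> \<in> Hdiv V E l" "\<And>\<tau>. \<tau> \<in> {s..t} \<Longrightarrow> q \<tau> \<in> H10 V E l"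
      and eq: "\<And>\<tau>. \<tau> \<in> {s<..<t} \<Longrightarrow> c \<odot> w' \<tau> + dx E l (q \<tau>) + a \<odot> w \<tau> = 0"
        "\<And>\<tau>. \<tau> \<in> {s<..<t} \<Longrightarrow> b \<odot> q' \<tau> + dx E l (w \<tau>) = 0"
    show "(norm (w t))\<^sup>2 + (norm (q t))\<^sup>2 \<le> C * exp (- \<gamma> * (t - s)) * ((norm (w s))\<^sup>2 + (norm (q s))\<^sup>2)"
    proof (rule decay[OF st, where X = "Hdiv V E l" and Q = "L2 E l" and R = "\<lambda>x. x"])
      show "L2 E l \<subseteq> dx E l ` Hdiv V E l"
      proof
        fix h assume h: "h \<in> L2 E l"
        obtain L where "\<And>h. h \<in> L2 E l \<Longrightarrow> L h \<in> Hdiv V E l \<and> dx E l (L h) = h"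
          using bounded_lift[OF boundary] by blast
        with h show "h \<in> dx E l ` Hdiv V E l" by (metis imageI)
      qed
      fix \<tau> v assume \<tau>: "\<tau> \<in> {s<..<t}" and v: "v \<in> Hdiv V E l"
      have "q \<tau> \<in> H10 V E l" using mem(2) \<tau> by auto
      then have "inner (q \<tau>) (dx E l v) = - inner (dx E l (q \<tau>)) v" by (simp add: inner_dx_H10_Hdiv[OF v])
      then have "inner (c \<odot> w' \<tau>) v - inner (q \<tau>) (dx E l v) + inner (a \<odot> w \<tau>) v
        = inner (c \<odot> w' \<tau> + dx E l (q \<tau>) + a \<odot> w \<tau>) v" by (simp add: inner_add_left)
      then show "inner (c \<odot> w' \<tau>) v - inner (q \<tau>) (dx E l v) + inner (a \<odot> w \<tau>) v = 0"
        by (simp add: eq(1)[OF \<tau>])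
    next
      fix \<tau> assume \<tau>: "\<tau> \<in> {s<..<t}"
      show "b \<odot> q' \<tau> = - dx E l (w \<tau>)" using eq(2)[OF \<tau>] by (simp add: eq_neg_iff_add_eq_0)
    qed (use der mem in \<open>auto intro: H1_L2[OF H10_H1] H1_L2 Hdiv_add simp: H0div_def\<close>)
  next
    fix Vh Qh w w' q q' s t
    assume st: "s \<le> t" and fd: "finite_dim_subspace Vh" "Vh \<subseteq> Hdiv V E l"
      "finite_dim_subspace Qh" "Qh \<subseteq> L2 E l" "dx E l ` Vh = Qh" "H0div V E l \<subseteq> Vh"
      and der: "\<And>\<tau>. \<tau> \<in> {s..t} \<Longrightarrow> (w has_vector_derivative w' \<tau>) (at \<tau> within {s..t})"
        "\<And>\<tau>. \<tau> \<in> {s..t} \<Longrightarrow> (q has_vector_derivative q' \<tau>) (at \<tau> within {s..t})"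
      and mem: "\<And>\<tau>. \<tau> \<in> {s..t} \<Longrightarrow> w \<tau> \<in> Vh" "\<And>\<tau>. \<tau> \<in> {s..t} \<Longrightarrow> q \<tau> \<in> Qh"
      and eq: "\<And>\<tau> v. \<tau> \<in> {s..t} \<Longrightarrow> v \<in> Vh \<Longrightarrow>
          inner (c \<odot> w' \<tau>) v - inner (q \<tau>) (dx E l v) + inner (a \<odot> w \<tau>) v = 0"
        "\<And>\<tau> r. \<tau> \<in> {s..t} \<Longrightarrow> r \<in> Qh \<Longrightarrow> inner (b \<odot> q' \<tau>) r + inner (dx E l (w \<tau>)) r = 0"
    obtain B where B: "finite B" "Vh = span B" using fd(1) by (auto simp: finite_dim_subspace_def)
    obtain B' where B': "finite B'" "Qh = span B'" using fd(3) by (auto simp: finite_dim_subspace_def)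
    obtain P where P: "bounded_linear P" "\<And>x. P x \<in> Qh" "\<And>x y. y \<in> Qh \<Longrightarrow> inner (x - P x) y = 0"
      using orthogonal_projection_span[OF B'(1)] unfolding B'(2) by blast
    have Pi: "inner (P x) y = inner x y" if "y \<in> Qh" for x y
      using P(3)[OF that, of x] by (simp add: inner_diff_left)
    show "(norm (w t))\<^sup>2 + (norm (q t))\<^sup>2 \<le> C * exp (- \<gamma> * (t - s)) * ((norm (w s))\<^sup>2 + (norm (q s))\<^sup>2)"
    proof (rule decay[OF st fd(2,4) P(1)])
      \<comment> \<open>The remainder \<open>x - P x\<close> takes the role of the subtracted
        vector, so the difference is \<open>P x\<close>.\<close>
      show "norm (P x) \<le> norm x" for x
        using norm_minus_projection_le[of x "x - P x"] P(3)[OF P(2), of x x] by (simp add: inner_commute)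
      show "x + z \<in> Vh" if "x \<in> Vh" "z \<in> H0div V E l" for x z
        using that fd(6) unfolding B(2) by (intro span_add) auto
      fix \<tau> assume "\<tau> \<in> {s<..<t}"
      then have \<tau>: "\<tau> \<in> {s..t}" by auto
      \<comment> \<open>The residual lies in \<open>Qh\<close> because derivatives of elements of
        \<open>Vh\<close> do; it may be tested with itself and therefore vanishes.\<close>
      define x where "x = P (b \<odot> q' \<tau>) + dx E l (w \<tau>)"
      have "dx E l (w \<tau>) \<in> Qh" using mem(1)[OF \<tau>] fd(5) by auto
      then have x: "x \<in> Qh" using P(2) unfolding x_def B'(2) by (intro span_add)
      have "inner x x = 0" using eq(2)[OF \<tau> x] Pi[OF x] by (simp add: x_def inner_add_left)
      then show "P (b \<odot> q' \<tau>) = - dx E l (w \<tau>)" by (simp add: x_def eq_neg_iff_add_eq_0)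
    qed (use der mem eq P Pi fd in auto)
  qed
qed

end

section \<open>Regularity in time of finite dimensional functions\<close>

text \<open>For discrete time derivatives, which the equations determine only implicitly: their
  increments are controlled by those of functions already known to be continuous.\<close>

lemma continuous_on_dominated:
  fixes f :: "'t::topological_space \<Rightarrow> 'a::real_normed_vector"
    and g h :: "'t \<Rightarrow> 'b::real_normed_vector"
  assumes g: "continuous_on S g" and h: "continuous_on S h"
    and le: "\<And>x y. x \<in> S \<Longrightarrow> y \<in> S \<Longrightarrow> norm (f x - f y) \<le> K * norm (g x - g y) + M * norm (h x - h y)"
  shows "continuous_on S f"
  unfolding continuous_on_def
proof
  fix x assume x: "x \<in> S"
  have "((\<lambda>y. K * norm (g y - g x) + M * norm (h y - h x)) \<longlongrightarrow> K * norm (g x - g x) + M * norm (h x - h x)) (at x within S)"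
    using g h x by (intro tendsto_intros) (auto simp: continuous_on_def)
  then have "((\<lambda>y. K * norm (g y - g x) + M * norm (h y - h x)) \<longlongrightarrow> 0) (at x within S)" by simp
  then have "((\<lambda>y. f y - f x) \<longlongrightarrow> 0) (at x within S)"
    by (rule Lim_null_comparison[rotated]) (use le x in \<open>auto simp: eventually_at_filter\<close>)
  then show "(f \<longlongrightarrow> f x) (at x within S)" by (simp add: LIM_zero_iff)
qed

text \<open>The type of network functions is not complete, so the fundamental theorem of calculus is only
  available for the coordinates with respect to an orthogonal basis.\<close>

context
  fixes X :: "'a::real_inner set" and T :: real and f f' :: "real \<Rightarrow> 'a"
  assumes X: "finite_dim_subspace X" and f: "H1_time T X f f'"
begin

lemma inner_H1_time:
  assumes "t \<in> {0..T}"
  shows "inner (f t) x = inner (f 0) x + integral {0..t} (\<lambda>s. inner (f' s) x)"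
    and "(\<lambda>s. inner (f' s) x) integrable_on {0..t}"
proof -
  have "(f' has_integral (f t - f 0)) {0..t}" using f assms by (auto simp: H1_time_def)
  from has_integral_linear[OF this bounded_linear_inner_left[of x]]
  have "((\<lambda>s. inner (f' s) x) has_integral (inner (f t - f 0) x)) {0..t}" by (simp add: comp_def)
  then show "inner (f t) x = inner (f 0) x + integral {0..t} (\<lambda>s. inner (f' s) x)"
    and "(\<lambda>s. inner (f' s) x) integrable_on {0..t}"
    by (auto simp: integral_unique inner_diff_left has_integral_integrable)
qed

lemma expansion_H1_time:
  obtains C where "\<And>t. t \<in> {0..T} \<Longrightarrow> f t = (\<Sum>b\<in>C. (inner (f t) b / inner b b) *\<^sub>R b)"
    "\<And>t. t \<in> {0..T} \<Longrightarrow> f' t = (\<Sum>b\<in>C. (inner (f' t) b / inner b b) *\<^sub>R b)"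
proof -
  obtain B where B: "finite B" "X = span B" using X by (auto simp: finite_dim_subspace_def)
  obtain C where C: "\<And>x. x \<in> span B \<Longrightarrow> (\<Sum>b\<in>C. (inner x b / inner b b) *\<^sub>R b) = x"
    by (rule orthogonal_expansion[OF B(1)]) blast
  show thesis by (rule that[of C]) (use f B C in \<open>auto simp: H1_time_def\<close>)
qed

lemma continuous_on_H1_time: "continuous_on {0..T} f"
proof (cases "0 \<le> T")
  case True
  obtain C where C: "\<And>t. t \<in> {0..T} \<Longrightarrow> f t = (\<Sum>b\<in>C. (inner (f t) b / inner b b) *\<^sub>R b)"
    by (rule expansion_H1_time) blast
  have c: "continuous_on {0..T} (\<lambda>t. inner (f t) x)" for x
  proof -
    have "continuous_on {0..T} (\<lambda>t. inner (f 0) x + integral {0..t} (\<lambda>s. inner (f' s) x))"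
      using inner_H1_time(2)[of T x] True by (intro continuous_intros indefinite_integral_continuous_1) auto
    then show ?thesis by (rule continuous_on_eq) (rule inner_H1_time(1)[symmetric])
  qed
  have "continuous_on {0..T} (\<lambda>t. \<Sum>b\<in>C. (inner (f t) b / inner b b) *\<^sub>R b)"
    unfolding divide_inverse by (intro continuous_intros c)
  then show ?thesis by (rule continuous_on_eq) (rule C[symmetric])
qed auto

lemma has_vector_derivative_H1_time:
  assumes c: "continuous_on {0..T} f'" and t: "t \<in> {0..T}"
  shows "(f has_vector_derivative f' t) (at t within {0..T})"
proof -
  obtain C where C: "\<And>t. t \<in> {0..T} \<Longrightarrow> f t = (\<Sum>b\<in>C. (inner (f t) b / inner b b) *\<^sub>R b)"
    "\<And>t. t \<in> {0..T} \<Longrightarrow> f' t = (\<Sum>b\<in>C. (inner (f' t) b / inner b b) *\<^sub>R b)"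
    by (rule expansion_H1_time) blast
  have d: "((\<lambda>t. inner (f t) x) has_vector_derivative inner (f' t) x) (at t within {0..T})" for x
  proof (rule has_vector_derivative_transform[OF t inner_H1_time(1)])
    have "((\<lambda>u. integral {0..u} (\<lambda>s. inner (f' s) x)) has_vector_derivative inner (f' t) x) (at t within {0..T})"
      by (rule integral_has_vector_derivative[OF _ t]) (intro continuous_intros c)
    from has_vector_derivative_add[OF has_vector_derivative_const[of "inner (f 0) x"] this]
    show "((\<lambda>u. inner (f 0) x + integral {0..u} (\<lambda>s. inner (f' s) x)) has_vector_derivative inner (f' t) x) (at t within {0..T})"
      by simp
  qed
  have "((\<lambda>t. \<Sum>b\<in>C. (inner (f t) b / inner b b) *\<^sub>R b) has_vector_derivative
      (\<Sum>b\<in>C. (inner (f' t) b / inner b b) *\<^sub>R b)) (at t within {0..T})"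
    by (intro has_vector_derivative_sum bounded_linear.has_vector_derivative[OF bounded_linear_scaleR_left]
        bounded_linear.has_vector_derivative[OF bounded_linear_divide] d)
  from has_vector_derivative_transform[OF t C(1) this] show ?thesis unfolding C(2)[OF t, symmetric] .
qed

end

text \<open>The steps \<open>1 / (n + 1)\<close> are positive, so all sample points stay in the half
  line and the one-sided derivative at 0 is covered.\<close>

lemma difference_quotient_tendsto:
  assumes "(f has_vector_derivative f') (at t within {0..})" and t: "0 \<le> t"
  shows "(\<lambda>n. (real n + 1) *\<^sub>R (f (t + 1 / (real n + 1)) - f t)) \<longlonglongrightarrow> f'"
proof -
  have D: "((\<lambda>y. (f y - (f t + (y - t) *\<^sub>R f')) /\<^sub>R \<bar>y - t\<bar>) \<longlongrightarrow> 0) (at t within {0..})"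
    using assms unfolding has_vector_derivative_def has_derivative_within by (simp add: divide_inverse_commute)
  have l0: "(\<lambda>n. 1 / (real n + 1)) \<longlonglongrightarrow> 0"
    using LIMSEQ_inverse_real_of_nat by (simp add: inverse_eq_divide add.commute)
  have "filterlim (\<lambda>n. t + 1 / (real n + 1)) (at t within {0..}) sequentially"
    unfolding filterlim_at
  proof
    show "(\<lambda>n. t + 1 / (real n + 1)) \<longlonglongrightarrow> t" using tendsto_add[OF tendsto_const[of t] l0] by simp
    have "0 < 1 / (real n + 1)" for n by simp
    then show "\<forall>\<^sub>F n in sequentially. t + 1 / (real n + 1) \<in> {0..} \<and> t + 1 / (real n + 1) \<noteq> t"
      using t by (auto intro!: always_eventually add_nonneg_nonneg)
  qed
  from filterlim_compose[OF D this]
  have "(\<lambda>n. (f (t + 1 / (real n + 1)) - (f t + (1 / (real n + 1)) *\<^sub>R f')) /\<^sub>R (1 / (real n + 1))) \<longlonglongrightarrow> 0"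
    by simp
  moreover have "(f (t + 1 / (real n + 1)) - (f t + (1 / (real n + 1)) *\<^sub>R f')) /\<^sub>R (1 / (real n + 1))
      = (real n + 1) *\<^sub>R (f (t + 1 / (real n + 1)) - f t) - f'" for n
  proof -
    have "(real n + 1) * (1 / (real n + 1)) = 1" by simp
    then show ?thesis by (simp add: scaleR_diff_right scaleR_add_right inverse_eq_divide del: of_nat_Suc)
  qed
  ultimately show ?thesis by (simp add: LIM_zero_iff)
qed

lemma has_vector_derivative_shift:
  assumes "(f has_vector_derivative f') (at (t + h) within {0..})" "0 \<le> s" "0 \<le> h"
  shows "((\<lambda>\<tau>. f (\<tau> + h)) has_vector_derivative f') (at t within {s..r})"
proof -
  have "((\<lambda>\<tau>. \<tau> + h) has_vector_derivative 1) (at t within {s..r})"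
    by (auto intro!: derivative_eq_intros)
  moreover have "(f has_vector_derivative f') (at (t + h) within (\<lambda>\<tau>. \<tau> + h) ` {s..r})"
    by (rule has_vector_derivative_within_subset[OF assms(1)]) (use assms in auto)
  ultimately show ?thesis using vector_diff_chain_within[of "\<lambda>\<tau>. \<tau> + h" 1 t "{s..r}" f f'] by (simp add: comp_def)
qed

lemma evolution_has_vector_derivative:
  assumes "evolution_solution V E l a b c f g u p" "0 \<le> t"
  shows "(u has_vector_derivative vector_derivative u (at t within {0..})) (at t within {0..})"
    and "(p has_vector_derivative vector_derivative p (at t within {0..})) (at t within {0..})"
proof -
  have "u differentiable (at t within {0..})" "p differentiable (at t within {0..})"
    using assms unfolding evolution_solution_def C1_within_def
    by (meson atLeast_iff differentiableI_vector)+
  then show "(u has_vector_derivative vector_derivative u (at t within {0..})) (at t within {0..})"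
    "(p has_vector_derivative vector_derivative p (at t within {0..})) (at t within {0..})"
    by (simp_all add: vector_derivative_works)
qed

context damped_network
begin

text \<open>A weak derivative is a priori only square integrable, but here the equations hold at
  every time. Subtracting them at two times, testing with the increment \<delta> of the derivative
  and using coercivity bounds \<delta> by increments of \<open>uh\<close> and \<open>ph\<close>,
  since \<open>dx\<close> is bounded on the finite dimensional \<open>Vh\<close>.\<close>

lemma semidiscrete_regularity:
  assumes fd: "finite_dim_subspace Vh" "Vh \<subseteq> Hdiv V E l" "finite_dim_subspace Qh" "Qh \<subseteq> L2 E l"
    and H: "H1_time T Vh uh uh'" "H1_time T Qh ph ph'"
    and eq: "\<And>t v. t \<in> {0..T} \<Longrightarrow> v \<in> Vh \<Longrightarrow>
        inner (c \<odot> uh' t) v - inner (ph t) (dx E l v) + inner (a \<odot> uh t) v = inner f v"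
      "\<And>t q. t \<in> {0..T} \<Longrightarrow> q \<in> Qh \<Longrightarrow> inner (b \<odot> ph' t) q + inner (dx E l (uh t)) q = inner g q"
  shows "continuous_on {0..T} uh'" "continuous_on {0..T} ph'"
proof -
  obtain B where B: "finite B" "Vh = span B" using fd(1) by (auto simp: finite_dim_subspace_def)
  obtain B' where B': "finite B'" "Qh = span B'" using fd(3) by (auto simp: finite_dim_subspace_def)
  have VH: "v \<in> Vh \<Longrightarrow> v \<in> H1 E l" for v using fd(2) Hdiv_H1 by blast
  obtain K where K0: "0 \<le> K" and K: "\<And>x. x \<in> span B \<Longrightarrow> norm (dx E l x) \<le> K * norm x"
    by (rule linear_bound_on_span[OF B(1), where f = "dx E l"])
      (use VH in \<open>auto simp: B(2) intro: dx_add dx_scaleR\<close>)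
  have memV: "uh t \<in> Vh" "uh' t \<in> Vh" and memQ: "ph t \<in> Qh" "ph' t \<in> Qh" if "t \<in> {0..T}" for t
    using H that by (auto simp: H1_time_def)
  have sV: "x - y \<in> Vh" if "x \<in> Vh" "y \<in> Vh" for x y using that unfolding B(2) by (rule span_diff)
  have sQ: "x - y \<in> Qh" if "x \<in> Qh" "y \<in> Qh" for x y using that unfolding B'(2) by (rule span_diff)
  interpret ma: bounded_linear "(\<odot>) a" by (rule mult_linear)
  interpret mb: bounded_linear "(\<odot>) b" by (rule mult_linear)
  interpret mc: bounded_linear "(\<odot>) c" by (rule mult_linear)
  note cont = continuous_on_H1_time[OF fd(1) H(1)] continuous_on_H1_time[OF fd(3) H(2)]
  have cancel: "x \<le> M / C0" if "C0 * x\<^sup>2 \<le> M * x" "0 \<le> x" "0 \<le> M" for x M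
  proof (cases "x = 0")
    case False
    then have "C0 * x \<le> M" using that by (simp add: power2_eq_square mult.assoc[symmetric])
    then show ?thesis using pos by (simp add: field_simps)
  qed (use that pos in simp)
  show "continuous_on {0..T} uh'"
  proof (rule continuous_on_dominated[OF cont(2,1), where K = "K / C0" and M = "C1 / C0"])
    fix t r assume t: "t \<in> {0..T}" and r: "r \<in> {0..T}"
    define \<delta> where "\<delta> = uh' t - uh' r"
    have \<delta>: "\<delta> \<in> Vh" using memV t r sV by (auto simp: \<delta>_def)
    have "C0 * (norm \<delta>)\<^sup>2 \<le> inner (c \<odot> \<delta>) \<delta>" using \<delta> VH H1_L2 by (intro mult_coercive) auto
    also have "\<dots> = inner (ph t - ph r) (dx E l \<delta>) - inner (a \<odot> (uh t - uh r)) \<delta>"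
      using eq(1)[OF t \<delta>] eq(1)[OF r \<delta>] unfolding \<delta>_def[symmetric]
      by (simp add: mc.diff[of "uh' t" "uh' r", folded \<delta>_def] ma.diff inner_diff_left)
    also have "\<dots> \<le> norm (ph t - ph r) * (K * norm \<delta>) + C1 * norm (uh t - uh r) * norm \<delta>"
    proof -
      have "inner (ph t - ph r) (dx E l \<delta>) \<le> norm (ph t - ph r) * norm (dx E l \<delta>)" by (rule norm_cauchy_schwarz)
      also have "\<dots> \<le> norm (ph t - ph r) * (K * norm \<delta>)" using K \<delta> B(2) by (intro mult_left_mono) auto
      finally have 1: "inner (ph t - ph r) (dx E l \<delta>) \<le> norm (ph t - ph r) * (K * norm \<delta>)" .
      have "\<bar>inner (a \<odot> (uh t - uh r)) \<delta>\<bar> \<le> norm (a \<odot> (uh t - uh r)) * norm \<delta>" by (rule Cauchy_Schwarz_ineq2)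
      also have "\<dots> \<le> C1 * norm (uh t - uh r) * norm \<delta>" by (intro mult_right_mono mult_norm) auto
      finally show ?thesis using 1 by simp
    qed
    finally have main: "C0 * (norm \<delta>)\<^sup>2 \<le> (K * norm (ph t - ph r) + C1 * norm (uh t - uh r)) * norm \<delta>"
      by (simp add: algebra_simps)
    show "norm (uh' t - uh' r) \<le> K / C0 * norm (ph t - ph r) + C1 / C0 * norm (uh t - uh r)"
      using cancel[OF main] K0 pos by (simp add: \<delta>_def add_divide_distrib)
  qed
  show "continuous_on {0..T} ph'"
  proof (rule continuous_on_dominated[OF cont(1,1), where K = "K / C0" and M = 0])
    fix t r assume t: "t \<in> {0..T}" and r: "r \<in> {0..T}"
    define \<delta> where "\<delta> = ph' t - ph' r"
    have \<delta>: "\<delta> \<in> Qh" using memQ t r sQ by (auto simp: \<delta>_def)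
    have u: "uh t - uh r \<in> Vh" using memV t r sV by auto
    have "C0 * (norm \<delta>)\<^sup>2 \<le> inner (b \<odot> \<delta>) \<delta>" using \<delta> fd(4) by (intro mult_coercive) auto
    also have "\<dots> = - inner (dx E l (uh t - uh r)) \<delta>"
      using eq(2)[OF t \<delta>] eq(2)[OF r \<delta>] memV[OF t] memV[OF r]
      by (simp add: mb.diff[of "ph' t" "ph' r", folded \<delta>_def] dx_diff VH inner_diff_left)
    also have "\<dots> \<le> norm (dx E l (uh t - uh r)) * norm \<delta>"
      using Cauchy_Schwarz_ineq2[of "dx E l (uh t - uh r)" \<delta>] by linarith
    also have "\<dots> \<le> K * norm (uh t - uh r) * norm \<delta>" using K u B(2) by (intro mult_right_mono) auto
    finally have main: "C0 * (norm \<delta>)\<^sup>2 \<le> K * norm (uh t - uh r) * norm \<delta>" .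
    show "norm (ph' t - ph' r) \<le> K / C0 * norm (uh t - uh r) + 0 * norm (uh t - uh r)"
      using cancel[OF main] K0 by (simp add: \<delta>_def)
  qed
qed

text \<open>By linearity the difference of two solutions with the same data is homogeneous. The
  second pair \<open>(v, r)\<close> has to solve the equations on \<open>[s,t]\<close> only, which
  covers both a stationary state and a time shift of \<open>(u, p)\<close>.\<close>

lemma evolution_difference_decay:
  assumes decay: "\<And>w w' q q' s t. \<lbrakk>s \<le> t;
      \<And>\<tau>. \<tau> \<in> {s..t} \<Longrightarrow> (w has_vector_derivative w' \<tau>) (at \<tau> within {s..t});
      \<And>\<tau>. \<tau> \<in> {s..t} \<Longrightarrow> (q has_vector_derivative q' \<tau>) (at \<tau> within {s..t});
      \<And>\<tau>. \<tau> \<in> {s..t} \<Longrightarrow> w \<tau> \<in> Hdiv V E l; \<And>\<tau>. \<tau> \<in> {s..t} \<Longrightarrow> q \<tau> \<in> H10 V E l;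
      \<And>\<tau>. \<tau> \<in> {s<..<t} \<Longrightarrow> c \<odot> w' \<tau> + dx E l (q \<tau>) + a \<odot> w \<tau> = 0;
      \<And>\<tau>. \<tau> \<in> {s<..<t} \<Longrightarrow> b \<odot> q' \<tau> + dx E l (w \<tau>) = 0\<rbrakk>
      \<Longrightarrow> (norm (w t))\<^sup>2 + (norm (q t))\<^sup>2 \<le> C * exp (- \<gamma> * (t - s)) * ((norm (w s))\<^sup>2 + (norm (q s))\<^sup>2)"
    and evol: "evolution_solution V E l a b c f g u p"
    and st: "0 \<le> s" "s \<le> t"
    and der: "\<And>\<tau>. \<tau> \<in> {s..t} \<Longrightarrow> (v has_vector_derivative v' \<tau>) (at \<tau> within {s..t})"
      "\<And>\<tau>. \<tau> \<in> {s..t} \<Longrightarrow> (r has_vector_derivative r' \<tau>) (at \<tau> within {s..t})"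
    and mem: "\<And>\<tau>. \<tau> \<in> {s..t} \<Longrightarrow> v \<tau> \<in> Hdiv V E l" "\<And>\<tau>. \<tau> \<in> {s..t} \<Longrightarrow> r \<tau> \<in> H10 V E l"
    and eq: "\<And>\<tau>. \<tau> \<in> {s<..<t} \<Longrightarrow> c \<odot> v' \<tau> + dx E l (r \<tau>) + a \<odot> v \<tau> = f"
      "\<And>\<tau>. \<tau> \<in> {s<..<t} \<Longrightarrow> b \<odot> r' \<tau> + dx E l (v \<tau>) = g"
  shows "(norm (v t - u t))\<^sup>2 + (norm (r t - p t))\<^sup>2
    \<le> C * exp (- \<gamma> * (t - s)) * ((norm (v s - u s))\<^sup>2 + (norm (r s - p s))\<^sup>2)"
proof -
  interpret ma: bounded_linear "(\<odot>) a" by (rule mult_linear)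
  interpret mb: bounded_linear "(\<odot>) b" by (rule mult_linear)
  interpret mc: bounded_linear "(\<odot>) c" by (rule mult_linear)
  define u' where "u' \<tau> = vector_derivative u (at \<tau> within {0..})" for \<tau>
  define p' where "p' \<tau> = vector_derivative p (at \<tau> within {0..})" for \<tau>
  have d: "(u has_vector_derivative u' \<tau>) (at \<tau> within {0..})" "(p has_vector_derivative p' \<tau>) (at \<tau> within {0..})" if "0 \<le> \<tau>" for \<tau>
    unfolding u'_def p'_def using evolution_has_vector_derivative[OF evol that] by auto
  have m: "u \<tau> \<in> Hdiv V E l" "p \<tau> \<in> H10 V E l" if "\<tau> \<in> {s..t}" for \<tau>
    using evol that st by (auto simp: evolution_solution_def)
  have e: "c \<odot> u' \<tau> + dx E l (p \<tau>) + a \<odot> u \<tau> = f" "b \<odot> p' \<tau> + dx E l (u \<tau>) = g" if "\<tau> \<in> {s<..<t}" for \<tau>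
    using evol that st by (auto simp: evolution_solution_def u'_def p'_def)
  show ?thesis
  proof (rule decay[OF st(2), where w = "\<lambda>\<tau>. v \<tau> - u \<tau>" and w' = "\<lambda>\<tau>. v' \<tau> - u' \<tau>"
        and q = "\<lambda>\<tau>. r \<tau> - p \<tau>" and q' = "\<lambda>\<tau>. r' \<tau> - p' \<tau>"])
    fix \<tau> assume \<tau>: "\<tau> \<in> {s..t}"
    then have "0 \<le> \<tau>" "{s..t} \<subseteq> {0..}" using st by auto
    then show "((\<lambda>\<tau>. v \<tau> - u \<tau>) has_vector_derivative v' \<tau> - u' \<tau>) (at \<tau> within {s..t})"
      "((\<lambda>\<tau>. r \<tau> - p \<tau>) has_vector_derivative r' \<tau> - p' \<tau>) (at \<tau> within {s..t})"
      using der[OF \<tau>] d[of \<tau>]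
      by (auto intro!: has_vector_derivative_diff intro: has_vector_derivative_within_subset)
    show "v \<tau> - u \<tau> \<in> Hdiv V E l" "r \<tau> - p \<tau> \<in> H10 V E l"
      using mem[OF \<tau>] m[OF \<tau>] by (auto intro: Hdiv_diff H10_diff)
  next
    fix \<tau> assume \<tau>: "\<tau> \<in> {s<..<t}"
    then have \<tau>': "\<tau> \<in> {s..t}" by auto
    note H = Hdiv_H1[OF mem(1)[OF \<tau>']] H10_H1[OF mem(2)[OF \<tau>']] Hdiv_H1[OF m(1)[OF \<tau>']] H10_H1[OF m(2)[OF \<tau>']]
    have "c \<odot> (v' \<tau> - u' \<tau>) + dx E l (r \<tau> - p \<tau>) + a \<odot> (v \<tau> - u \<tau>)
      = (c \<odot> v' \<tau> + dx E l (r \<tau>) + a \<odot> v \<tau>) - (c \<odot> u' \<tau> + dx E l (p \<tau>) + a \<odot> u \<tau>)"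
      using H by (simp add: mc.diff ma.diff dx_diff)
    then show "c \<odot> (v' \<tau> - u' \<tau>) + dx E l (r \<tau> - p \<tau>) + a \<odot> (v \<tau> - u \<tau>) = 0"
      by (simp only: eq(1)[OF \<tau>] e(1)[OF \<tau>] diff_self)
    have "b \<odot> (r' \<tau> - p' \<tau>) + dx E l (v \<tau> - u \<tau>)
      = (b \<odot> r' \<tau> + dx E l (v \<tau>)) - (b \<odot> p' \<tau> + dx E l (u \<tau>))"
      using H by (simp add: mb.diff dx_diff)
    then show "b \<odot> (r' \<tau> - p' \<tau>) + dx E l (v \<tau> - u \<tau>) = 0"
      by (simp only: eq(2)[OF \<tau>] e(2)[OF \<tau>] diff_self)
  qed
qed

end

section \<open>Stationary states, time shifts and the discrete problem as applications of
  homogeneous decay\<close>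

theorem theorem7p4:
  fixes V :: "'v::finite set" and E :: "('v \<times> 'v) set" and l :: "'v \<times> 'v \<Rightarrow> real"
    and a b c :: "'v net_fun" and C0 C1 :: real
  assumes "network V E l" and "boundary_vertices V E \<noteq> {}"
    and "a \<in> L2 E l" and "b \<in> L2 E l" and "c \<in> L2 E l"
    and "0 < C0" and "0 < C1"
    and "ae_between E l C0 C1 a" and "ae_between E l C0 C1 b" and "ae_between E l C0 C1 c"
  shows "\<exists>C>0. \<exists>\<gamma>>0.
    (\<forall>f\<in>L2 E l. \<forall>g\<in>L2 E l. \<forall>u p. evolution_solution V E l a b c f g u p \<longrightarrow>
       (\<forall>us ps. stationary_solution V E l a f g us ps \<longrightarrow>
          (\<forall>s t. 0 \<le> s \<and> s \<le> t \<longrightarrow>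
             (norm (u t - us))\<^sup>2 + (norm (p t - ps))\<^sup>2
               \<le> C * exp (- \<gamma> * (t - s)) * ((norm (u s - us))\<^sup>2 + (norm (p s - ps))\<^sup>2))) \<and>
       (\<forall>s t. 0 \<le> s \<and> s \<le> t \<longrightarrow>
          (norm (vector_derivative u (at t within {0..})))\<^sup>2
            + (norm (vector_derivative p (at t within {0..})))\<^sup>2
            \<le> C * exp (- \<gamma> * (t - s)) *
               ((norm (vector_derivative u (at s within {0..})))\<^sup>2
                 + (norm (vector_derivative p (at s within {0..})))\<^sup>2))) \<and>
    (\<forall>Vh Qh. finite_dim_subspace Vh \<and> Vh \<subseteq> Hdiv V E l \<and>
         finite_dim_subspace Qh \<and> Qh \<subseteq> L2 E l \<and>
         dx E l ` Vh = Qh \<and> H0div V E l \<subseteq> Vh \<longrightarrow>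
       (\<forall>f\<in>L2 E l. \<forall>g\<in>L2 E l. \<forall>u0\<in>Hdiv V E l. \<forall>p0\<in>L2 E l. \<forall>T>0. \<forall>us ps uh ph.
          discrete_stationary_solution E l a Vh Qh f g us ps \<and>
          semidiscrete_solution E l a b c Vh Qh T f g u0 p0 uh ph \<longrightarrow>
          (\<forall>s t. 0 \<le> s \<and> s \<le> t \<and> t \<le> T \<longrightarrow>
             (norm (uh t - us))\<^sup>2 + (norm (ph t - ps))\<^sup>2
               \<le> C * exp (- \<gamma> * (t - s)) * ((norm (uh s - us))\<^sup>2 + (norm (ph s - ps))\<^sup>2))))"
proof -
  interpret damped_network V E l a b c C0 C1
    by unfold_locales (use assms in auto)
  interpret ma: bounded_linear "(\<odot>) a" by (rule mult_linear)
  interpret mb: bounded_linear "(\<odot>) b" by (rule mult_linear)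
  interpret mc: bounded_linear "(\<odot>) c" by (rule mult_linear)
  show ?thesis
  proof (rule homogeneous_decay)
    fix C \<gamma> :: real
    assume C: "0 < C" "0 < \<gamma>"
      and decay: "\<And>w w' q q' s t. \<lbrakk>s \<le> t;
      \<And>\<tau>. \<tau> \<in> {s..t} \<Longrightarrow> (w has_vector_derivative w' \<tau>) (at \<tau> within {s..t});
      \<And>\<tau>. \<tau> \<in> {s..t} \<Longrightarrow> (q has_vector_derivative q' \<tau>) (at \<tau> within {s..t});
      \<And>\<tau>. \<tau> \<in> {s..t} \<Longrightarrow> w \<tau> \<in> Hdiv V E l; \<And>\<tau>. \<tau> \<in> {s..t} \<Longrightarrow> q \<tau> \<in> H10 V E l;
      \<And>\<tau>. \<tau> \<in> {s<..<t} \<Longrightarrow> c \<odot> w' \<tau> + dx E l (q \<tau>) + a \<odot> w \<tau> = 0;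
      \<And>\<tau>. \<tau> \<in> {s<..<t} \<Longrightarrow> b \<odot> q' \<tau> + dx E l (w \<tau>) = 0\<rbrakk>
      \<Longrightarrow> (norm (w t))\<^sup>2 + (norm (q t))\<^sup>2 \<le> C * exp (- \<gamma> * (t - s)) * ((norm (w s))\<^sup>2 + (norm (q s))\<^sup>2)"
      and decay_h: "\<And>Vh Qh w w' q q' s t. \<lbrakk>s \<le> t; finite_dim_subspace Vh; Vh \<subseteq> Hdiv V E l;
      finite_dim_subspace Qh; Qh \<subseteq> L2 E l; dx E l ` Vh = Qh; H0div V E l \<subseteq> Vh;
      \<And>\<tau>. \<tau> \<in> {s..t} \<Longrightarrow> (w has_vector_derivative w' \<tau>) (at \<tau> within {s..t});
      \<And>\<tau>. \<tau> \<in> {s..t} \<Longrightarrow> (q has_vector_derivative q' \<tau>) (at \<tau> within {s..t});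
      \<And>\<tau>. \<tau> \<in> {s..t} \<Longrightarrow> w \<tau> \<in> Vh; \<And>\<tau>. \<tau> \<in> {s..t} \<Longrightarrow> q \<tau> \<in> Qh;
      \<And>\<tau> v. \<tau> \<in> {s..t} \<Longrightarrow> v \<in> Vh \<Longrightarrow>
        inner (c \<odot> w' \<tau>) v - inner (q \<tau>) (dx E l v) + inner (a \<odot> w \<tau>) v = 0;
      \<And>\<tau> r. \<tau> \<in> {s..t} \<Longrightarrow> r \<in> Qh \<Longrightarrow> inner (b \<odot> q' \<tau>) r + inner (dx E l (w \<tau>)) r = 0\<rbrakk>
      \<Longrightarrow> (norm (w t))\<^sup>2 + (norm (q t))\<^sup>2 \<le> C * exp (- \<gamma> * (t - s)) * ((norm (w s))\<^sup>2 + (norm (q s))\<^sup>2)"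
    show ?thesis
    proof (rule exI[of _ C], rule conjI[OF C(1)], rule exI[of _ \<gamma>], rule conjI[OF C(2)], intro conjI allI impI ballI)
      fix f g u p us ps and s t :: real
      assume evol: "evolution_solution V E l a b c f g u p" and stat: "stationary_solution V E l a f g us ps"
        and st: "0 \<le> s \<and> s \<le> t"
      \<comment> \<open>The stationary pair is a solution constant in time: its time derivatives are
        0, which the coefficient operators map to 0.\<close>
      have "(norm (us - u t))\<^sup>2 + (norm (ps - p t))\<^sup>2
        \<le> C * exp (- \<gamma> * (t - s)) * ((norm (us - u s))\<^sup>2 + (norm (ps - p s))\<^sup>2)"
        by (rule evolution_difference_decay[OF _ evol, where v = "\<lambda>_. us" and r = "\<lambda>_. ps" and v' = "\<lambda>_. 0" and r' = "\<lambda>_. 0"], fact decay)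
          (use st stat in \<open>auto simp: stationary_solution_def mc.zero mb.zero intro: has_vector_derivative_const\<close>)
      then show "(norm (u t - us))\<^sup>2 + (norm (p t - ps))\<^sup>2
        \<le> C * exp (- \<gamma> * (t - s)) * ((norm (u s - us))\<^sup>2 + (norm (p s - ps))\<^sup>2)"
        by (simp add: norm_minus_commute)
    next
      fix f g u p and s t :: real
      assume evol: "evolution_solution V E l a b c f g u p" and st: "0 \<le> s \<and> s \<le> t"
      define u' where "u' \<tau> = vector_derivative u (at \<tau> within {0..})" for \<tau>
      define p' where "p' \<tau> = vector_derivative p (at \<tau> within {0..})" for \<tau>
      have d: "(u has_vector_derivative u' \<tau>) (at \<tau> within {0..})" "(p has_vector_derivative p' \<tau>) (at \<tau> within {0..})" if "0 \<le> \<tau>" for \<tau>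
        unfolding u'_def p'_def using evolution_has_vector_derivative[OF evol that] by auto
      \<comment> \<open>The squared size of the difference quotients. The decay estimate is proved
        for each \<open>n\<close> with constants independent of \<open>n\<close> and passes to the
        limit.\<close>
      define D where "D n \<tau> = (norm ((real n + 1) *\<^sub>R (u (\<tau> + 1 / (real n + 1)) - u \<tau>)))\<^sup>2
        + (norm ((real n + 1) *\<^sub>R (p (\<tau> + 1 / (real n + 1)) - p \<tau>)))\<^sup>2" for n \<tau>
      have lim: "(\<lambda>n. D n \<tau>) \<longlonglongrightarrow> (norm (u' \<tau>))\<^sup>2 + (norm (p' \<tau>))\<^sup>2" if "0 \<le> \<tau>" for \<tau>
        unfolding D_def using d[OF that] that by (intro tendsto_intros difference_quotient_tendsto)
      have "D n t \<le> C * exp (- \<gamma> * (t - s)) * D n s" for n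
      proof -
        define h where "h = 1 / (real n + 1)"
        have h: "0 \<le> h" by (simp add: h_def)
        \<comment> \<open>The data \<open>f\<close> and \<open>g\<close> do not depend on time, so
          the shifted pair solves the same equations.\<close>
        have "(norm (u (t + h) - u t))\<^sup>2 + (norm (p (t + h) - p t))\<^sup>2
          \<le> C * exp (- \<gamma> * (t - s)) * ((norm (u (s + h) - u s))\<^sup>2 + (norm (p (s + h) - p s))\<^sup>2)"
        proof (rule evolution_difference_decay[OF _ evol, where v = "\<lambda>\<tau>. u (\<tau> + h)" and r = "\<lambda>\<tau>. p (\<tau> + h)"
              and v' = "\<lambda>\<tau>. u' (\<tau> + h)" and r' = "\<lambda>\<tau>. p' (\<tau> + h)"], fact decay)
          fix \<tau> assume \<tau>: "\<tau> \<in> {s..t}"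
          show "((\<lambda>\<tau>. u (\<tau> + h)) has_vector_derivative u' (\<tau> + h)) (at \<tau> within {s..t})"
            "((\<lambda>\<tau>. p (\<tau> + h)) has_vector_derivative p' (\<tau> + h)) (at \<tau> within {s..t})"
            using \<tau> st h by (auto intro!: has_vector_derivative_shift d)
          show "u (\<tau> + h) \<in> Hdiv V E l" "p (\<tau> + h) \<in> H10 V E l"
            using evol \<tau> st h by (auto simp: evolution_solution_def)
        next
          fix \<tau> assume "\<tau> \<in> {s<..<t}"
          then have "0 < \<tau> + h" using st h by auto
          then show "c \<odot> u' (\<tau> + h) + dx E l (p (\<tau> + h)) + a \<odot> u (\<tau> + h) = f" "b \<odot> p' (\<tau> + h) + dx E l (u (\<tau> + h)) = g"
            using evol by (auto simp: evolution_solution_def u'_def p'_def)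
        qed (use st in auto)
        from mult_left_mono[OF this, of "(real n + 1)\<^sup>2"]
        have "(real n + 1)\<^sup>2 * ((norm (u (t + h) - u t))\<^sup>2 + (norm (p (t + h) - p t))\<^sup>2)
          \<le> C * exp (- \<gamma> * (t - s)) * ((real n + 1)\<^sup>2 * ((norm (u (s + h) - u s))\<^sup>2 + (norm (p (s + h) - p s))\<^sup>2))"
          by (simp add: mult.left_commute)
        moreover have "D n \<tau> = (real n + 1)\<^sup>2 * ((norm (u (\<tau> + h) - u \<tau>))\<^sup>2 + (norm (p (\<tau> + h) - p \<tau>))\<^sup>2)" for \<tau>
          by (simp only: D_def h_def[symmetric] norm_scaleR power_mult_distrib power2_abs distrib_left)
        ultimately show ?thesis by simp
      qed
      then have "(norm (u' t))\<^sup>2 + (norm (p' t))\<^sup>2 \<le> C * exp (- \<gamma> * (t - s)) * ((norm (u' s))\<^sup>2 + (norm (p' s))\<^sup>2)"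
        using st by (intro LIMSEQ_le[OF lim tendsto_mult_left[OF lim]]) auto
      then show "(norm (vector_derivative u (at t within {0..})))\<^sup>2 + (norm (vector_derivative p (at t within {0..})))\<^sup>2
        \<le> C * exp (- \<gamma> * (t - s)) * ((norm (vector_derivative u (at s within {0..})))\<^sup>2
          + (norm (vector_derivative p (at s within {0..})))\<^sup>2)"
        by (simp add: u'_def p'_def)
    next
      fix Vh Qh f g u0 p0 and T :: real and us ps uh ph and s t :: real
      assume fd: "finite_dim_subspace Vh \<and> Vh \<subseteq> Hdiv V E l \<and> finite_dim_subspace Qh \<and> Qh \<subseteq> L2 E l \<and>
         dx E l ` Vh = Qh \<and> H0div V E l \<subseteq> Vh"
        and sol: "discrete_stationary_solution E l a Vh Qh f g us ps \<and>
          semidiscrete_solution E l a b c Vh Qh T f g u0 p0 uh ph"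
        and st: "0 \<le> s \<and> s \<le> t \<and> t \<le> T"
      from sol obtain uh' ph' where H: "H1_time T Vh uh uh'" "H1_time T Qh ph ph'"
        and eq: "\<And>t v. t \<in> {0..T} \<Longrightarrow> v \<in> Vh \<Longrightarrow>
            inner (c \<odot> uh' t) v - inner (ph t) (dx E l v) + inner (a \<odot> uh t) v = inner f v"
          "\<And>t q. t \<in> {0..T} \<Longrightarrow> q \<in> Qh \<Longrightarrow> inner (b \<odot> ph' t) q + inner (dx E l (uh t)) q = inner g q"
        unfolding semidiscrete_solution_def by blast
      from sol have ss: "us \<in> Vh" "ps \<in> Qh"
        "\<And>v. v \<in> Vh \<Longrightarrow> inner (a \<odot> us) v - inner ps (dx E l v) = inner f v"
        "\<And>q. q \<in> Qh \<Longrightarrow> inner (dx E l us) q = inner g q"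
        unfolding discrete_stationary_solution_def by auto
      obtain B B' where B: "Vh = span B" "Qh = span B'" using fd unfolding finite_dim_subspace_def by blast
      have VH: "v \<in> Vh \<Longrightarrow> v \<in> H1 E l" for v using fd Hdiv_H1 by blast
      have sub: "{s..t} \<subseteq> {0..T}" using st by auto
      have mem: "uh \<tau> \<in> Vh" "ph \<tau> \<in> Qh" if "\<tau> \<in> {s..t}" for \<tau>
        using H that sub by (auto simp: H1_time_def)
      have reg: "continuous_on {0..T} uh'" "continuous_on {0..T} ph'"
        using semidiscrete_regularity[OF _ _ _ _ H eq] fd by auto
      have der: "(uh has_vector_derivative uh' \<tau>) (at \<tau> within {s..t})"
        "(ph has_vector_derivative ph' \<tau>) (at \<tau> within {s..t})" if \<tau>: "\<tau> \<in> {s..t}" for \<tau>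
      proof -
        have \<tau>': "\<tau> \<in> {0..T}" using \<tau> sub by blast
        show "(uh has_vector_derivative uh' \<tau>) (at \<tau> within {s..t})"
          by (rule has_vector_derivative_within_subset[OF has_vector_derivative_H1_time[OF _ H(1) reg(1) \<tau>'] sub])
            (use fd in blast)
        show "(ph has_vector_derivative ph' \<tau>) (at \<tau> within {s..t})"
          by (rule has_vector_derivative_within_subset[OF has_vector_derivative_H1_time[OF _ H(2) reg(2) \<tau>'] sub])
            (use fd in blast)
      qed
      show "(norm (uh t - us))\<^sup>2 + (norm (ph t - ps))\<^sup>2
        \<le> C * exp (- \<gamma> * (t - s)) * ((norm (uh s - us))\<^sup>2 + (norm (ph s - ps))\<^sup>2)"
      \<comment> \<open>Subtracting the discrete stationary equations removes \<open>f\<close> and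
        \<open>g\<close>, while the time derivatives remain those of \<open>uh\<close> and
        \<open>ph\<close>.\<close>
      proof (rule decay_h[of s t Vh Qh "\<lambda>\<tau>. uh \<tau> - us" uh' "\<lambda>\<tau>. ph \<tau> - ps" ph'])
        fix \<tau> assume \<tau>: "\<tau> \<in> {s..t}"
        then have \<tau>': "\<tau> \<in> {0..T}" using sub by blast
        show "((\<lambda>\<tau>. uh \<tau> - us) has_vector_derivative uh' \<tau>) (at \<tau> within {s..t})"
          "((\<lambda>\<tau>. ph \<tau> - ps) has_vector_derivative ph' \<tau>) (at \<tau> within {s..t})"
          using has_vector_derivative_diff[OF der(1)[OF \<tau>] has_vector_derivative_const]
            has_vector_derivative_diff[OF der(2)[OF \<tau>] has_vector_derivative_const] by simp_all
        show "uh \<tau> - us \<in> Vh" "ph \<tau> - ps \<in> Qh"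
          using mem[OF \<tau>] ss(1,2) unfolding B by (auto intro: span_diff)
        show "inner (c \<odot> uh' \<tau>) v - inner (ph \<tau> - ps) (dx E l v) + inner (a \<odot> (uh \<tau> - us)) v = 0" if v: "v \<in> Vh" for v
          using eq(1)[OF \<tau>' v] ss(3)[OF v] by (simp add: ma.diff inner_diff_left)
        show "inner (b \<odot> ph' \<tau>) r + inner (dx E l (uh \<tau> - us)) r = 0" if r: "r \<in> Qh" for r
          using eq(2)[OF \<tau>' r] ss(4)[OF r] VH mem(1)[OF \<tau>] ss(1) by (simp add: dx_diff inner_diff_left)
      qed (use st fd in auto)
    qed
  qed
qed

end
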